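(* Let $(\Theta,I,\mathbf p)$ be a parametrized statistical model on the finite weighted graph $(I,E,\omega)$, let $q\in\mathcal P_+(I)$ be a reference measure, and let $\kappa\in\mathbb R$ (all notions as specified in the context). Assume $\Theta$ is a compact set. Then $\operatorname{Ric}(\Theta,I,\mathbf p)\ge\kappa$ holds if and only if for any $\theta\in\Theta$, $$G_F(\theta)+\sum_{i\in I}d_{\theta\theta}p_i(\theta)\,\log\frac{p_i(\theta)}{q_i}-\sum_{k=1}^d \Gamma^{W,k}(\theta)\,\frac{\partial}{\partial\theta_k}\operatorname{D}_{\operatorname{KL}}(p(\theta)\|q)\ \succeq\ \kappa\, G_W(\theta).$$ Here $d_{\theta\theta}p_i(\theta)=\big(\frac{\partial^2p_i}{\partial\theta_a\partial\theta_b}\big)_{1\le a,b\le d}$ is the second differential of the parametrization; $G_F(\theta)=(G_F(\theta)_{ab})_{1\le a,b\le d}$ is the Fisher-Rao metric tensor $$G_F(\theta)_{ab}=\sum_{i\in I}\frac{\partial\log p_i(\theta)}{\partial\theta_a}\frac{\partial\log p_i(\theta)}{\partial\theta_b}\,p_i(\theta);$$ $\Gamma^{W,k}=(\Gamma^{W,k}_{ij})_{1\le i,j\le d}$ is the Wasserstein Christoffel symbol $$\Gamma^{W,k}_{ij}=\frac12\sum_{l=1}^d (G_W^{-1})_{kl}\Big(\partial_{\theta_i}G_{W,jl}+\partial_{\theta_j}G_{W,il}-\partial_{\theta_l}G_{W,ij}\Big);$$ and $G_W(\theta)$ is the $L^2$-Wasserstein metric tensor on parameter space.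
   Context: **Graph.** $I=\{1,\dots,n\}$ is the discrete sample space, and $(I,E,\omega)$ is a connected undirected graph with weights $\omega_{ij}=\omega_{ji}>0$ if $(i,j)\in E$ and $\omega_{ij}=0$ otherwise. $N(i)$ is the set of neighbors of $i$, and $d_i=\frac{\sum_{j\in N(i)}\omega_{ij}}{\sum_{k=1}^n\sum_{j\in N(k)}\omega_{kj}}$. $\mathcal P_+(I)=\{p\in\mathbb R^n: \sum_i p_i=1,\ p_i>0\}$. For $p\in\mathcal P_+(I)$, $L(p)\in\mathbb R^{n\times n}$ is the weighted graph Laplacian, i.e. the symmetric matrix with quadratic form (sum over undirected edges) $$\Phi^{\mathsf T}L(p)\Phi=\sum_{(i,j)\in E}\omega_{ij}(\Phi_i-\Phi_j)^2\,\tfrac12\Big(\frac{p_i}{d_i}+\frac{p_j}{d_j}\Big),$$ and $L(p)^\dagger$ is its pseudo-inverse. **Model.** $\Theta\subset\mathbb R^d$, $d\le n-1$, is the parameter space, and $\mathbf p:\Theta\to\mathcal P_+(I)$, $\theta\mapsto p(\theta)=(p_i(\theta))_{i=1}^n$, is the parametrization. Its Jacobi matrix $J_\theta p(\theta)=(\partial p_i/\partial\theta_j)\in\mathbb R^{n\times d}$ is assumed to have rank $d$. **Wasserstein metric on $\Theta$.** $G_W(\theta)=J_\theta p(\theta)^{\mathsf T}L(p(\theta))^\dagger J_\theta p(\theta)$, $g^W_\theta(a,b)=a^{\mathsf T}G_W(\theta)b$ for $a,b\in\mathbb R^d$, and $$d_W(\theta_0,\theta_1)^2=\inf\Big\{\int_0^1\dot\theta(t)^{\mathsf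 T}G_W(\theta(t))\dot\theta(t)\,dt:\ \theta\in C^1([0,1],\Theta),\ \theta(0)=\theta_0,\ \theta(1)=\theta_1\Big\}.$$ **KL divergence.** $\operatorname{D}_{\operatorname{KL}}(p\|q)=\sum_{i=1}^n p_i\log\frac{p_i}{q_i}$. **Ricci curvature lower bound.** $\operatorname{Ric}(\Theta,I,\mathbf p)\ge\kappa$ (with respect to $q$) means: for any constant speed geodesic $\theta_t$, $t\in[0,1]$, connecting $\theta_0,\theta_1$ in $(\Theta,g^W)$, it holds that $$\operatorname{D}_{\operatorname{KL}}(p(\theta_t)\|q)\le(1-t)\operatorname{D}_{\operatorname{KL}}(p(\theta_0)\|q)+t\operatorname{D}_{\operatorname{KL}}(p(\theta_1)\|q)-\frac\kappa2t(1-t)\,d_W(\theta_0,\theta_1)^2.$$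
   Formalization: Θ is assumed to lie in the closure of its interior (false e.g. for a one-point Θ), p is C² on a neighborhood of Θ, and constant speed geodesics are minimizing curves that solve the geodesic equation of g^W, so minimizers bent along the boundary of a nonconvex Θ are excluded. *)

theory Defs
  imports "HOL-Analysis.Analysis"
begin

section \<open>Weighted graphs and the graph Laplacian\<close>

text \<open>
  The sample space is a finite type \<open>'n\<close>. An undirected edge is represented by both of its
  orientations in \<open>E\<close>.
\<close>

definition weighted_graph :: "('n::finite \<times> 'n) set \<Rightarrow> real^'n^'n \<Rightarrow> bool" where
  "weighted_graph E w \<longleftrightarrow>
     sym E \<and> (\<forall>i j. (i, j) \<in> E\<^sup>*) \<and>
     (\<forall>i j. w $ i $ j = w $ j $ i) \<and>
     (\<forall>i j. if (i, j) \<in> E then 0 < w $ i $ j else w $ i $ j = 0)"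

definition neighbors :: "('n::finite \<times> 'n) set \<Rightarrow> 'n \<Rightarrow> 'n set" where
  "neighbors E i = {j. (i, j) \<in> E}"

definition node_deg :: "('n::finite \<times> 'n) set \<Rightarrow> real^'n^'n \<Rightarrow> 'n \<Rightarrow> real" where
  "node_deg E w i =
     (\<Sum>j\<in>neighbors E i. w $ i $ j) / (\<Sum>k\<in>UNIV. \<Sum>j\<in>neighbors E k. w $ k $ j)"

definition pos_simplex :: "(real^'n::finite) set" where
  "pos_simplex = {p. (\<Sum>i\<in>UNIV. p $ i) = 1 \<and> (\<forall>i. 0 < p $ i)}"

definition edge_weight :: "('n::finite \<times> 'n) set \<Rightarrow> real^'n^'n \<Rightarrow> real^'n \<Rightarrow> 'n \<Rightarrow> 'n \<Rightarrow> real" where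
  "edge_weight E w p i j =
     w $ i $ j * (1/2 * (p $ i / node_deg E w i + p $ j / node_deg E w j))"

definition laplacian :: "('n::finite \<times> 'n) set \<Rightarrow> real^'n^'n \<Rightarrow> real^'n \<Rightarrow> real^'n^'n" where
  "laplacian E w p =
     (\<chi> i j. (if i = j then \<Sum>k\<in>neighbors E i. edge_weight E w p i k else 0)
            - (if (i, j) \<in> E then edge_weight E w p i j else 0))"

text \<open>
  The next two lemmas characterize the Laplacian as the symmetric matrix of the Dirichlet form;
  the factor \<open>1/2\<close> turns the sum over ordered pairs into a sum over undirected edges.
\<close>

lemma laplacian_symmetric:
  assumes "weighted_graph E w"
  shows "transpose (laplacian E w p) = laplacian E w p"
proof -
  have "(i, j) \<in> E \<longleftrightarrow> (j, i) \<in> E" for i j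
    using assms by (auto simp: weighted_graph_def dest: symD)
  moreover have "edge_weight E w p i j = edge_weight E w p j i" for i j
    using assms by (simp add: weighted_graph_def edge_weight_def add.commute)
  ultimately show ?thesis
    by (auto simp: transpose_def laplacian_def vec_eq_iff)
qed

lemma laplacian_quadratic_form:
  assumes "weighted_graph E w"
  shows "\<Phi> \<bullet> (laplacian E w p *v \<Phi>) =
    1/2 * (\<Sum>(i, j)\<in>E. w $ i $ j * (\<Phi> $ i - \<Phi> $ j)\<^sup>2 *
       (1/2 * (p $ i / node_deg E w i + p $ j / node_deg E w j)))"
proof -
  define a where "a i j = (if (i, j) \<in> E then edge_weight E w p i j else 0)" for i j
  have a_sym: "a i j = a j i" for i j
    using assms by (auto simp: a_def weighted_graph_def edge_weight_def add.commute dest: symD)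
  have nb: "(\<Sum>k\<in>neighbors E i. edge_weight E w p i k) = (\<Sum>k\<in>UNIV. a i k)" for i
    by (rule sum.mono_neutral_cong_left) (auto simp: neighbors_def a_def)
  have row: "(laplacian E w p *v \<Phi>) $ i
      = (\<Sum>k\<in>UNIV. a i k) * \<Phi> $ i - (\<Sum>j\<in>UNIV. a i j * \<Phi> $ j)" for i
  proof -
    have "(laplacian E w p *v \<Phi>) $ i
        = (\<Sum>j\<in>UNIV. (if i = j then (\<Sum>k\<in>UNIV. a i k) * \<Phi> $ j else 0) - a i j * \<Phi> $ j)"
      unfolding matrix_vector_mult_def laplacian_def vec_lambda_beta nb a_def[symmetric]
      by (intro sum.cong) (auto simp: left_diff_distrib)
    then show ?thesis
      by (simp add: sum_subtractf)
  qed
  have lhs: "\<Phi> \<bullet> (laplacian E w p *v \<Phi>)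
      = (\<Sum>i\<in>UNIV. \<Sum>j\<in>UNIV. a i j * (\<Phi> $ i)\<^sup>2) - (\<Sum>i\<in>UNIV. \<Sum>j\<in>UNIV. a i j * (\<Phi> $ i * \<Phi> $ j))"
    by (simp add: inner_vec_def row sum_subtractf right_diff_distrib sum_distrib_left
        sum_distrib_right power2_eq_square mult_ac)
  have swap: "(\<Sum>i\<in>UNIV. \<Sum>j\<in>UNIV. a i j * (\<Phi> $ j)\<^sup>2) = (\<Sum>i\<in>UNIV. \<Sum>j\<in>UNIV. a i j * (\<Phi> $ i)\<^sup>2)"
    by (subst sum.swap) (simp add: a_sym)
  have "(\<Sum>(i, j)\<in>E. w $ i $ j * (\<Phi> $ i - \<Phi> $ j)\<^sup>2 *
       (1/2 * (p $ i / node_deg E w i + p $ j / node_deg E w j)))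
      = (\<Sum>(i, j)\<in>UNIV. a i j * (\<Phi> $ i - \<Phi> $ j)\<^sup>2)"
    by (rule sum.mono_neutral_cong_left) (auto simp: a_def edge_weight_def mult_ac)
  also have "\<dots> = (\<Sum>i\<in>UNIV. \<Sum>j\<in>UNIV. a i j * (\<Phi> $ i - \<Phi> $ j)\<^sup>2)"
    by (simp add: sum.cartesian_product)
  also have "\<dots> = (\<Sum>i\<in>UNIV. \<Sum>j\<in>UNIV. a i j * (\<Phi> $ i)\<^sup>2 + a i j * (\<Phi> $ j)\<^sup>2
                      - 2 * (a i j * (\<Phi> $ i * \<Phi> $ j)))"
    by (intro sum.cong refl) (simp add: power2_eq_square algebra_simps)
  also have "\<dots> = 2 * (\<Phi> \<bullet> (laplacian E w p *v \<Phi>))"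
    by (simp add: sum.distrib sum_subtractf swap lhs flip: sum_distrib_left)
  finally show ?thesis
    by simp
qed

section \<open>Moore--Penrose pseudo-inverse\<close>

definition is_pinv :: "real^'n::finite^'m::finite \<Rightarrow> real^'m^'n \<Rightarrow> bool" where
  "is_pinv A X \<longleftrightarrow>
     A ** X ** A = A \<and> X ** A ** X = X \<and>
     transpose (A ** X) = A ** X \<and> transpose (X ** A) = X ** A"

definition pinv :: "real^'n::finite^'m::finite \<Rightarrow> real^'m^'n" where
  "pinv A = (THE X. is_pinv A X)"

lemma is_pinv_unique:
  assumes X: "is_pinv A X" and Y: "is_pinv A Y"
  shows "X = Y"
proof -
  have "A ** X = (A ** Y) ** (A ** X)"
    using Y by (simp add: is_pinv_def matrix_mul_assoc)
  also have "\<dots> = transpose ((A ** X) ** (A ** Y))"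
    using X Y by (simp add: is_pinv_def matrix_transpose_mul)
  also have "(A ** X) ** (A ** Y) = A ** Y"
    using X by (simp add: is_pinv_def matrix_mul_assoc)
  finally have AX: "A ** X = A ** Y"
    using Y by (simp add: is_pinv_def)
  have "X ** A = (X ** A) ** (Y ** A)"
    using Y by (metis is_pinv_def matrix_mul_assoc)
  also have "\<dots> = transpose ((Y ** A) ** (X ** A))"
    using X Y by (simp add: is_pinv_def matrix_transpose_mul)
  also have "(Y ** A) ** (X ** A) = Y ** A"
    using X by (metis is_pinv_def matrix_mul_assoc)
  finally have XA: "X ** A = Y ** A"
    using Y by (simp add: is_pinv_def)
  have "X = X ** A ** X"
    using X by (simp add: is_pinv_def)
  also have "\<dots> = Y ** A ** X"
    by (simp add: XA)
  also have "\<dots> = Y ** (A ** Y)"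
    by (simp add: AX flip: matrix_mul_assoc)
  also have "\<dots> = Y"
    using Y by (simp add: is_pinv_def matrix_mul_assoc)
  finally show ?thesis .
qed

lemma pinv_eqI: "is_pinv A X \<Longrightarrow> pinv A = X"
  unfolding pinv_def using is_pinv_unique by blast

section \<open>Parametrized statistical models\<close>

definition C2_on :: "'a::real_normed_vector set \<Rightarrow> ('a \<Rightarrow> 'b::real_normed_vector) \<Rightarrow> bool" where
  "C2_on U f \<longleftrightarrow>
     (\<exists>(f' :: 'a \<Rightarrow> 'a \<Rightarrow>\<^sub>L 'b) (f'' :: 'a \<Rightarrow> 'a \<Rightarrow>\<^sub>L 'a \<Rightarrow>\<^sub>L 'b).
        (\<forall>x\<in>U. (f has_derivative blinfun_apply (f' x)) (at x) \<and>
                (f' has_derivative blinfun_apply (f'' x)) (at x)) \<and>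
        continuous_on U f'')"

text \<open>
  The parameter space is a full-dimensional domain that may contain boundary points; as usual, the
  parametrization is twice continuously differentiable on such a set if it is so on an open
  neighborhood of it. Only the values on \<open>\<Theta>\<close> are required to be probability vectors. The
  derivatives at boundary points are independent of the extension, since they are the limits of
  those at interior points.
\<close>

definition parametrized_model :: "(real^'d::finite) set \<Rightarrow> (real^'d \<Rightarrow> real^'n::finite) \<Rightarrow> bool" where
  "parametrized_model \<Theta> p \<longleftrightarrow>
     \<Theta> \<subseteq> closure (interior \<Theta>) \<and>
     (\<exists>U. open U \<and> \<Theta> \<subseteq> U \<and> C2_on U p) \<and>
     CARD('d) \<le> CARD('n) - 1 \<and>
     (\<forall>\<theta>\<in>\<Theta>. p \<theta> \<in> pos_simplex \<and> rank (jacobian p (at \<theta>)) = CARD('d))"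

definition partial :: "'d::finite \<Rightarrow> (real^'d \<Rightarrow> real) \<Rightarrow> real^'d \<Rightarrow> real" where
  "partial k f \<theta> = deriv (\<lambda>h. f (\<theta> + h *\<^sub>R axis k 1)) 0"

definition KL :: "real^'n::finite \<Rightarrow> real^'n \<Rightarrow> real" where
  "KL p q = (\<Sum>i\<in>UNIV. p $ i * ln (p $ i / q $ i))"

definition hess_p :: "(real^'d::finite \<Rightarrow> real^'n::finite) \<Rightarrow> 'n \<Rightarrow> real^'d \<Rightarrow> real^'d^'d" where
  "hess_p p i \<theta> = (\<chi> a b. partial a (partial b (\<lambda>\<eta>. p \<eta> $ i)) \<theta>)"

definition fisher_metric :: "(real^'d::finite \<Rightarrow> real^'n::finite) \<Rightarrow> real^'d \<Rightarrow> real^'d^'d" where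
  "fisher_metric p \<theta> =
     (\<chi> a b. \<Sum>i\<in>UNIV. partial a (\<lambda>\<eta>. ln (p \<eta> $ i)) \<theta> * partial b (\<lambda>\<eta>. ln (p \<eta> $ i)) \<theta> * p \<theta> $ i)"

section \<open>The Wasserstein metric on the parameter space\<close>

definition wass_metric ::
  "('n::finite \<times> 'n) set \<Rightarrow> real^'n^'n \<Rightarrow> (real^'d::finite \<Rightarrow> real^'n) \<Rightarrow> real^'d \<Rightarrow> real^'d^'d" where
  "wass_metric E w p \<theta> =
     transpose (jacobian p (at \<theta>)) ** pinv (laplacian E w (p \<theta>)) ** jacobian p (at \<theta>)"

definition wass_inner ::
  "('n::finite \<times> 'n) set \<Rightarrow> real^'n^'n \<Rightarrow> (real^'d::finite \<Rightarrow> real^'n) \<Rightarrow> real^'d \<Rightarrow> real^'d \<Rightarrow> real^'d \<Rightarrow> real"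
  where
  "wass_inner E w p \<theta> a b = a \<bullet> (wass_metric E w p \<theta> *v b)"

definition christoffel ::
  "('n::finite \<times> 'n) set \<Rightarrow> real^'n^'n \<Rightarrow> (real^'d::finite \<Rightarrow> real^'n) \<Rightarrow> 'd \<Rightarrow> real^'d \<Rightarrow> real^'d^'d" where
  "christoffel E w p k \<theta> =
     (\<chi> i j. 1/2 * (\<Sum>l\<in>UNIV. matrix_inv (wass_metric E w p \<theta>) $ k $ l *
        (partial i (\<lambda>\<eta>. wass_metric E w p \<eta> $ j $ l) \<theta>
         + partial j (\<lambda>\<eta>. wass_metric E w p \<eta> $ i $ l) \<theta>
         - partial l (\<lambda>\<eta>. wass_metric E w p \<eta> $ i $ j) \<theta>)))"

definition C1_curve :: "'a::real_normed_vector set \<Rightarrow> (real \<Rightarrow> 'a) \<Rightarrow> (real \<Rightarrow> 'a) \<Rightarrow> bool" where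
  "C1_curve \<Theta> \<gamma> \<gamma>' \<longleftrightarrow>
     (\<forall>t\<in>{0..1}. \<gamma> t \<in> \<Theta> \<and> (\<gamma> has_vector_derivative \<gamma>' t) (at t within {0..1})) \<and>
     continuous_on {0..1} \<gamma>'"

text \<open>
  As an infimum in \<open>real\<close>, the distance is meaningful only for points that can be joined by a
  \<open>C\<^sup>1\<close> curve in \<open>\<Theta>\<close>; below it is only applied to the endpoints of such a curve.
\<close>

definition wass_dist ::
  "('n::finite \<times> 'n) set \<Rightarrow> real^'n^'n \<Rightarrow> (real^'d::finite) set \<Rightarrow> (real^'d \<Rightarrow> real^'n)
     \<Rightarrow> real^'d \<Rightarrow> real^'d \<Rightarrow> real" where
  "wass_dist E w \<Theta> p \<theta>0 \<theta>1 =
     sqrt (Inf {integral {0..1} (\<lambda>t. wass_inner E w p (\<gamma> t) (\<gamma>' t) (\<gamma>' t)) | \<gamma> \<gamma>'.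
                  C1_curve \<Theta> \<gamma> \<gamma>' \<and> \<gamma> 0 = \<theta>0 \<and> \<gamma> 1 = \<theta>1})"

text \<open>
  A constant speed geodesic on \<open>[0,1]\<close> in the sense of optimal transport: a solution of the
  geodesic equation of the Riemannian metric which is minimizing, i.e. whose constant speed equals
  the distance of its endpoints. For nonconvex \<open>\<Theta>\<close>, a shortest curve that is bent around the
  boundary of \<open>\<Theta>\<close> violates the geodesic equation and is not a geodesic of the metric.
\<close>

definition const_speed_geodesic ::
  "('n::finite \<times> 'n) set \<Rightarrow> real^'n^'n \<Rightarrow> (real^'d::finite) set \<Rightarrow> (real^'d \<Rightarrow> real^'n)
     \<Rightarrow> (real \<Rightarrow> real^'d) \<Rightarrow> bool" where
  "const_speed_geodesic E w \<Theta> p \<gamma> \<longleftrightarrow>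
     (\<exists>\<gamma>'. C1_curve \<Theta> \<gamma> \<gamma>' \<and>
        (\<forall>t\<in>{0..1}.
           (\<gamma>' has_vector_derivative (\<chi> k. - (\<gamma>' t \<bullet> (christoffel E w p k (\<gamma> t) *v \<gamma>' t))))
             (at t within {0..1})) \<and>
        (\<forall>t\<in>{0..1}. sqrt (wass_inner E w p (\<gamma> t) (\<gamma>' t) (\<gamma>' t)) = wass_dist E w \<Theta> p (\<gamma> 0) (\<gamma> 1)))"

definition Ric_ge ::
  "('n::finite \<times> 'n) set \<Rightarrow> real^'n^'n \<Rightarrow> (real^'d::finite) set \<Rightarrow> (real^'d \<Rightarrow> real^'n)
     \<Rightarrow> real^'n \<Rightarrow> real \<Rightarrow> bool" where
  "Ric_ge E w \<Theta> p q \<kappa> \<longleftrightarrow>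
     (\<forall>\<gamma>. const_speed_geodesic E w \<Theta> p \<gamma> \<longrightarrow>
        (\<forall>t\<in>{0..1}. KL (p (\<gamma> t)) q \<le>
           (1 - t) * KL (p (\<gamma> 0)) q + t * KL (p (\<gamma> 1)) q
           - \<kappa> / 2 * t * (1 - t) * (wass_dist E w \<Theta> p (\<gamma> 0) (\<gamma> 1))\<^sup>2))"

definition loewner_ge :: "real^'d::finite^'d \<Rightarrow> real^'d^'d \<Rightarrow> bool" (infix "\<succeq>" 50) where
  "A \<succeq> B \<longleftrightarrow> (\<forall>v. 0 \<le> v \<bullet> ((A - B) *v v))"

end

theory Submission
  imports Defs "HOL-Complex_Analysis.Great_Picard"
begin

text \<open>
  Along a geodesic \<open>\<gamma>\<close>, the second derivative of \<open>f(t) = KL(p(\<gamma> t) | q)\<close> is the quadratic form of the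
  left-hand matrix at \<open>\<gamma>'\<close>, and \<open>\<gamma>'\<^sup>T G\<^sub>W \<gamma>'\<close> is the squared distance of the endpoints, so the matrix
  inequality gives the convexity inequality.

  For the converse, \<open>p\<close> is only \<open>C\<^sup>2\<close>, hence \<open>G\<^sub>W\<close> is only \<open>C\<^sup>1\<close>: solutions of the geodesic equation
  are neither unique nor locally minimizing. Minimizing geodesics are therefore obtained by the
  direct method. Minimizers of a discrete energy satisfy a discrete Euler--Lagrange equation, which
  bounds the increments of position and momentum \<open>G\<^sub>W \<gamma>'\<close>; by the Arzela--Ascoli theorem they
  converge to a minimizing solution of the geodesic equation. Between an interior point \<open>\<theta>\<close> and
  \<open>\<theta> + s v\<close> this geodesic has velocity \<open>s v + O(s\<^sup>2)\<close>, so a vector \<open>v\<close> violating the matrix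
  inequality would contradict convexity for small \<open>s\<close>. Boundary points follow by continuity.
\<close>

section \<open>Continuously differentiable functions and matrix inverses\<close>

text \<open>The compactness argument runs on the momentum because the discrete energy controls only
  the mean square of the velocities. The Euler-Lagrange equation turns exactly this quantity into a
  bound for the total variation of the momentum, hence into a sup bound, and ellipticity of the
  metric carries it over to the velocities. Minimization takes place in a small ball of radius
  \<open>r\<close> with ellipticity constants \<open>l\<close> and \<open>L\<close>. Two constraints
  must turn out inactive: the minimizing chain must not touch the sphere, as the Euler-Lagrange
  equation would fail there, and a competitor in \<open>\<Theta>\<close> that leaves the ball must
  not be cheaper. Both follow if the end point \<open>y\<close> satisfies
  \<open>L |y - c|^2 < l r^2\<close>: the straight segment costs at most the left-hand side, a curve
  reaching the sphere at least the right-hand side. The extension of \<open>p\<close> outside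
  \<open>\<Theta>\<close> need not sum to one. That the first and second derivatives of the
  \<open>p i\<close> sum to zero is therefore derived in the interior and extended to
  \<open>\<Theta>\<close> by continuity, and positive definiteness of the metric is available on
  \<open>\<Theta>\<close> only.\<close>

lemma bounded_bilinear_matrix_vector_mult:
  "bounded_bilinear ((*v) :: real^'n::finite^'m::finite \<Rightarrow> real^'n \<Rightarrow> real^'m)"
proof -
  have "linear (\<lambda>A :: real^'n^'m. A *v x)" for x
    by (rule linearI)
      (simp_all add: matrix_vector_mult_add_rdistrib scaleR_matrix_vector_assoc)
  then have "bilinear ((*v) :: real^'n^'m \<Rightarrow> real^'n \<Rightarrow> real^'m)"
    by (simp add: bilinear_def)
  then show ?thesis
    by (simp add: bilinear_conv_bounded_bilinear)
qed

lemmas continuous_on_matrix_vector_mult [continuous_intros] =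
  bounded_bilinear.continuous_on [OF bounded_bilinear_matrix_vector_mult]

lemma matrix_inv_mult:
  fixes A :: "real^'d::finite^'d"
  assumes "det A \<noteq> 0"
  shows "A ** matrix_inv A = mat 1" and "matrix_inv A ** A = mat 1"
proof -
  have "\<exists>B. A ** B = mat 1 \<and> B ** A = mat 1"
    using assms invertible_det_nz invertible_def by blast
  then have "A ** matrix_inv A = mat 1 \<and> matrix_inv A ** A = mat 1"
    unfolding matrix_inv_def by (rule someI_ex)
  then show "A ** matrix_inv A = mat 1" and "matrix_inv A ** A = mat 1"
    by auto
qed

lemma matrix_inv_mult_vector:
  fixes A :: "real^'d::finite^'d"
  assumes "det A \<noteq> 0"
  shows "A *v (matrix_inv A *v x) = x" and "matrix_inv A *v (A *v x) = x"
  using matrix_inv_mult [OF assms] by (simp_all add: matrix_vector_mul_assoc)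

text \<open>Exhibits the entries of the inverse as quotients of polynomials in the entries of
  \<open>A\<close>, so that continuity and \<open>C1_on\<close> pass to the inverse.\<close>

lemma matrix_inv_cramer:
  fixes A :: "real^'d::finite^'d"
  assumes "det A \<noteq> 0"
  shows "matrix_inv A $ k $ l
    = det (\<chi> i j. if j = k then axis l 1 $ i else A $ i $ j) / det A"
proof -
  have "A *v (matrix_inv A *v axis l 1) = axis l 1"
    using assms by (rule matrix_inv_mult_vector)
  then have "(matrix_inv A *v axis l 1) $ k
      = det (\<chi> i j. if j = k then axis l 1 $ i else A $ i $ j) / det A"
    using cramer [OF assms, of "matrix_inv A *v axis l 1" "axis l 1"] by simp
  moreover have "(matrix_inv A *v axis l 1) $ k = matrix_inv A $ k $ l"
    by (simp add: matrix_vector_mult_basis column_def)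
  ultimately show ?thesis
    by simp
qed

lemma det_nonzero_if_kernel_trivial:
  fixes A :: "real^'d::finite^'d"
  assumes "\<And>x. A *v x = 0 \<Longrightarrow> x = 0"
  shows "det A \<noteq> 0"
  using assms matrix_left_invertible_ker [of A] invertible_left_inverse invertible_det_nz by blast

lemma det_nonzero_if_posdef:
  fixes A :: "real^'d::finite^'d"
  assumes "\<And>x. x \<noteq> 0 \<Longrightarrow> 0 < x \<bullet> (A *v x)"
  shows "det A \<noteq> 0"
  by (rule det_nonzero_if_kernel_trivial) (metis assms inner_zero_right less_irrefl)

text \<open>Continuity of the derivative is asked for each fixed direction \<open>h\<close>; in
  finite dimension this amounts to continuity in operator norm and reduces to continuity of the
  partial derivatives.\<close>

definition C1_on :: "(real^'d::finite) set \<Rightarrow> (real^'d \<Rightarrow> real) \<Rightarrow> bool" where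
  "C1_on W f \<longleftrightarrow>
     (\<exists>f'. (\<forall>x\<in>W. (f has_derivative f' x) (at x)) \<and> (\<forall>h. continuous_on W (\<lambda>x. f' x h)))"

lemma C1_onE:
  assumes "C1_on W f"
  obtains f' where "\<And>x. x \<in> W \<Longrightarrow> (f has_derivative f' x) (at x)"
    and "\<And>h. continuous_on W (\<lambda>x. f' x h)"
  using assms unfolding C1_on_def by blast

lemma C1_on_subset: "C1_on W f \<Longrightarrow> V \<subseteq> W \<Longrightarrow> C1_on V f"
  unfolding C1_on_def by (meson continuous_on_subset subsetD)

lemma C1_on_imp_continuous_on: "C1_on W f \<Longrightarrow> continuous_on W f"
  by (meson C1_onE continuous_at_imp_continuous_on has_derivative_continuous)

lemma C1_on_cong:
  assumes "C1_on W f" "open W" "\<And>x. x \<in> W \<Longrightarrow> g x = f x"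
  shows "C1_on W g"
proof -
  obtain f' where f': "\<And>x. x \<in> W \<Longrightarrow> (f has_derivative f' x) (at x)"
    "\<And>h. continuous_on W (\<lambda>x. f' x h)"
    using assms(1) by (rule C1_onE) blast
  have "(g has_derivative f' x) (at x)" if "x \<in> W" for x
    by (rule has_derivative_transform_within_open [OF f'(1)]) (use that assms in auto)
  then show ?thesis
    unfolding C1_on_def using f'(2) by (intro exI [of _ f']) auto
qed

lemma C1_on_const: "C1_on W (\<lambda>x. c)"
  unfolding C1_on_def by (intro exI [of _ "\<lambda>x h. 0"]) auto

lemma C1_on_add:
  assumes "C1_on W f" "C1_on W g"
  shows "C1_on W (\<lambda>x. f x + g x)"
proof -
  obtain f' where f': "\<And>x. x \<in> W \<Longrightarrow> (f has_derivative f' x) (at x)"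
    "\<And>h. continuous_on W (\<lambda>x. f' x h)"
    using assms(1) by (rule C1_onE) blast
  obtain g' where g': "\<And>x. x \<in> W \<Longrightarrow> (g has_derivative g' x) (at x)"
    "\<And>h. continuous_on W (\<lambda>x. g' x h)"
    using assms(2) by (rule C1_onE) blast
  show ?thesis
    unfolding C1_on_def using f' g'
    by (intro exI [of _ "\<lambda>x h. f' x h + g' x h"]) (auto intro!: derivative_intros continuous_intros)
qed

lemma C1_on_mult:
  assumes "C1_on W f" "C1_on W g"
  shows "C1_on W (\<lambda>x. f x * g x)"
proof -
  obtain f' where f': "\<And>x. x \<in> W \<Longrightarrow> (f has_derivative f' x) (at x)"
    "\<And>h. continuous_on W (\<lambda>x. f' x h)"
    using assms(1) by (rule C1_onE) blast
  obtain g' where g': "\<And>x. x \<in> W \<Longrightarrow> (g has_derivative g' x) (at x)"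
    "\<And>h. continuous_on W (\<lambda>x. g' x h)"
    using assms(2) by (rule C1_onE) blast
  show ?thesis
    unfolding C1_on_def using f' g'
    by (intro exI [of _ "\<lambda>x h. f x * g' x h + f' x h * g x"])
      (auto intro!: has_derivative_mult continuous_intros assms [THEN C1_on_imp_continuous_on])
qed

lemma C1_on_diff:
  assumes "C1_on W f" "C1_on W g"
  shows "C1_on W (\<lambda>x. f x - g x)"
  using C1_on_add [OF assms(1) C1_on_mult [OF C1_on_const [of W "-1"] assms(2)]] by simp

lemma C1_on_inverse:
  assumes "C1_on W f" "\<And>x. x \<in> W \<Longrightarrow> f x \<noteq> 0"
  shows "C1_on W (\<lambda>x. inverse (f x))"
proof -
  obtain f' where f': "\<And>x. x \<in> W \<Longrightarrow> (f has_derivative f' x) (at x)"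
    "\<And>h. continuous_on W (\<lambda>x. f' x h)"
    using assms(1) by (rule C1_onE) blast
  show ?thesis
    unfolding C1_on_def using f' assms(2)
    by (intro exI [of _ "\<lambda>x h. - (inverse (f x) * f' x h * inverse (f x))"])
      (auto intro!: has_derivative_inverse continuous_intros assms(1) [THEN C1_on_imp_continuous_on])
qed

lemma C1_on_divide:
  assumes "C1_on W f" "C1_on W g" "\<And>x. x \<in> W \<Longrightarrow> g x \<noteq> 0"
  shows "C1_on W (\<lambda>x. f x / g x)"
  unfolding divide_inverse by (intro C1_on_mult C1_on_inverse assms)

lemma C1_on_ln:
  assumes "C1_on W f" "\<And>x. x \<in> W \<Longrightarrow> 0 < f x"
  shows "C1_on W (\<lambda>x. ln (f x))"
proof -
  obtain f' where f': "\<And>x. x \<in> W \<Longrightarrow> (f has_derivative f' x) (at x)"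
    "\<And>h. continuous_on W (\<lambda>x. f' x h)"
    using assms(1) by (rule C1_onE) blast
  have "((\<lambda>x. ln (f x)) has_derivative (\<lambda>h. f' x h * inverse (f x))) (at x)" if "x \<in> W" for x
    using has_derivative_ln [OF assms(2) f'(1)] that by simp
  moreover have "continuous_on W (\<lambda>x. f' x h * inverse (f x))" for h
    using assms(2) by (intro continuous_intros f' C1_on_imp_continuous_on assms(1)) force
  ultimately show ?thesis
    unfolding C1_on_def by (intro exI [of _ "\<lambda>x h. f' x h * inverse (f x)"]) auto
qed

lemma C1_on_sum:
  assumes "\<And>i. i \<in> I \<Longrightarrow> C1_on W (f i)"
  shows "C1_on W (\<lambda>x. \<Sum>i\<in>I. f i x)"
  using assms by (induction I rule: infinite_finite_induct) (auto intro: C1_on_const C1_on_add)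

lemma C1_on_prod:
  assumes "\<And>i. i \<in> I \<Longrightarrow> C1_on W (f i)"
  shows "C1_on W (\<lambda>x. \<Prod>i\<in>I. f i x)"
  using assms by (induction I rule: infinite_finite_induct) (auto intro: C1_on_const C1_on_mult)

lemma C1_on_det:
  fixes A :: "real^'d::finite \<Rightarrow> real^'n::finite^'n"
  assumes "\<And>i j. C1_on W (\<lambda>x. A x $ i $ j)"
  shows "C1_on W (\<lambda>x. det (A x))"
  unfolding det_def by (intro C1_on_sum C1_on_mult C1_on_const C1_on_prod assms)

lemma C1_on_matrix_inv:
  fixes A :: "real^'d::finite \<Rightarrow> real^'n::finite^'n"
  assumes A: "\<And>i j. C1_on W (\<lambda>x. A x $ i $ j)" and "open W"
    and det: "\<And>x. x \<in> W \<Longrightarrow> det (A x) \<noteq> 0"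
  shows "C1_on W (\<lambda>x. matrix_inv (A x) $ k $ l)"
proof (rule C1_on_cong [OF _ \<open>open W\<close> matrix_inv_cramer [OF det]])
  have "C1_on W (\<lambda>x. (\<chi> i j. if j = k then axis l 1 $ i else A x $ i $ j) $ i $ j)" for i j
    by (cases "j = k") (simp_all add: A C1_on_const)
  then show "C1_on W (\<lambda>x. det (\<chi> i j. if j = k then axis l 1 $ i else A x $ i $ j) / det (A x))"
    by (intro C1_on_divide C1_on_det A det) auto
qed

section \<open>Coordinate partial derivatives and the chain rule along curves\<close>

lemma has_derivative_imp_partial:
  assumes "(f has_derivative f') (at x)"
  shows "partial k f x = f' (axis k 1)"
proof -
  have "((\<lambda>h. f (x + h *\<^sub>R axis k 1)) has_derivative (\<lambda>h. f' (h *\<^sub>R axis k 1))) (at 0)"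
    by (rule has_derivative_compose [where g = f])
      (use assms in \<open>auto intro!: derivative_eq_intros\<close>)
  moreover have "f' (h *\<^sub>R axis k 1) = f' (axis k 1) * h" for h
    using has_derivative_linear [OF assms] by (simp add: linear_cmul)
  ultimately have "((\<lambda>h. f (x + h *\<^sub>R axis k 1)) has_field_derivative f' (axis k 1)) (at 0)"
    by (simp add: has_field_derivative_def)
  then show ?thesis
    unfolding partial_def by (rule DERIV_imp_deriv)
qed

lemma C1_on_has_derivative:
  assumes "C1_on W f" "x \<in> W"
  shows "(f has_derivative (\<lambda>h. \<Sum>k\<in>UNIV. h $ k * partial k f x)) (at x)"
proof -
  obtain f' where f': "(f has_derivative f' x) (at x)"
    using assms by (meson C1_onE)
  have lin: "linear (f' x)"
    using f' by (rule has_derivative_linear)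
  have "f' x h = (\<Sum>k\<in>UNIV. h $ k * partial k f x)" for h
  proof -
    have "f' x h = f' x (\<Sum>k\<in>UNIV. (h $ k) *\<^sub>R axis k 1)"
      using basis_expansion [of h] by (simp add: scalar_mult_eq_scaleR)
    also have "\<dots> = (\<Sum>k\<in>UNIV. h $ k * f' x (axis k 1))"
      using lin by (simp add: linear_sum linear_cmul)
    finally show ?thesis
      by (simp add: has_derivative_imp_partial [OF f'])
  qed
  then show ?thesis
    using f' by (metis (no_types, lifting) ext)
qed

lemma C1_on_partial_continuous:
  assumes "C1_on W f"
  shows "continuous_on W (partial k f)"
proof -
  obtain f' where f': "\<And>x. x \<in> W \<Longrightarrow> (f has_derivative f' x) (at x)"
    "\<And>h. continuous_on W (\<lambda>x. f' x h)"
    using assms by (rule C1_onE) blast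
  show ?thesis
    using f'(2) [of "axis k 1"] by (rule continuous_on_eq) (simp add: has_derivative_imp_partial [OF f'(1)])
qed

text \<open>The derivative of \<open>f\<close> is taken in a full neighborhood, that of the curve
  only within \<open>S\<close>, which covers the end points of \<open>{0..1}\<close>.\<close>

lemma C1_on_chain:
  assumes "C1_on W f" "\<gamma> t \<in> W" "(\<gamma> has_vector_derivative v) (at t within S)"
  shows "((\<lambda>t. f (\<gamma> t)) has_vector_derivative (\<Sum>k\<in>UNIV. v $ k * partial k f (\<gamma> t))) (at t within S)"
proof -
  have "((\<lambda>t. f (\<gamma> t)) has_derivative (\<lambda>h. \<Sum>k\<in>UNIV. (h *\<^sub>R v) $ k * partial k f (\<gamma> t))) (at t within S)"
    using assms(3) unfolding has_vector_derivative_def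
    by (rule has_derivative_compose
        [where g = f and f = \<gamma> and g' = "\<lambda>h. \<Sum>k\<in>UNIV. h $ k * partial k f (\<gamma> t)",
          OF _ C1_on_has_derivative [OF assms(1,2)]])
  then show ?thesis
    by (simp add: has_vector_derivative_def sum_distrib_left mult.assoc)
qed

lemma continuous_on_matrixI:
  assumes "\<And>i j. continuous_on S (\<lambda>x. A x $ i $ j)"
  shows "continuous_on S (A :: 'a::topological_space \<Rightarrow> real^'m::finite^'n::finite)"
proof -
  have "continuous_on S (\<lambda>x. \<chi> i j. A x $ i $ j)"
    by (intro continuous_on_vec_lambda assms)
  then show ?thesis
    by simp
qed

section \<open>Limits of discrete curves\<close>

text \<open>The weight with which the increment of one grid cell enters the interpolant: it rises
  from 0 to 1 across the cell.\<close>

definition ramp :: "real \<Rightarrow> real" where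
  "ramp u = max 0 (min 1 u)"

lemma sum_ramp: "(\<Sum>k<N. ramp (u - real k)) = max 0 (min (real N) u)"
  by (induction N) (auto simp: ramp_def max_def min_def)

lemma ramp_mono: "u \<le> v \<Longrightarrow> ramp u \<le> ramp v"
  by (auto simp: ramp_def)

text \<open>\<open>f t - f s\<close> combines the steps with weights \<open>w k\<close>, nonnegative
  because \<open>ramp\<close> is monotone and, by \<open>sum_ramp\<close>, of total at most
  \<open>N (t - s)\<close>. This gives the Lipschitz bound without locating \<open>s\<close> and
  \<open>t\<close> in grid cells.\<close>

lemma lipschitz_interpolation:
  fixes a :: "nat \<Rightarrow> 'a::real_normed_vector"
  assumes "0 < N" "0 \<le> M" and step: "\<And>k. k < N \<Longrightarrow> norm (a (Suc k) - a k) \<le> M / real N"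
  obtains f where "\<And>k. k \<le> N \<Longrightarrow> f (real k / real N) = a k"
    and "\<And>s t. s \<le> t \<Longrightarrow> norm (f t - f s) \<le> M * (t - s)"
proof
  define f where "f t = a 0 + (\<Sum>k<N. ramp (real N * t - real k) *\<^sub>R (a (Suc k) - a k))" for t
  show "f (real j / real N) = a j" if "j \<le> N" for j
  proof -
    \<comment> \<open>At \<open>t = j / N\<close> the weight is 1 for \<open>k < j\<close> and 0 for
      \<open>k \<ge> j\<close>, so a telescoping sum remains.\<close>
    have "(\<Sum>k<N. ramp (real N * (real j / real N) - real k) *\<^sub>R (a (Suc k) - a k))
        = (\<Sum>k<j. a (Suc k) - a k)"
      using that \<open>0 < N\<close> by (intro sum.mono_neutral_cong_right) (auto simp: ramp_def)
    then show ?thesis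
      by (simp add: f_def sum_lessThan_telescope)
  qed
  show "norm (f t - f s) \<le> M * (t - s)" if "s \<le> t" for s t
  proof -
    define w where "w k = ramp (real N * t - real k) - ramp (real N * s - real k)" for k
    have w: "0 \<le> w k" for k
      unfolding w_def using ramp_mono that \<open>0 < N\<close> by (simp add: mult_left_mono)
    have "(\<Sum>k<N. w k) \<le> real N * (t - s)"
    proof -
      have "real N * s \<le> real N * t"
        using that by (simp add: mult_left_mono)
      then show ?thesis
        unfolding w_def sum_subtractf sum_ramp by (auto simp: right_diff_distrib)
    qed
    moreover have "f t - f s = (\<Sum>k<N. w k *\<^sub>R (a (Suc k) - a k))"
      by (simp add: f_def w_def sum_subtractf scaleR_left_diff_distrib)
    moreover have "norm (\<Sum>k<N. w k *\<^sub>R (a (Suc k) - a k)) \<le> (\<Sum>k<N. w k * (M / real N))"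
    proof (rule sum_norm_le)
      fix k
      assume "k \<in> {..<N}"
      then show "norm (w k *\<^sub>R (a (Suc k) - a k)) \<le> w k * (M / real N)"
        using mult_left_mono [OF step [of k] w [of k]] w [of k] by simp
    qed
    ultimately have "norm (f t - f s) \<le> (\<Sum>k<N. w k) * (M / real N)"
      by (metis sum_distrib_right)
    also have "\<dots> \<le> (real N * (t - s)) * (M / real N)"
      using \<open>(\<Sum>k<N. w k) \<le> real N * (t - s)\<close> \<open>0 \<le> M\<close> by (intro mult_right_mono) auto
    finally show ?thesis
      using \<open>0 < N\<close> by (simp add: mult.commute)
  qed
qed

text \<open>The arrays live on different grids, so they are first extended to curves on
  \<open>{0..1}\<close> with the common Lipschitz constant \<open>M\<close>, to which the theorem
  for functions applies. Row \<open>n\<close> has \<open>Suc n\<close> cells, so the mesh is defined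
  for \<open>n = 0\<close> too.\<close>

lemma discrete_Arzela_Ascoli:
  fixes z :: "nat \<Rightarrow> nat \<Rightarrow> 'a::euclidean_space"
  assumes bound: "\<And>n k. k \<le> Suc n \<Longrightarrow> norm (z n k) \<le> B"
    and step: "\<And>n k. k < Suc n \<Longrightarrow> norm (z n (Suc k) - z n k) \<le> M / real (Suc n)"
  obtains g r where "continuous_on {0..1} g" "strict_mono (r :: nat \<Rightarrow> nat)"
    "\<And>e. 0 < e \<Longrightarrow> \<exists>n0. \<forall>n\<ge>n0. \<forall>k\<le>Suc (r n).
       norm (z (r n) k - g (real k / real (Suc (r n)))) < e"
proof -
  have "0 \<le> M"
    using order_trans [OF norm_ge_zero step [of 0 0]] by simp
  have "\<forall>n. \<exists>f. (\<forall>k\<le>Suc n. f (real k / real (Suc n)) = z n k) \<and>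
      (\<forall>s t. s \<le> t \<longrightarrow> norm (f t - f s) \<le> M * (t - s))"
  proof
    fix n
    show "\<exists>f. (\<forall>k\<le>Suc n. f (real k / real (Suc n)) = z n k) \<and>
      (\<forall>s t. s \<le> t \<longrightarrow> norm (f t - f s) \<le> M * (t - s))"
      by (rule lipschitz_interpolation [of "Suc n" M "z n"])
        (use \<open>0 \<le> M\<close> step in \<open>simp_all, blast\<close>)
  qed
  then obtain f where f: "\<And>n k. k \<le> Suc n \<Longrightarrow> f n (real k / real (Suc n)) = z n k"
    and lip: "\<And>n s t. s \<le> t \<Longrightarrow> norm (f n t - f n s) \<le> M * (t - s)"
    by metis
  have lip': "norm (f n s - f n t) \<le> M * norm (s - t)" for n s t
    using lip [of s t n] lip [of t s n] by (cases "s \<le> t") (auto simp: norm_minus_commute)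
  have "norm (f n t) \<le> B + M" if "t \<in> {0..1}" for n t
  proof -
    have "norm (f n t - f n 0) \<le> M * norm (t - 0)"
      by (rule lip')
    also have "\<dots> \<le> M"
      using that \<open>0 \<le> M\<close> by (simp add: mult_left_le)
    finally show ?thesis
      using norm_triangle_sub [of "f n t" "f n 0"] f [of 0 n] bound [of 0 n] by simp
  qed
  moreover have "\<exists>d>0. \<forall>n y. y \<in> {0..1} \<and> norm (x - y) < d \<longrightarrow> norm (f n x - f n y) < e"
    if "0 < e" for x e :: real
  proof (intro exI [of _ "e / (M + 1)"] conjI allI impI)
    show "0 < e / (M + 1)"
      using that \<open>0 \<le> M\<close> by simp
    fix n and y :: real
    assume y: "y \<in> {0..1} \<and> norm (x - y) < e / (M + 1)"
    have "norm (f n x - f n y) \<le> M * norm (x - y)"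
      by (rule lip')
    also have "\<dots> \<le> (M + 1) * norm (x - y)"
      by (simp add: mult_right_mono)
    also have "\<dots> < e"
      using y \<open>0 \<le> M\<close> by (simp add: field_simps)
    finally show "norm (f n x - f n y) < e" .
  qed
  ultimately obtain g r where g: "continuous_on {0..1} g" and r: "strict_mono (r :: nat \<Rightarrow> nat)"
    and conv: "\<And>e. 0 < e \<Longrightarrow> \<exists>N. \<forall>n x. n \<ge> N \<and> x \<in> {0..1} \<longrightarrow> norm (f (r n) x - g x) < e"
    using Arzela_Ascoli [of "{0..1::real}" f "B + M"] by (metis compact_Icc)
  show ?thesis
  proof (rule that [OF g r])
    fix e :: real
    assume "0 < e"
    then obtain n0 where n0: "\<And>n x. n \<ge> n0 \<Longrightarrow> x \<in> {0..1} \<Longrightarrow> norm (f (r n) x - g x) < e"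
      using conv by metis
    have "norm (z (r n) k - g (real k / real (Suc (r n)))) < e" if "n \<ge> n0" "k \<le> Suc (r n)" for n k
      using n0 [OF that(1), of "real k / real (Suc (r n))"] that(2) f [OF that(2)]
      by (simp add: divide_le_eq)
    then show "\<exists>n0. \<forall>n\<ge>n0. \<forall>k\<le>Suc (r n). norm (z (r n) k - g (real k / real (Suc (r n)))) < e"
      by blast
  qed
qed

text \<open>The values \<open>z n k\<close> approximate \<open>g\<close> at the left endpoints \<open>k / N n\<close> of the \<open>n\<close>-th grid.\<close>

definition unif_close ::
  "(nat \<Rightarrow> nat) \<Rightarrow> (nat \<Rightarrow> nat \<Rightarrow> 'a::real_normed_vector) \<Rightarrow> (real \<Rightarrow> 'a) \<Rightarrow> bool" where
  "unif_close N z g \<longleftrightarrow>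
     (\<forall>e>0. \<forall>\<^sub>F n in sequentially. \<forall>k<N n. norm (z n k - g (real k / real (N n))) < e)"

section \<open>Uniform approximation of continuous curves on refining grids\<close>

lemma unif_closeD:
  "unif_close N z g \<Longrightarrow> 0 < e \<Longrightarrow>
    \<forall>\<^sub>F n in sequentially. \<forall>k<N n. norm (z n k - g (real k / real (N n))) < e"
  unfolding unif_close_def by blast

lemma unif_close_Pair:
  assumes "unif_close N z g" "unif_close N z' g'"
  shows "unif_close N (\<lambda>n k. (z n k, z' n k)) (\<lambda>t. (g t, g' t))"
  unfolding unif_close_def
proof (intro allI impI)
  fix e :: real
  assume "0 < e"
  then have "0 < e / 2"
    by simp
  show "\<forall>\<^sub>F n in sequentially. \<forall>k<N n.
      norm ((z n k, z' n k) - (g (real k / real (N n)), g' (real k / real (N n)))) < e"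
    using unif_closeD [OF assms(1) \<open>0 < e / 2\<close>] unif_closeD [OF assms(2) \<open>0 < e / 2\<close>]
  proof eventually_elim
    case (elim n)
    show ?case
    proof (intro allI impI)
      fix k
      assume "k < N n"
      then show "norm ((z n k, z' n k) - (g (real k / real (N n)), g' (real k / real (N n)))) < e"
        using elim norm_Pair_le [of "z n k - g (real k / real (N n))" "z' n k - g' (real k / real (N n))"]
        by fastforce
    qed
  qed
qed

text \<open>Serves for velocities, forces and energy densities, which are continuous in position and
  momentum or velocity, hence uniformly continuous on the compact \<open>K\<close>.\<close>

lemma unif_close_compose:
  assumes "unif_close N z g" "compact K" "continuous_on K h"
    and "\<And>n k. k < N n \<Longrightarrow> z n k \<in> K" and "\<And>t. t \<in> {0..1} \<Longrightarrow> g t \<in> K"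
  shows "unif_close N (\<lambda>n k. h (z n k)) (\<lambda>t. h (g t))"
  unfolding unif_close_def
proof (intro allI impI)
  fix e :: real
  assume "0 < e"
  then obtain d where "0 < d" and d: "\<And>x y. x \<in> K \<Longrightarrow> y \<in> K \<Longrightarrow> dist x y < d \<Longrightarrow> dist (h x) (h y) < e"
    using compact_uniformly_continuous [OF assms(3,2)] unfolding uniformly_continuous_on_def
    by metis
  show "\<forall>\<^sub>F n in sequentially. \<forall>k<N n. norm (h (z n k) - h (g (real k / real (N n)))) < e"
    using unif_closeD [OF assms(1) \<open>0 < d\<close>]
  proof eventually_elim
    case (elim n)
    show ?case
    proof (intro allI impI)
      fix k
      assume k: "k < N n"
      then have "real k / real (N n) \<in> {0..1}"
        by (simp add: divide_le_eq)
      then show "norm (h (z n k) - h (g (real k / real (N n)))) < e"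
        using d [of "z n k" "g (real k / real (N n))"] elim k assms(4,5) by (simp add: dist_norm)
    qed
  qed
qed

lemma eventually_inverse_less:
  assumes "filterlim N at_top sequentially" "0 < (d::real)"
  shows "\<forall>\<^sub>F n in sequentially. C / real (N n) < d"
proof -
  have "filterlim (\<lambda>n. real (N n)) at_infinity sequentially"
    using assms(1) filterlim_compose filterlim_real_sequentially filterlim_at_top_imp_at_infinity
    by blast
  then have "(\<lambda>n. C / real (N n)) \<longlonglongrightarrow> 0"
    by (rule tendsto_divide_0 [OF tendsto_const])
  then show ?thesis
    using assms(2) by (rule order_tendstoD(2))
qed

text \<open>Absorbs a shift by one grid index: a discrete velocity is tied to the momentum at the
  next index, which differs by \<open>O(1 / N)\<close>.\<close>

lemma unif_close_perturb:
  assumes "unif_close N z g" "filterlim N at_top sequentially"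
    and "\<And>n k. k < N n \<Longrightarrow> norm (z' n k - z n k) \<le> C / real (N n)"
  shows "unif_close N z' g"
  unfolding unif_close_def
proof (intro allI impI)
  fix e :: real
  assume "0 < e"
  then have "0 < e / 2"
    by simp
  show "\<forall>\<^sub>F n in sequentially. \<forall>k<N n. norm (z' n k - g (real k / real (N n))) < e"
    using unif_closeD [OF assms(1) \<open>0 < e / 2\<close>] eventually_inverse_less [OF assms(2) \<open>0 < e / 2\<close>, of C]
  proof eventually_elim
    case (elim n)
    show ?case
    proof (intro allI impI)
      fix k
      assume "k < N n"
      then show "norm (z' n k - g (real k / real (N n))) < e"
        using elim(1) [rule_format, of k] elim(2) assms(3) [of k n]
          norm_triangle_ineq [of "z' n k - z n k" "z n k - g (real k / real (N n))"]
        by (simp del: less_divide_eq_numeral1)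
    qed
  qed
qed

section \<open>Riemann sums, and integral equations as limits of difference equations\<close>

lemma norm_integral_diff_le:
  fixes h :: "real \<Rightarrow> 'a::euclidean_space"
  assumes "continuous_on {a..b} h" "a \<le> b" "\<And>x. x \<in> {a..b} \<Longrightarrow> norm (v - h x) \<le> B"
  shows "norm ((b - a) *\<^sub>R v - integral {a..b} h) \<le> B * (b - a)"
proof -
  have "integral {a..b} (\<lambda>x. v - h x) = (b - a) *\<^sub>R v - integral {a..b} h"
    using assms(1,2) by (subst integral_diff) (auto intro!: integrable_continuous_real)
  moreover have "norm (integral {a..b} (\<lambda>x. v - h x)) \<le> B * (b - a)"
    by (rule integral_bound) (use assms in \<open>auto intro!: continuous_intros\<close>)
  ultimately show ?thesis
    by simp
qed

text \<open>On each cell the error is at most \<open>e / 2\<close> from closeness at the left end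
  plus \<open>e / 2\<close> from the oscillation of \<open>h\<close>, times the cell length.
  Uniformity in \<open>k\<close> allows integration up to a moving grid point.\<close>

lemma unif_close_riemann_sums:
  fixes h :: "real \<Rightarrow> 'a::euclidean_space"
  assumes close: "unif_close N b h" and N: "filterlim N at_top sequentially"
    and cont: "continuous_on {0..1} h" and "0 < e"
  shows "\<forall>\<^sub>F n in sequentially. \<forall>k\<le>N n.
    norm ((1 / real (N n)) *\<^sub>R (\<Sum>j<k. b n j) - integral {0..real k / real (N n)} h) \<le> e"
proof -
  have "0 < e / 2"
    using \<open>0 < e\<close> by simp
  then obtain d where "0 < d"
    and d: "\<And>x y. x \<in> {0..1} \<Longrightarrow> y \<in> {0..1} \<Longrightarrow> dist x y < d \<Longrightarrow> dist (h x) (h y) < e / 2"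
    using compact_uniformly_continuous [OF cont compact_Icc] unfolding uniformly_continuous_on_def
    by metis
  show ?thesis
    using unif_closeD [OF close \<open>0 < e / 2\<close>] eventually_inverse_less [OF N \<open>0 < d\<close>, of 1]
  proof eventually_elim
    case (elim n)
    \<comment> \<open>The induction needs the bound proportional to the elapsed time
      \<open>k / N\<close>; a constant bound \<open>e\<close> would not reproduce itself.\<close>
    have "norm ((1 / real (N n)) *\<^sub>R (\<Sum>j<k. b n j) - integral {0..real k / real (N n)} h)
        \<le> e * (real k / real (N n))" if "k \<le> N n" for k
      using that
    proof (induction k)
      case 0
      then show ?case
        by simp
    next
      case (Suc k)
      define s where "s = real k / real (N n)"
      define t where "t = real (Suc k) / real (N n)"
      have st: "0 \<le> s" "s \<le> t" "t \<le> 1" "t - s = 1 / real (N n)"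
        using Suc.prems by (auto simp: s_def t_def divide_simps)
      have ct: "continuous_on {s..t} h" "continuous_on {0..t} h"
        using st by (auto intro: continuous_on_subset [OF cont])
      have "norm (b n k - h x) \<le> e" if x: "x \<in> {s..t}" for x
      proof -
        have "dist (h s) (h x) < e / 2"
          using st x elim(2) by (intro d) (auto simp: dist_norm)
        moreover have "norm (b n k - h s) < e / 2"
          using elim(1) Suc.prems by (simp add: s_def)
        ultimately show ?thesis
          using norm_triangle_ineq [of "b n k - h s" "h s - h x"] by (simp add: dist_norm)
      qed
      then have "norm ((t - s) *\<^sub>R b n k - integral {s..t} h) \<le> e * (t - s)"
        using st ct by (intro norm_integral_diff_le) auto
      moreover have "integral {0..t} h = integral {0..s} h + integral {s..t} h"
        using Henstock_Kurzweil_Integration.integral_combine [of 0 s t h] st ct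
          integrable_continuous_real by metis
      ultimately have "norm ((1 / real (N n)) *\<^sub>R (\<Sum>j<Suc k. b n j) - integral {0..t} h)
          \<le> e * s + e * (t - s)"
        using Suc.IH Suc.prems
          norm_triangle_ineq [of "(1 / real (N n)) *\<^sub>R (\<Sum>j<k. b n j) - integral {0..s} h"
            "(t - s) *\<^sub>R b n k - integral {s..t} h"]
        by (simp add: s_def [symmetric] st(4) scaleR_add_right algebra_simps)
      then show ?case
        by (simp add: t_def right_diff_distrib)
    qed
    moreover have "e * (real k / real (N n)) \<le> e" if "k \<le> N n" for k
      using that \<open>0 < e\<close> by (simp add: mult_left_le divide_le_eq)
    ultimately show ?case
      by (meson order_trans)
  qed
qed

lemma unif_close_riemann_limit:
  fixes h :: "real \<Rightarrow> 'a::euclidean_space"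
  assumes close: "unif_close N b h" and N: "filterlim N at_top sequentially"
    and cont: "continuous_on {0..1} h"
  shows "(\<lambda>n. (1 / real (N n)) *\<^sub>R (\<Sum>j<N n. b n j)) \<longlonglongrightarrow> integral {0..1} h"
proof (rule tendstoI)
  fix e :: real
  assume "0 < e"
  then have "0 < e / 2"
    by simp
  have "\<forall>\<^sub>F n in sequentially. 0 < N n"
    using filterlim_at_top [THEN iffD1, OF N, rule_format, of 1] by eventually_elim simp
  with unif_close_riemann_sums [OF assms \<open>0 < e / 2\<close>]
  show "\<forall>\<^sub>F n in sequentially. dist ((1 / real (N n)) *\<^sub>R (\<Sum>j<N n. b n j)) (integral {0..1} h) < e"
  proof eventually_elim
    case (elim n)
    then show ?case
      using \<open>0 < e\<close> elim(1) [rule_format, of "N n"] by (simp add: dist_norm)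
  qed
qed

lemma grid_points:
  assumes N: "filterlim N at_top sequentially" and t: "t \<in> {0..1}"
  obtains k :: "nat \<Rightarrow> nat" where "\<And>n. k n \<le> N n"
    and "(\<lambda>n. real (k n) / real (N n)) \<longlonglongrightarrow> t"
proof -
  define k where "k n = nat \<lfloor>t * real (N n)\<rfloor>" for n
  have k: "real (k n) \<le> t * real (N n)" "t * real (N n) - 1 \<le> real (k n)" for n
    using t by (auto simp: k_def)
  have kN: "k n \<le> N n" for n
    using k(1) [of n] t
    by (metis atLeastAtMost_iff mult_left_le mult.commute of_nat_0_le_iff of_nat_le_iff order_trans)
  have Npos: "\<forall>\<^sub>F n in sequentially. 0 < N n"
    using filterlim_at_top [THEN iffD1, OF N, rule_format, of 1] by eventually_elim simp
  have "(\<lambda>n. real (k n) / real (N n)) \<longlonglongrightarrow> t"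
  proof (rule tendstoI)
    fix e :: real
    assume "0 < e"
    show "\<forall>\<^sub>F n in sequentially. dist (real (k n) / real (N n)) t < e"
      using Npos eventually_inverse_less [OF N \<open>0 < e\<close>, of 1]
    proof eventually_elim
      case (elim n)
      have "t - real (k n) / real (N n) = (t * real (N n) - real (k n)) / real (N n)"
        using elim(1) by (simp add: diff_divide_distrib)
      also have "\<dots> \<le> 1 / real (N n)"
        using k(2) [of n] by (intro divide_right_mono) auto
      finally have "t - real (k n) / real (N n) \<le> 1 / real (N n)" .
      moreover have "real (k n) / real (N n) \<le> t"
        using k(1) [of n] elim(1) by (simp add: divide_le_eq)
      ultimately show ?case
        using elim(2) by (simp add: dist_norm)
    qed
  qed
  with kN show ?thesis
    by (rule that)
qed

lemma grid_tendsto: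
  fixes A :: "real \<Rightarrow> 'a::real_normed_vector"
  assumes A: "continuous_on {0..1} A" and t: "t \<in> {0..1}"
    and conv: "\<And>e. 0 < e \<Longrightarrow> \<forall>\<^sub>F n in sequentially. \<forall>k\<le>N n.
      norm (a n k - A (real k / real (N n))) < e"
    and kN: "\<And>n. k n \<le> N n" and k: "(\<lambda>n. real (k n) / real (N n)) \<longlonglongrightarrow> t"
  shows "(\<lambda>n. a n (k n)) \<longlonglongrightarrow> A t"
proof -
  have s01: "real (k n) / real (N n) \<in> {0..1}" for n
    using kN [of n] by (auto simp: divide_le_eq)
  have lim_A: "(\<lambda>n. A (real (k n) / real (N n))) \<longlonglongrightarrow> A t"
    using continuous_on_tendsto_compose [OF A k] t s01 by auto
  have "(\<lambda>n. a n (k n) - A (real (k n) / real (N n))) \<longlonglongrightarrow> 0"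
  proof (rule tendstoI)
    fix e :: real
    assume "0 < e"
    show "\<forall>\<^sub>F n in sequentially. dist (a n (k n) - A (real (k n) / real (N n))) 0 < e"
      using conv [OF \<open>0 < e\<close>] by eventually_elim (use kN in auto)
  qed
  from tendsto_add [OF this lim_A] show ?thesis
    by simp
qed

text \<open>The telescoped sum of \<open>b\<close> up to a grid point near \<open>t\<close> is a
  Riemann sum of \<open>h\<close>. Applied to position and momentum, this is the source of the
  differentiability of both limits.\<close>

lemma unif_close_antiderivative:
  fixes h A :: "real \<Rightarrow> 'a::euclidean_space"
  assumes close: "unif_close N b h" and N: "filterlim N at_top sequentially"
    and h: "continuous_on {0..1} h" and A: "continuous_on {0..1} A"
    and conv: "\<And>e. 0 < e \<Longrightarrow> \<forall>\<^sub>F n in sequentially. \<forall>k\<le>N n.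
      norm (a n k - A (real k / real (N n))) < e"
    and step: "\<And>n k. k < N n \<Longrightarrow> a n (Suc k) - a n k = (1 / real (N n)) *\<^sub>R b n k"
    and t: "t \<in> {0..1}"
  shows "A t = A 0 + integral {0..t} h"
proof -
  obtain k where kN: "\<And>n. k n \<le> N n" and k: "(\<lambda>n. real (k n) / real (N n)) \<longlonglongrightarrow> t"
    using grid_points [OF N t] by metis
  have s01: "real (k n) / real (N n) \<in> {0..1}" for n
    using kN [of n] by (auto simp: divide_le_eq)
  have "continuous_on {0..1} (\<lambda>t. integral {0..t} h)"
    by (intro indefinite_integral_continuous_1 integrable_continuous_real h)
  then have lim_I: "(\<lambda>n. integral {0..real (k n) / real (N n)} h) \<longlonglongrightarrow> integral {0..t} h"
    using continuous_on_tendsto_compose [of "{0..1}" "\<lambda>t. integral {0..t} h", OF _ k] t s01 by auto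
  have 1: "(\<lambda>n. a n (k n)) \<longlonglongrightarrow> A t"
    by (rule grid_tendsto [OF A t conv kN k])
  have 2: "(\<lambda>n. a n 0) \<longlonglongrightarrow> A 0"
    by (rule grid_tendsto [OF A _ conv]) auto
  have tele: "a n j - a n 0 = (1 / real (N n)) *\<^sub>R (\<Sum>i<j. b n i)" if "j \<le> N n" for n j
  proof -
    have "a n j - a n 0 = (\<Sum>i<j. a n (Suc i) - a n i)"
      by (simp add: sum_lessThan_telescope)
    also have "\<dots> = (\<Sum>i<j. (1 / real (N n)) *\<^sub>R b n i)"
      using that step by (intro sum.cong) auto
    finally show ?thesis
      by (simp add: scaleR_sum_right)
  qed
  have "(\<lambda>n. (a n (k n) - a n 0) - integral {0..real (k n) / real (N n)} h) \<longlonglongrightarrow> 0"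
  proof (rule tendstoI)
    fix e :: real
    assume "0 < e"
    then have "0 < e / 2"
      by simp
    show "\<forall>\<^sub>F n in sequentially.
        dist (a n (k n) - a n 0 - integral {0..real (k n) / real (N n)} h) 0 < e"
      using unif_close_riemann_sums [OF close N h \<open>0 < e / 2\<close>]
    proof eventually_elim
      case (elim n)
      then show ?case
        using \<open>0 < e\<close> elim [rule_format, OF kN] tele [OF kN] by simp
    qed
  qed
  from tendsto_add [OF this lim_I] have "(\<lambda>n. a n (k n) - a n 0) \<longlonglongrightarrow> integral {0..t} h"
    by simp
  with tendsto_diff [OF 1 2] have "A t - A 0 = integral {0..t} h"
    using LIMSEQ_unique by blast
  then show ?thesis
    by (simp add: algebra_simps)
qed

text \<open>The reference vector \<open>v\<close> is free: 0 yields a Lipschitz bound, while a value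
  of \<open>\<gamma>'\<close> yields a comparison of a displacement with a velocity.\<close>

lemma C1_increment:
  fixes \<gamma> \<gamma>' :: "real \<Rightarrow> 'a::euclidean_space"
  assumes deriv: "\<And>t. t \<in> {0..1} \<Longrightarrow> (\<gamma> has_vector_derivative \<gamma>' t) (at t within {0..1})"
    and cont: "continuous_on {0..1} \<gamma>'" and st: "0 \<le> s" "s \<le> t" "t \<le> 1"
    and bound: "\<And>x. x \<in> {s..t} \<Longrightarrow> norm (v - \<gamma>' x) \<le> B"
  shows "norm ((t - s) *\<^sub>R v - (\<gamma> t - \<gamma> s)) \<le> B * (t - s)"
proof -
  have sub: "{s..t} \<subseteq> {0..1}"
    using st by auto
  have "(\<gamma>' has_integral \<gamma> t - \<gamma> s) {s..t}"
    using st sub by (intro fundamental_theorem_of_calculus)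
      (auto intro!: has_vector_derivative_within_subset [OF deriv])
  then have "integral {s..t} \<gamma>' = \<gamma> t - \<gamma> s"
    by (rule integral_unique)
  with norm_integral_diff_le [OF continuous_on_subset [OF cont sub] st(2) bound] show ?thesis
    by simp
qed

lemma unif_close_difference_quotient:
  fixes \<gamma> \<gamma>' :: "real \<Rightarrow> 'a::euclidean_space"
  assumes deriv: "\<And>t. t \<in> {0..1} \<Longrightarrow> (\<gamma> has_vector_derivative \<gamma>' t) (at t within {0..1})"
    and cont: "continuous_on {0..1} \<gamma>'" and N: "filterlim N at_top sequentially"
  shows "unif_close N (\<lambda>n k. real (N n) *\<^sub>R
    (\<gamma> (real (Suc k) / real (N n)) - \<gamma> (real k / real (N n)))) \<gamma>'"
  unfolding unif_close_def
proof (intro allI impI)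
  fix e :: real
  assume "0 < e"
  then have "0 < e / 2"
    by simp
  then obtain d where "0 < d"
    and d: "\<And>x y. x \<in> {0..1} \<Longrightarrow> y \<in> {0..1} \<Longrightarrow> dist x y < d \<Longrightarrow> dist (\<gamma>' x) (\<gamma>' y) < e / 2"
    using compact_uniformly_continuous [OF cont compact_Icc] unfolding uniformly_continuous_on_def
    by metis
  show "\<forall>\<^sub>F n in sequentially. \<forall>k<N n. norm (real (N n) *\<^sub>R
    (\<gamma> (real (Suc k) / real (N n)) - \<gamma> (real k / real (N n))) - \<gamma>' (real k / real (N n))) < e"
    using eventually_inverse_less [OF N \<open>0 < d\<close>, of 1]
  proof eventually_elim
    case (elim n)
    show ?case
    proof (intro allI impI)
      fix k
      assume k: "k < N n"
      define s where "s = real k / real (N n)"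
      define t where "t = real (Suc k) / real (N n)"
      have st: "0 \<le> s" "s \<le> t" "t \<le> 1" "t - s = 1 / real (N n)"
        using k by (auto simp: s_def t_def divide_simps)
      have *: "norm ((t - s) *\<^sub>R \<gamma>' s - (\<gamma> t - \<gamma> s)) \<le> (e / 2) * (t - s)"
      proof (rule C1_increment [OF deriv cont st(1-3)])
        fix x
        assume "x \<in> {s..t}"
        then have "dist (\<gamma>' s) (\<gamma>' x) < e / 2"
          using st elim by (intro d) (auto simp: dist_norm)
        then show "norm (\<gamma>' s - \<gamma>' x) \<le> e / 2"
          by (simp add: dist_norm)
      qed
      have "real (N n) *\<^sub>R (\<gamma> t - \<gamma> s) - \<gamma>' s = - (real (N n) *\<^sub>R ((t - s) *\<^sub>R \<gamma>' s - (\<gamma> t - \<gamma> s)))"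
        using k st(4) by (simp add: scaleR_diff_right)
      then have "norm (real (N n) *\<^sub>R (\<gamma> t - \<gamma> s) - \<gamma>' s)
          = real (N n) * norm ((t - s) *\<^sub>R \<gamma>' s - (\<gamma> t - \<gamma> s))"
        by simp
      also have "\<dots> \<le> real (N n) * ((e / 2) * (t - s))"
        using * by (intro mult_left_mono) auto
      also have "\<dots> = e / 2"
        using k st(4) by simp
      finally show "norm (real (N n) *\<^sub>R (\<gamma> (real (Suc k) / real (N n)) - \<gamma> (real k / real (N n)))
          - \<gamma>' (real k / real (N n))) < e"
        using \<open>0 < e\<close> by (simp add: s_def t_def)
    qed
  qed
qed

text \<open>Subtracting \<open>c / 2 * t^2\<close> makes the first derivative increasing, and the
  tangent inequality gives convexity. As \<open>f''\<close> may be discontinuous, the mean value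
  theorem takes the place of integration.\<close>

lemma second_derivative_ge_imp_convex:
  fixes f f' f'' :: "real \<Rightarrow> real"
  assumes "\<And>t. t \<in> {0..1} \<Longrightarrow> (f has_vector_derivative f' t) (at t within {0..1})"
    and "\<And>t. t \<in> {0..1} \<Longrightarrow> (f' has_vector_derivative f'' t) (at t within {0..1})"
    and "\<And>t. t \<in> {0..1} \<Longrightarrow> c \<le> f'' t" and "t \<in> {0..1}"
  shows "f t \<le> (1 - t) * f 0 + t * f 1 - c / 2 * t * (1 - t)"
proof -
  define g where "g t = f t - c / 2 * t\<^sup>2" for t
  define g' where "g' t = f' t - c * t" for t
  have g: "(g has_real_derivative g' t) (at t within {0..1})" if "t \<in> {0..1}" for t
    using assms(1) [OF that] unfolding g_def g'_def has_real_derivative_iff_has_vector_derivative [symmetric]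
    by (auto intro!: derivative_eq_intros)
  have g': "(g' has_real_derivative f'' t - c) (at t within {0..1})" if "t \<in> {0..1}" for t
    using assms(2) [OF that] unfolding g'_def has_real_derivative_iff_has_vector_derivative [symmetric]
    by (auto intro!: derivative_eq_intros)
  have mvt: "\<exists>z. z \<in> {0..1} \<and> x < z \<and> z < y \<and> u y - u x = u' z * (y - x)"
    if u: "\<And>t. t \<in> {0..1} \<Longrightarrow> (u has_real_derivative u' t) (at t within {0..1})"
      and "0 \<le> x" "x < y" "y \<le> 1" for u u' :: "real \<Rightarrow> real" and x y
  proof -
    have "(u has_derivative (*) (u' t)) (at t within {x..y})" if "x \<le> t" "t \<le> y" for t
      using DERIV_subset [OF u [of t], of "{x..y}"]
        that \<open>0 \<le> x\<close> \<open>y \<le> 1\<close> by (simp add: has_field_derivative_def)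
    from mvt_simple [OF \<open>x < y\<close> this] show ?thesis
      using \<open>0 \<le> x\<close> \<open>y \<le> 1\<close> by (metis atLeastAtMost_iff greaterThanLessThan_iff less_imp_le order_trans)
  qed
  have mono: "g' x \<le> g' y" if xy: "0 \<le> x" "x < y" "y \<le> 1" for x y
  proof -
    obtain z where "z \<in> {0..1}" "g' y - g' x = (f'' z - c) * (y - x)"
      using mvt [of g' "\<lambda>t. f'' t - c" x y, OF g' xy] by blast
    then show ?thesis
      using assms(3) [of z] xy by (smt (verit) mult_nonneg_nonneg)
  qed
  have "convex_on {0..1} g"
  proof (rule pos_convex_function)
    fix x y :: real
    assume xy: "x \<in> {0..1}" "y \<in> {0..1}"
    consider "x < y" | "x = y" | "y < x"
      by linarith
    then show "g' x * (y - x) \<le> g y - g x"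
    proof cases
      case 1
      then obtain z where "x < z" "z < y" "g y - g x = g' z * (y - x)"
        using mvt [of g g' x y] g xy by auto
      then show ?thesis
        using mono [of x z] xy 1 by (simp add: mult_right_mono)
    next
      case 3
      then obtain z where z: "y < z" "z < x" "g x - g y = g' z * (x - y)"
        using mvt [of g g' y x] g xy by auto
      then have "g' z * (x - y) \<le> g' x * (x - y)"
        using mono [of z x] xy 3 by (simp add: mult_right_mono)
      then show ?thesis
        using z(3) by (simp add: algebra_simps)
    qed simp
  qed simp
  then have "g ((1 - t) * 0 + t * 1) \<le> (1 - t) * g 0 + t * g 1"
    using convex_onD [of "{0..1}" g t 0 1] assms(4) by simp
  then show ?thesis
    by (simp add: g_def power2_eq_square algebra_simps diff_divide_distrib)
qed

section \<open>Minimizing geodesics of a continuously differentiable metric\<close>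

lemmas mvm_bilinear = bounded_bilinear_matrix_vector_mult
lemmas mvm_scaleR = bounded_bilinear.scaleR_right [OF mvm_bilinear]
lemmas mvm_diff = bounded_bilinear.diff_right [OF mvm_bilinear]
lemmas mvm_diff_left = bounded_bilinear.diff_left [OF mvm_bilinear]

lemma continuous_on_matrix_inv:
  fixes A :: "'a::topological_space \<Rightarrow> real^'d::finite^'d"
  assumes A: "continuous_on S A" and det: "\<And>x. x \<in> S \<Longrightarrow> det (A x) \<noteq> 0"
  shows "continuous_on S (\<lambda>x. matrix_inv (A x))"
proof (rule continuous_on_matrixI)
  fix k l
  have cdet: "continuous_on S (\<lambda>x. det (B x))"
    if "\<And>i j. continuous_on S (\<lambda>x. B x $ i $ j)" for B :: "'a \<Rightarrow> real^'d^'d"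
    unfolding det_def by (intro continuous_intros that)
  have comp: "continuous_on S (\<lambda>x. A x $ i $ j)" for i j
    by (intro continuous_intros A)
  have "continuous_on S (\<lambda>x. (\<chi> i j. if j = k then axis l 1 $ i else A x $ i $ j) $ i $ j)" for i j
    by (cases "j = k") (simp_all add: comp)
  then have "continuous_on S (\<lambda>x. det (\<chi> i j. if j = k then axis l 1 $ i else A x $ i $ j) / det (A x))"
    by (intro continuous_on_divide cdet comp) (auto simp: det)
  then show "continuous_on S (\<lambda>x. matrix_inv (A x) $ k $ l)"
    by (rule continuous_on_eq) (simp add: matrix_inv_cramer det)
qed

lemma matrix_family_bound:
  fixes A :: "'a::topological_space \<Rightarrow> real^'n::finite^'m::finite"
  assumes "compact S" "continuous_on S A"
  obtains K where "0 < K" "\<And>x v. x \<in> S \<Longrightarrow> norm (A x *v v) \<le> K * norm v"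
proof -
  obtain k where k: "0 < k" "\<And>(B :: real^'n^'m) v. norm (B *v v) \<le> norm B * norm v * k"
    using bounded_bilinear.pos_bounded [OF mvm_bilinear] by blast
  have "bounded (A ` S)"
    using assms by (simp add: compact_continuous_image compact_imp_bounded)
  then obtain b where b: "0 < b" "\<And>x. x \<in> S \<Longrightarrow> norm (A x) \<le> b"
    by (auto simp: bounded_pos)
  show ?thesis
  proof (rule that [of "b * k"])
    show "norm (A x *v v) \<le> b * k * norm v" if "x \<in> S" for x v
    proof -
      have "norm (A x) * norm v * k \<le> b * norm v * k"
        using b(2) [OF that] k(1) by (intro mult_right_mono) auto
      then show ?thesis
        using k(2) [of "A x" v] by (simp add: mult_ac)
    qed
  qed (use b k in simp)
qed

text \<open>A product rule for \<open>f\<close> merely continuous at \<open>t\<close>: a derivative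
  of \<open>f\<close> would be multiplied by \<open>D t = 0\<close>.\<close>

lemma has_vector_derivative_matrix_mult_zero:
  fixes f :: "real \<Rightarrow> real^'n::finite^'m::finite"
  assumes D: "(D has_vector_derivative w) (at t within S)" "D t = 0"
    and f: "(f \<longlongrightarrow> f t) (at t within S)"
  shows "((\<lambda>s. f s *v D s) has_vector_derivative f t *v w) (at t within S)"
proof -
  have "((\<lambda>s. (1 / norm (s - t)) *\<^sub>R (D s - (s - t) *\<^sub>R w)) \<longlongrightarrow> 0) (at t within S)"
    using D by (simp add: has_vector_derivative_def has_derivative_within)
  from bounded_bilinear.tendsto [OF mvm_bilinear f this]
  have A: "((\<lambda>s. f s *v ((1 / norm (s - t)) *\<^sub>R (D s - (s - t) *\<^sub>R w))) \<longlongrightarrow> 0) (at t within S)"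
    by simp
  have "((\<lambda>s. (f s - f t) *v w) \<longlongrightarrow> (f t - f t) *v w) (at t within S)"
    by (intro bounded_bilinear.tendsto [OF mvm_bilinear] tendsto_diff f tendsto_const)
  then have "((\<lambda>s. (f s - f t) *v w) \<longlongrightarrow> 0) (at t within S)"
    by simp
  then have B: "((\<lambda>s. sgn (s - t) *\<^sub>R ((f s - f t) *v w)) \<longlongrightarrow> 0) (at t within S)"
    by (rule tendsto_0_le [where K = 1]) (auto simp: sgn_if intro!: always_eventually)
  \<comment> \<open>The remainder quotient of the product splits into \<open>f s\<close> applied to
    that of \<open>D\<close> and a sign times \<open>(f s - f t) *v w\<close>; both tend to
    zero.\<close>
  have "f s *v ((1 / norm (s - t)) *\<^sub>R (D s - (s - t) *\<^sub>R w)) + sgn (s - t) *\<^sub>R ((f s - f t) *v w)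
      = (1 / norm (s - t)) *\<^sub>R (f s *v D s - (f t *v D t + (s - t) *\<^sub>R (f t *v w)))" for s
  proof -
    have "sgn (s - t) = (1 / norm (s - t)) * (s - t)"
      by (simp add: real_sgn_eq)
    then show ?thesis
      by (simp only: mvm_scaleR mvm_diff mvm_diff_left \<open>D t = 0\<close>)
        (simp add: scaleR_diff_right)
  qed
  with tendsto_add [OF A B] show ?thesis
    by (simp add: has_vector_derivative_def has_derivative_within
        bounded_linear_scaleR_left)
qed

text \<open>A metric near one point, detached from the statistical model, with ellipticity constants
  \<open>l\<close> and \<open>L\<close>. The derivative is taken in the whole space even at boundary
  points of the ball.\<close>

locale riemannian_ball =
  fixes G :: "real^'d::finite \<Rightarrow> real^'d^'d" and DG :: "real^'d \<Rightarrow> real^'d \<Rightarrow> real^'d^'d"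
    and c :: "real^'d" and r l L :: real
  assumes r_pos: "0 < r"
    and G_deriv: "x \<in> cball c r \<Longrightarrow> (G has_derivative DG x) (at x)"
    and DG_cont: "continuous_on (cball c r) (\<lambda>x. DG x h)"
    and G_sym: "x \<in> cball c r \<Longrightarrow> transpose (G x) = G x"
    and l_pos: "0 < l"
    and G_lower: "x \<in> cball c r \<Longrightarrow> l * (norm v)\<^sup>2 \<le> v \<bullet> (G x *v v)"
    and G_upper: "x \<in> cball c r \<Longrightarrow> v \<bullet> (G x *v v) \<le> L * (norm v)\<^sup>2"
begin

text \<open>The squared speed without the customary factor 1/2, which reappears in front of
  \<open>gforce\<close>.\<close>

definition gq :: "real^'d \<Rightarrow> real^'d \<Rightarrow> real" where
  "gq x v = v \<bullet> (G x *v v)"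

text \<open>\<open>gforce x v\<close> is the gradient of \<open>\<lambda>x. gq x v\<close>.\<close>

definition gforce :: "real^'d \<Rightarrow> real^'d \<Rightarrow> real^'d" where
  "gforce x v = (\<chi> i. v \<bullet> (DG x (axis i 1) *v v))"

text \<open>Results from expanding the left-hand side of \<open>(G x v)' = gforce x v / 2\<close> as
  \<open>G x v' + DG x v v\<close> and solving for \<open>v'\<close>.\<close>

definition geodesic_acc :: "real^'d \<Rightarrow> real^'d \<Rightarrow> real^'d" where
  "geodesic_acc x v = matrix_inv (G x) *v ((1/2) *\<^sub>R gforce x v - DG x v *v v)"

section \<open>Ellipticity and bounds for the metric and the force\<close>

lemma G_cont: "continuous_on (cball c r) G"
  by (intro continuous_at_imp_continuous_on ballI) (rule has_derivative_continuous [OF G_deriv])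

lemma G_inner: "x \<in> cball c r \<Longrightarrow> u \<bullet> (G x *v v) = v \<bullet> (G x *v u)"
  by (metis G_sym dot_lmul_matrix inner_commute transpose_matrix_vector)

lemma det_G: "x \<in> cball c r \<Longrightarrow> det (G x) \<noteq> 0"
proof (rule det_nonzero_if_posdef)
  fix v :: "real^'d"
  assume "x \<in> cball c r" "v \<noteq> 0"
  then show "0 < v \<bullet> (G x *v v)"
    using G_lower [of x v] l_pos by (smt (verit) mult_pos_pos zero_less_norm_iff zero_less_power)
qed

lemma G_lower_norm: "x \<in> cball c r \<Longrightarrow> l * norm v \<le> norm (G x *v v)"
proof -
  assume x: "x \<in> cball c r"
  have "l * (norm v)\<^sup>2 \<le> norm v * norm (G x *v v)"
    using G_lower [OF x, of v] norm_cauchy_schwarz [of v "G x *v v"] by linarith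
  then have "norm v * (l * norm v) \<le> norm v * norm (G x *v v)"
    by (simp add: power2_eq_square mult_ac)
  then show ?thesis
    by (cases "v = 0") auto
qed

lemma Ginv_norm:
  assumes "x \<in> cball c r"
  shows "norm (matrix_inv (G x) *v v) \<le> norm v / l"
  using G_lower_norm [OF assms, of "matrix_inv (G x) *v v"] l_pos
  by (simp add: matrix_inv_mult_vector [OF det_G [OF assms]] field_simps)

lemma Ginv_cont: "continuous_on (cball c r) (\<lambda>x. matrix_inv (G x))"
  by (intro continuous_on_matrix_inv G_cont det_G)

lemma DG_linear: "x \<in> cball c r \<Longrightarrow> linear (DG x)"
  by (rule has_derivative_linear [OF G_deriv])

lemma inner_gforce:
  assumes "x \<in> cball c r"
  shows "h \<bullet> gforce x v = v \<bullet> (DG x h *v v)"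
proof -
  have lin: "linear (\<lambda>h. v \<bullet> (DG x h *v v))"
    using DG_linear [OF assms]
    by (intro linearI) (simp_all add: linear_add linear_scale matrix_vector_mult_add_rdistrib
        inner_add_right scaleR_matrix_vector_assoc [symmetric])
  have "v \<bullet> (DG x h *v v) = v \<bullet> (DG x (\<Sum>i\<in>UNIV. (h $ i) *\<^sub>R axis i 1) *v v)"
    using basis_expansion [of h] by (simp add: scalar_mult_eq_scaleR)
  also have "\<dots> = (\<Sum>i\<in>UNIV. h $ i * (v \<bullet> (DG x (axis i 1) *v v)))"
    using linear_sum [OF lin, of "\<lambda>i. (h $ i) *\<^sub>R axis i 1" UNIV]
    by (simp add: linear_scale [OF lin, simplified])
  finally show ?thesis
    by (simp add: gforce_def inner_vec_def)
qed

lemma gforce_scaleR: "gforce x (a *\<^sub>R v) = a\<^sup>2 *\<^sub>R gforce x v"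
  by (simp add: gforce_def vec_eq_iff mvm_scaleR power2_eq_square)

lemma gq_scaleR: "gq x (a *\<^sub>R v) = a\<^sup>2 * gq x v"
  by (simp add: gq_def mvm_scaleR power2_eq_square)

lemma gq_cont: "continuous_on (cball c r \<times> UNIV) (\<lambda>(x, v). gq x v)"
  unfolding gq_def case_prod_unfold
  by (intro continuous_intros continuous_on_compose2 [OF G_cont]) auto

lemma gforce_cont: "continuous_on (cball c r \<times> UNIV) (\<lambda>(x, v). gforce x v)"
  unfolding gforce_def case_prod_unfold
  by (intro continuous_intros continuous_on_compose2 [OF DG_cont]) auto

lemma gforce_bound:
  obtains K where "0 < K" "\<And>x v. x \<in> cball c r \<Longrightarrow> norm (gforce x v) \<le> K * (norm v)\<^sup>2"
proof -
  have "\<exists>K>0. \<forall>x v. x \<in> cball c r \<longrightarrow> norm (DG x (axis i 1) *v v) \<le> K * norm v" for i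
    using matrix_family_bound [OF compact_cball DG_cont [of "axis i 1"]] by metis
  then obtain K where K: "\<And>i. 0 < K i"
    "\<And>i x v. x \<in> cball c r \<Longrightarrow> norm (DG x (axis i 1) *v v) \<le> K i * norm v"
    by metis
  show ?thesis
  proof (rule that [of "\<Sum>i\<in>UNIV. K i"])
    show "0 < (\<Sum>i\<in>UNIV. K i)"
      by (intro sum_pos) (auto simp: K)
    fix x v
    assume x: "x \<in> cball c r"
    have "norm (gforce x v) \<le> (\<Sum>i\<in>UNIV. \<bar>gforce x v $ i\<bar>)"
      by (rule norm_le_l1_cart)
    also have "\<dots> \<le> (\<Sum>i\<in>UNIV. K i * (norm v)\<^sup>2)"
    proof (rule sum_mono)
      fix i
      have "\<bar>gforce x v $ i\<bar> \<le> norm v * norm (DG x (axis i 1) *v v)"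
        by (simp add: gforce_def Cauchy_Schwarz_ineq2)
      also have "\<dots> \<le> norm v * (K i * norm v)"
        by (intro mult_left_mono K x) auto
      finally show "\<bar>gforce x v $ i\<bar> \<le> K i * (norm v)\<^sup>2"
        by (simp add: power2_eq_square mult_ac)
    qed
    finally show "norm (gforce x v) \<le> (\<Sum>i\<in>UNIV. K i) * (norm v)\<^sup>2"
      by (simp add: sum_distrib_right)
  qed
qed

section \<open>Minimizers of the discrete energy\<close>

lemma minimal_chain:
  assumes y: "y \<in> cball c r" and "0 < N"
  obtains u where "u 0 = c" "u N = y" "\<And>k. u k \<in> cball c r"
    and "\<And>u'. u' 0 = c \<Longrightarrow> u' N = y \<Longrightarrow> (\<And>k. u' k \<in> cball c r) \<Longrightarrow>
      (\<Sum>k<N. gq (u k) (u (Suc k) - u k)) \<le> (\<Sum>k<N. gq (u' k) (u' (Suc k) - u' k))"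
proof -
  \<comment> \<open>The end points are built into the factors of a product over all of
    \<open>nat\<close>, compact by Tychonoff's theorem. Coordinates beyond \<open>N\<close> range
    over the ball without affecting the energy.\<close>
  define T where "T k = (if k = 0 then {c} else if k = N then {y} else cball c r)" for k
  define S where "S = PiE UNIV T"
  have "compactin (product_topology (\<lambda>i. euclidean) UNIV) S"
    unfolding S_def compactin_PiE by (auto simp: T_def)
  then have S: "compact S"
    by (simp add: euclidean_product_topology)
  have ne: "S \<noteq> {}"
    using r_pos by (auto simp: S_def T_def PiE_eq_empty_iff)
  have cont: "continuous_on S (\<lambda>u. \<Sum>k<N. gq (u k) (u (Suc k) - u k))"
  proof (intro continuous_on_sum)
    fix k
    have "continuous_on S (\<lambda>u. u j)" for j :: nat
      by (rule continuous_on_subset [OF continuous_on_product_coordinates]) simp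
    then have "continuous_on S (\<lambda>u. (u k, u (Suc k) - u k))"
      by (intro continuous_intros)
    moreover have "(\<lambda>u. (u k, u (Suc k) - u k)) ` S \<subseteq> cball c r \<times> UNIV"
      using r_pos y by (force simp: S_def T_def PiE_iff split: if_splits)
    ultimately show "continuous_on S (\<lambda>u. gq (u k) (u (Suc k) - u k))"
      using continuous_on_compose2 [OF gq_cont, of S "\<lambda>u. (u k, u (Suc k) - u k)"] by simp
  qed
  obtain u where u: "u \<in> S"
    "\<And>u'. u' \<in> S \<Longrightarrow> (\<Sum>k<N. gq (u k) (u (Suc k) - u k)) \<le> (\<Sum>k<N. gq (u' k) (u' (Suc k) - u' k))"
    using continuous_attains_inf [OF S ne cont] by blast
  show ?thesis
  proof (rule that [of u])
    show "u 0 = c" "u N = y"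
      using u(1) \<open>0 < N\<close> by (auto simp: S_def T_def PiE_iff split: if_splits dest: spec [of _ 0] spec [of _ N])
    show "u k \<in> cball c r" for k
      using u(1) r_pos y by (force simp: S_def T_def PiE_iff split: if_splits)
    fix u' :: "nat \<Rightarrow> real^'d"
    assume "u' 0 = c" "u' N = y" "\<And>k. u' k \<in> cball c r"
    then show "(\<Sum>k<N. gq (u k) (u (Suc k) - u k)) \<le> (\<Sum>k<N. gq (u' k) (u' (Suc k) - u' k))"
      by (intro u(2)) (auto simp: S_def T_def PiE_iff)
  qed
qed

text \<open>Moving the vertex \<open>u (Suc k)\<close> changes two summands only, and the claim is
  the first-order condition for this variation. The metric is evaluated at the left end of each
  edge, so \<open>DG\<close> enters through the second summand alone. A vertex in the open ball can
  be moved in every direction.\<close>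

lemma discrete_euler_lagrange:
  assumes u: "\<And>k. u k \<in> cball c r" and k: "Suc k < N" and inner: "u (Suc k) \<in> ball c r"
    and min: "\<And>u'. u' 0 = u 0 \<Longrightarrow> u' N = u N \<Longrightarrow> (\<And>k. u' k \<in> cball c r) \<Longrightarrow>
      (\<Sum>k<N. gq (u k) (u (Suc k) - u k)) \<le> (\<Sum>k<N. gq (u' k) (u' (Suc k) - u' k))"
  shows "G (u (Suc k)) *v (u (Suc (Suc k)) - u (Suc k)) - G (u k) *v (u (Suc k) - u k)
    = (1/2) *\<^sub>R gforce (u (Suc k)) (u (Suc (Suc k)) - u (Suc k))"
proof -
  define x where "x = u (Suc k)"
  define w where "w = u (Suc (Suc k)) - x"
  define \<phi> where "\<phi> z = gq (u k) (z - u k) + gq z (u (Suc (Suc k)) - z)" for z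
  have "\<phi> x \<le> \<phi> z" if z: "z \<in> ball c r" for z
  proof -
    define u' where "u' = u(Suc k := z)"
    define R where "R = {..<N} - {k, Suc k}"
    have split: "(\<Sum>j<N. f j) = f k + f (Suc k) + (\<Sum>j\<in>R. f j)" for f :: "nat \<Rightarrow> real"
    proof -
      have "{..<N} = insert k (insert (Suc k) R)"
        using k by (auto simp: R_def)
      moreover have "finite R" "k \<notin> R" "Suc k \<notin> R"
        by (auto simp: R_def)
      ultimately show ?thesis
        by simp
    qed
    have "(\<Sum>j<N. gq (u j) (u (Suc j) - u j)) \<le> (\<Sum>j<N. gq (u' j) (u' (Suc j) - u' j))"
      by (rule min) (use u z k in \<open>auto simp: u'_def\<close>)
    moreover have "(\<Sum>j\<in>R. gq (u' j) (u' (Suc j) - u' j)) = (\<Sum>j\<in>R. gq (u j) (u (Suc j) - u j))"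
      by (rule sum.cong) (auto simp: R_def u'_def)
    ultimately show ?thesis
      unfolding split by (simp add: u'_def \<phi>_def x_def)
  qed
  moreover have "(\<phi> has_derivative (\<lambda>h. 2 * (h \<bullet> (G (u k) *v (x - u k))) - 2 * (h \<bullet> (G x *v w))
      + w \<bullet> (DG x h *v w))) (at x)"
  proof -
    have xc: "x \<in> cball c r"
      using u x_def by simp
    have 1: "((\<lambda>z. gq (u k) (z - u k)) has_derivative
        (\<lambda>h. 2 * (h \<bullet> (G (u k) *v (x - u k))))) (at x)"
    proof -
      have "((\<lambda>z. gq (u k) (z - u k)) has_derivative
          (\<lambda>h. (x - u k) \<bullet> (G (u k) *v h) + h \<bullet> (G (u k) *v (x - u k)))) (at x)"
        unfolding gq_def
        by (intro has_derivative_inner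
            bounded_linear.has_derivative [OF matrix_vector_mul_bounded_linear])
          (auto intro!: derivative_eq_intros)
      then show ?thesis
        using G_inner [OF u [of k], of "x - u k"] by simp
    qed
    have 2: "((\<lambda>z. gq z (u (Suc (Suc k)) - z)) has_derivative
        (\<lambda>h. w \<bullet> (G x *v (- h) + DG x h *v w) + (- h) \<bullet> (G x *v w))) (at x)"
      unfolding gq_def w_def
      by (intro has_derivative_inner bounded_bilinear.FDERIV [OF mvm_bilinear] G_deriv xc)
        (auto intro!: derivative_eq_intros)
    have "w \<bullet> (G x *v (- h)) = - (h \<bullet> (G x *v w))" for h
      using G_inner [OF xc, of w "-h"] by simp
    then have 2: "((\<lambda>z. gq z (u (Suc (Suc k)) - z)) has_derivative
        (\<lambda>h. - 2 * (h \<bullet> (G x *v w)) + w \<bullet> (DG x h *v w))) (at x)"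
      using 2 by (simp add: inner_add_right)
    show ?thesis
      unfolding \<phi>_def using has_derivative_add [OF 1 2] by (simp add: algebra_simps)
  qed
  ultimately have zero: "(\<lambda>h. 2 * (h \<bullet> (G (u k) *v (x - u k))) - 2 * (h \<bullet> (G x *v w))
      + w \<bullet> (DG x h *v w)) = (\<lambda>h. 0)"
    using inner by (intro differential_zero_maxmin [where S = "ball c r" and f = \<phi> and x = x])
      (auto simp: x_def)
  show ?thesis
  proof (rule vec_eq_iff [THEN iffD2], rule allI)
    fix i
    show "(G (u (Suc k)) *v (u (Suc (Suc k)) - u (Suc k)) - G (u k) *v (u (Suc k) - u k)) $ i
      = ((1/2) *\<^sub>R gforce (u (Suc k)) (u (Suc (Suc k)) - u (Suc k))) $ i"
      using fun_cong [OF zero, of "axis i 1"]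
      by (simp add: gforce_def w_def [symmetric] x_def [symmetric] inner_axis')
  qed
qed

text \<open>Comparison with the subdivided segment from \<open>c\<close> to \<open>y\<close>:
  \<open>L\<close> bounds its energy from above, \<open>l\<close> bounds that of \<open>u\<close>
  from below.\<close>

lemma chain_energy_bound:
  assumes y: "y \<in> cball c r" and N: "0 < N"
    and min: "\<And>u'. u' 0 = c \<Longrightarrow> u' N = y \<Longrightarrow> (\<And>k. u' k \<in> cball c r) \<Longrightarrow>
      (\<Sum>k<N. gq (u k) (u (Suc k) - u k)) \<le> (\<Sum>k<N. gq (u' k) (u' (Suc k) - u' k))"
    and u: "\<And>k. u k \<in> cball c r"
  shows "(\<Sum>k<N. (norm (u (Suc k) - u k))\<^sup>2) \<le> L / l * (norm (y - c))\<^sup>2 / real N"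
proof -
  \<comment> \<open>Truncation at 1 keeps the competitor in the ball beyond index \<open>N\<close>,
    as admissibility concerns every index.\<close>
  define u' where "u' k = c + min 1 (real k / real N) *\<^sub>R (y - c)" for k
  have u': "u' k \<in> cball c r" for k
  proof -
    have "min 1 (real k / real N) * norm (y - c) \<le> norm (y - c)"
      by (intro mult_left_le_one_le) auto
    then show ?thesis
      using y by (simp add: u'_def dist_norm norm_minus_commute)
  qed
  have "gq (u' k) (u' (Suc k) - u' k) \<le> L * ((norm (y - c))\<^sup>2 / (real N)\<^sup>2)" if "k < N" for k
  proof -
    have "u' (Suc k) - u' k = (1 / real N) *\<^sub>R (y - c)"
    proof -
      have "min 1 (real (Suc k) / real N) - min 1 (real k / real N) = 1 / real N"
        using that by (simp add: min_absorb2 divide_le_eq flip: diff_divide_distrib)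
      then show ?thesis
        unfolding u'_def by (metis add_diff_cancel_left scaleR_left_diff_distrib)
    qed
    then show ?thesis
      using G_upper [OF u' [of k], of "u' (Suc k) - u' k"]
      by (simp add: gq_def power_divide)
  qed
  then have "(\<Sum>k<N. gq (u' k) (u' (Suc k) - u' k)) \<le> (\<Sum>k<N. L * ((norm (y - c))\<^sup>2 / (real N)\<^sup>2))"
    by (intro sum_mono) auto
  also have "\<dots> = L * (norm (y - c))\<^sup>2 / real N"
    using N by (simp add: power2_eq_square)
  finally have "(\<Sum>k<N. gq (u k) (u (Suc k) - u k)) \<le> L * (norm (y - c))\<^sup>2 / real N"
    using min [of u'] u' N by (simp add: u'_def)
  moreover have "l * (\<Sum>k<N. (norm (u (Suc k) - u k))\<^sup>2) \<le> (\<Sum>k<N. gq (u k) (u (Suc k) - u k))"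
    unfolding sum_distrib_left gq_def by (intro sum_mono G_lower u)
  ultimately have "l * (\<Sum>k<N. (norm (u (Suc k) - u k))\<^sup>2) \<le> L * (norm (y - c))\<^sup>2 / real N"
    by linarith
  then have "(\<Sum>k<N. (norm (u (Suc k) - u k))\<^sup>2) \<le> (L * (norm (y - c))\<^sup>2 / real N) / l"
    by (subst pos_le_divide_eq [OF l_pos]) (simp only: mult.commute [of _ l])
  then show ?thesis
    by (simp add: mult.commute)
qed

text \<open>By Cauchy-Schwarz the squared length of the chain is at most \<open>N\<close> times the
  sum of squared steps, hence at most \<open>A\<close>. So the ball constraint is inactive and the
  Euler-Lagrange equation holds at every inner vertex.\<close>

lemma chain_stays_inside:
  assumes "u 0 = c" "k \<le> N" "0 < N"
    and "(\<Sum>k<N. (norm (u (Suc k) - u k))\<^sup>2) \<le> A / real N" "A < r\<^sup>2"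
  shows "u k \<in> ball c r"
proof -
  have "u k - c = (\<Sum>j<k. u (Suc j) - u j)"
    using assms(1) by (simp add: sum_lessThan_telescope)
  then have "norm (u k - c) \<le> (\<Sum>j<k. norm (u (Suc j) - u j))"
    by (simp add: sum_norm_le)
  also have "\<dots> \<le> (\<Sum>j<N. norm (u (Suc j) - u j))"
    using assms(2) by (intro sum_mono2) auto
  finally have "(norm (u k - c))\<^sup>2 \<le> (\<Sum>j<N. norm (u (Suc j) - u j))\<^sup>2"
    by (intro power_mono) auto
  also have "\<dots> \<le> real N * (\<Sum>j<N. (norm (u (Suc j) - u j))\<^sup>2)"
    using sum_squared_le_sum_of_squares [of "\<lambda>j. norm (u (Suc j) - u j)" "{..<N}"]
    by (simp add: mult.commute)
  also have "\<dots> \<le> A"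
    using assms(3,4) by (simp add: field_simps)
  finally have "(norm (u k - c))\<^sup>2 < r\<^sup>2"
    using assms(5) by simp
  then show ?thesis
    using r_pos by (simp add: power2_less_imp_less dist_norm norm_minus_commute)
qed

section \<open>From the momentum equation to the geodesic equation\<close>

lemma geodesic_acceleration:
  assumes x: "\<And>s. s \<in> S \<Longrightarrow> x s \<in> cball c r" and "t \<in> S"
    and deriv: "(x has_vector_derivative v t) (at t within S)"
    and P: "((\<lambda>s. G (x s) *v v s) has_vector_derivative (1/2) *\<^sub>R gforce (x t) (v t)) (at t within S)"
  shows "(v has_vector_derivative geodesic_acc (x t) (v t)) (at t within S)"
proof -
  have xt: "x t \<in> cball c r"
    using x \<open>t \<in> S\<close> by simp
  have "((\<lambda>s. G (x s)) has_derivative (\<lambda>h. DG (x t) (h *\<^sub>R v t))) (at t within S)"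
    by (rule has_derivative_compose [where g = G and f = x and g' = "DG (x t)", OF _ G_deriv [OF xt]])
      (use deriv in \<open>simp add: has_vector_derivative_def\<close>)
  then have "((\<lambda>s. G (x s)) has_vector_derivative DG (x t) (v t)) (at t within S)"
    by (simp add: has_vector_derivative_def linear_scale [OF DG_linear [OF xt]])
  then have "((\<lambda>s. G (x s) *v v t) has_vector_derivative DG (x t) (v t) *v v t) (at t within S)"
    by (rule bounded_linear.has_vector_derivative
        [OF bounded_bilinear.bounded_linear_left [OF mvm_bilinear]])
  \<comment> \<open>Freezing \<open>v t\<close> produces a difference that vanishes at
    \<open>s = t\<close> and is differentiable there although \<open>v\<close> is not yet known to
    be. Applying the continuous family of inverses to it returns \<open>v s - v t\<close>.\<close>
  from has_vector_derivative_diff [OF P this]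
  have D: "((\<lambda>s. G (x s) *v v s - G (x s) *v v t) has_vector_derivative
      (1/2) *\<^sub>R gforce (x t) (v t) - DG (x t) (v t) *v v t) (at t within S)" .
  have "(x \<longlongrightarrow> x t) (at t within S)"
    using has_vector_derivative_continuous [OF deriv] by (simp add: continuous_within)
  moreover have "\<forall>\<^sub>F s in at t within S. x s \<in> cball c r"
    using x by (auto simp: eventually_at_filter)
  ultimately have "((\<lambda>s. matrix_inv (G (x s))) \<longlongrightarrow> matrix_inv (G (x t))) (at t within S)"
    by (rule continuous_on_tendsto_compose [OF Ginv_cont _ xt])
  from has_vector_derivative_matrix_mult_zero [OF D _ this]
  have "((\<lambda>s. matrix_inv (G (x s)) *v (G (x s) *v v s - G (x s) *v v t))
      has_vector_derivative geodesic_acc (x t) (v t)) (at t within S)"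
    by (simp add: geodesic_acc_def)
  from has_vector_derivative_add [OF has_vector_derivative_const this, of "v t"]
  have "((\<lambda>s. v t + matrix_inv (G (x s)) *v (G (x s) *v v s - G (x s) *v v t))
      has_vector_derivative geodesic_acc (x t) (v t)) (at t within S)"
    by simp
  then show ?thesis
    by (rule has_vector_derivative_transform [OF \<open>t \<in> S\<close>, rotated])
      (simp add: mvm_diff matrix_inv_mult_vector(2) [OF det_G [OF x]])
qed

text \<open>The momentum equation contributes half the pairing of \<open>v\<close> with
  \<open>gforce\<close>, the acceleration contributes the same half minus the full pairing, and the
  sum is zero. This supplies the constant speed of the geodesics.\<close>

lemma geodesic_energy_constant:
  assumes x: "\<And>s. s \<in> {0..1} \<Longrightarrow> x s \<in> cball c r"
    and deriv: "\<And>t. t \<in> {0..1} \<Longrightarrow> (x has_vector_derivative v t) (at t within {0..1})"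
    and acc: "\<And>t. t \<in> {0..1} \<Longrightarrow>
      (v has_vector_derivative geodesic_acc (x t) (v t)) (at t within {0..1})"
    and P: "\<And>t. t \<in> {0..1} \<Longrightarrow>
      ((\<lambda>s. G (x s) *v v s) has_vector_derivative (1/2) *\<^sub>R gforce (x t) (v t)) (at t within {0..1})"
    and t: "t \<in> {0..1}"
  shows "gq (x t) (v t) = gq (x 0) (v 0)"
proof -
  have "((\<lambda>s. gq (x s) (v s)) has_derivative (\<lambda>h. 0)) (at t within {0..1})" if t: "t \<in> {0..1}" for t
  proof -
    have xt: "x t \<in> cball c r"
      using x t by simp
    have "((\<lambda>s. gq (x s) (v s)) has_vector_derivative
        v t \<bullet> ((1/2) *\<^sub>R gforce (x t) (v t)) + geodesic_acc (x t) (v t) \<bullet> (G (x t) *v v t)) (at t within {0..1})"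
      unfolding gq_def
      by (rule bounded_bilinear.has_vector_derivative [OF bounded_bilinear_inner acc [OF t] P [OF t]])
    moreover have "geodesic_acc (x t) (v t) \<bullet> (G (x t) *v v t)
        = v t \<bullet> ((1/2) *\<^sub>R gforce (x t) (v t)) - v t \<bullet> gforce (x t) (v t)"
      using G_inner [OF xt, of "geodesic_acc (x t) (v t)" "v t"]
      by (simp add: geodesic_acc_def matrix_inv_mult_vector [OF det_G [OF xt]] inner_diff_right
          inner_gforce [OF xt])
    ultimately show ?thesis
      by (simp add: has_vector_derivative_def)
  qed
  then show ?thesis
    using has_derivative_zero_constant [of "{0..1}" "\<lambda>s. gq (x s) (v s)"] t
    by (metis atLeastAtMost_iff convex_real_interval(5) less_eq_real_def zero_less_one)
qed

section \<open>A priori bounds and the continuum limit\<close>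

lemma l_le_L: "l \<le> L"
proof -
  define e :: "real^'d" where "e = axis undefined 1"
  have "norm e = 1"
    by (simp add: e_def norm_axis_1)
  then show ?thesis
    using G_lower [of c e] G_upper [of c e] r_pos by simp
qed

lemma near_imp_in_ball:
  assumes "L * (norm (y - c))\<^sup>2 < l * r\<^sup>2"
  shows "y \<in> cball c r"
proof -
  have "l * (norm (y - c))\<^sup>2 \<le> L * (norm (y - c))\<^sup>2"
    by (intro mult_right_mono l_le_L) auto
  then have "l * (norm (y - c))\<^sup>2 < l * r\<^sup>2"
    using assms by simp
  then have "(norm (y - c))\<^sup>2 < r\<^sup>2"
    using l_pos by simp
  then have "norm (y - c) < r"
    using r_pos by (simp add: power2_less_imp_less)
  then show ?thesis
    by (simp add: dist_norm norm_minus_commute)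
qed

text \<open>Minimality yields that the squares of \<open>V n k\<close> sum to at most
  \<open>(n + 1) A\<close>. By the Euler-Lagrange equation the increments of \<open>m\<close> are at
  most \<open>K |V|^2 / (n + 1)\<close>, so its total variation is at most \<open>K A\<close>.
  Averaging bounds \<open>m n 0\<close>, hence all of \<open>m\<close>, and ellipticity bounds each
  \<open>V n k\<close>.\<close>

lemma discrete_geodesics:
  assumes y: "L * (norm (y - c))\<^sup>2 < l * r\<^sup>2"
  obtains u V m :: "nat \<Rightarrow> nat \<Rightarrow> real^'d" and B M :: real
  where "\<And>n. u n 0 = c" "\<And>n. u n (Suc n) = y" "\<And>n k. u n k \<in> cball c r"
    and "\<And>n k. V n k = real (Suc n) *\<^sub>R (u n (Suc k) - u n k)"
    and "\<And>n k. m n (Suc k) = G (u n k) *v V n k"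
    and "\<And>n k. k < Suc n \<Longrightarrow>
      m n (Suc k) - m n k = (1 / real (Suc n)) *\<^sub>R ((1/2) *\<^sub>R gforce (u n k) (V n k))"
    and "\<And>n k. k \<le> Suc n \<Longrightarrow> norm (m n k) \<le> B"
    and "\<And>n k. k < Suc n \<Longrightarrow> norm (V n k) \<le> M"
    and "\<And>n k. k < Suc n \<Longrightarrow> norm ((1/2) *\<^sub>R gforce (u n k) (V n k)) \<le> M"
    and "\<And>n u'. u' 0 = c \<Longrightarrow> u' (Suc n) = y \<Longrightarrow> (\<And>k. u' k \<in> cball c r) \<Longrightarrow>
      (\<Sum>k<Suc n. gq (u n k) (u n (Suc k) - u n k)) \<le> (\<Sum>k<Suc n. gq (u' k) (u' (Suc k) - u' k))"
proof -
  \<comment> \<open>The hypothesis on \<open>y\<close> is equivalent to \<open>A < r^2\<close>, the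
    form in which \<open>chain_stays_inside\<close> uses it.\<close>
  define A where "A = L / l * (norm (y - c))\<^sup>2"
  have yb: "y \<in> cball c r"
    by (rule near_imp_in_ball [OF y])
  have A: "0 \<le> A" "A < r\<^sup>2"
    using y l_pos l_le_L by (auto simp: A_def field_simps)
  define good where "good n u \<longleftrightarrow> u 0 = c \<and> u (Suc n) = y \<and> (\<forall>k. u k \<in> cball c r) \<and>
      (\<forall>u'. u' 0 = c \<longrightarrow> u' (Suc n) = y \<longrightarrow> (\<forall>k. u' k \<in> cball c r) \<longrightarrow>
        (\<Sum>k<Suc n. gq (u k) (u (Suc k) - u k)) \<le> (\<Sum>k<Suc n. gq (u' k) (u' (Suc k) - u' k)))"
    for n u
  have "\<exists>u. good n u" for n
    by (rule minimal_chain [OF yb zero_less_Suc, of n]) (unfold good_def, blast)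
  then obtain u where "\<And>n. good n (u n)"
    by metis
  then have u0: "\<And>n. u n 0 = c" and uN: "\<And>n. u n (Suc n) = y"
    and u: "\<And>n k. u n k \<in> cball c r"
    and min: "\<And>n u'. u' 0 = c \<Longrightarrow> u' (Suc n) = y \<Longrightarrow> (\<And>k. u' k \<in> cball c r) \<Longrightarrow>
      (\<Sum>k<Suc n. gq (u n k) (u n (Suc k) - u n k)) \<le> (\<Sum>k<Suc n. gq (u' k) (u' (Suc k) - u' k))"
    unfolding good_def by blast+
  define V where "V n k = real (Suc n) *\<^sub>R (u n (Suc k) - u n k)" for n k
  \<comment> \<open>The momentum is shifted by one: \<open>m n (Suc k)\<close> belongs to edge
    \<open>k\<close>. The value at 0 belongs to no edge and is extrapolated so that the step
    equation holds for the first edge as well.\<close>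
  define m where "m n k = (case k of
      0 \<Rightarrow> G (u n 0) *v V n 0 - (1 / real (Suc n)) *\<^sub>R ((1/2) *\<^sub>R gforce (u n 0) (V n 0))
    | Suc j \<Rightarrow> G (u n j) *v V n j)" for n k
  have sum_\<Delta>: "(\<Sum>k<Suc n. (norm (u n (Suc k) - u n k))\<^sup>2) \<le> A / real (Suc n)" for n
    unfolding A_def by (intro chain_energy_bound yb min u) auto
  have sum_V: "(\<Sum>k<Suc n. (norm (V n k))\<^sup>2) \<le> real (Suc n) * A" for n
  proof -
    have "(\<Sum>k<Suc n. (norm (V n k))\<^sup>2)
        = (real (Suc n))\<^sup>2 * (\<Sum>k<Suc n. (norm (u n (Suc k) - u n k))\<^sup>2)"
      unfolding sum_distrib_left V_def by (simp add: power_mult_distrib)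
    also have "\<dots> \<le> (real (Suc n))\<^sup>2 * (A / real (Suc n))"
      by (intro mult_left_mono sum_\<Delta>) auto
    finally show ?thesis
      by (simp add: power2_eq_square)
  qed
  have inside: "u n k \<in> ball c r" if "k \<le> Suc n" for n k
    by (rule chain_stays_inside [OF u0 that _ sum_\<Delta> A(2)]) simp
  have step: "m n (Suc k) - m n k = (1 / real (Suc n)) *\<^sub>R ((1/2) *\<^sub>R gforce (u n k) (V n k))"
    if k: "k < Suc n" for n k
  proof (cases k)
    case 0
    then show ?thesis
      by (simp add: m_def)
  next
    case (Suc j)
    define \<Delta> where "\<Delta> i = u n (Suc i) - u n i" for i
    have "G (u n (Suc j)) *v \<Delta> (Suc j) - G (u n j) *v \<Delta> j = (1/2) *\<^sub>R gforce (u n (Suc j)) (\<Delta> (Suc j))"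
      unfolding \<Delta>_def using Suc k u0 uN
      by (intro discrete_euler_lagrange [where N = "Suc n"] u min inside) auto
    \<comment> \<open>As \<open>gforce\<close> is quadratic, passing from steps to velocities takes
      the square of the factor \<open>Suc n\<close> on the right and its first power on the left,
      which leaves \<open>1 / Suc n\<close>.\<close>
    then have "real (Suc n) *\<^sub>R (G (u n (Suc j)) *v \<Delta> (Suc j) - G (u n j) *v \<Delta> j)
        = (1 / real (Suc n)) *\<^sub>R ((1/2) *\<^sub>R ((real (Suc n))\<^sup>2 *\<^sub>R gforce (u n (Suc j)) (\<Delta> (Suc j))))"
      by (simp add: power2_eq_square)
    then show ?thesis
      by (simp only: Suc m_def nat.case V_def \<Delta>_def gforce_scaleR mvm_scaleR scaleR_diff_right [symmetric])
  qed
  obtain K where K: "0 < K" "\<And>x v. x \<in> cball c r \<Longrightarrow> norm (gforce x v) \<le> K * (norm v)\<^sup>2"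
    using gforce_bound by metis
  obtain g where g: "0 < g" "\<And>x v. x \<in> cball c r \<Longrightarrow> norm (G x *v v) \<le> g * norm v"
    using matrix_family_bound [OF compact_cball G_cont] by metis
  have incr: "norm (m n (Suc k) - m n k) \<le> K / real (Suc n) * (norm (V n k))\<^sup>2" if "k < Suc n" for n k
  proof -
    have "norm (m n (Suc k) - m n k) = norm (gforce (u n k) (V n k)) / (2 * real (Suc n))"
      by (simp add: step [OF that])
    also have "\<dots> \<le> (K * (norm (V n k))\<^sup>2) / (2 * real (Suc n))"
      by (intro divide_right_mono K u) auto
    also have "\<dots> \<le> (K * (norm (V n k))\<^sup>2) / real (Suc n)"
      using K(1) by (intro divide_left_mono) auto
    finally show ?thesis
      by simp
  qed
  have var: "(\<Sum>k<Suc n. norm (m n (Suc k) - m n k)) \<le> K * A" for n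
  proof -
    have "(\<Sum>k<Suc n. norm (m n (Suc k) - m n k)) \<le> (\<Sum>k<Suc n. K / real (Suc n) * (norm (V n k))\<^sup>2)"
      by (intro sum_mono incr) simp
    also have "\<dots> \<le> K / real (Suc n) * (real (Suc n) * A)"
      unfolding sum_distrib_left [symmetric] using K(1) by (intro mult_left_mono sum_V) auto
    also have "\<dots> = K * A"
      by simp
    finally show ?thesis .
  qed
  have osc: "norm (m n j - m n 0) \<le> K * A" if "j \<le> Suc n" for n j
  proof -
    have "m n j - m n 0 = (\<Sum>k<j. m n (Suc k) - m n k)"
      by (simp add: sum_lessThan_telescope)
    then have "norm (m n j - m n 0) \<le> (\<Sum>k<j. norm (m n (Suc k) - m n k))"
      by (simp add: sum_norm_le)
    also have "\<dots> \<le> (\<Sum>k<Suc n. norm (m n (Suc k) - m n k))"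
      using that by (intro sum_mono2) auto
    finally show ?thesis
      using var [of n] by linarith
  qed
  \<comment> \<open>Every edge bounds \<open>m n 0\<close> up to the oscillation of
    \<open>m\<close>; averaging over the edges replaces the still uncontrolled
    \<open>|V n k|^2\<close> by its mean, which is at most \<open>A\<close>.\<close>
  have m0: "norm (m n 0) \<le> g * (1 + A) + K * A" for n
  proof -
    have "norm (m n 0) \<le> g * (1 + (norm (V n k))\<^sup>2) + K * A" if "k < Suc n" for k
    proof -
      have "norm (V n k) \<le> 1 + (norm (V n k))\<^sup>2"
        using sum_power2_ge_zero [of "norm (V n k) - 1/2" 0] by (simp add: power2_eq_square algebra_simps)
      then have "norm (m n (Suc k)) \<le> g * (1 + (norm (V n k))\<^sup>2)"
        using g(2) [OF u [of n k], of "V n k"] g(1)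
        by (simp add: m_def) (smt (verit) mult_left_mono)
      then show ?thesis
        using osc [of "Suc k" n] that norm_triangle_ineq2 [of "m n 0" "m n (Suc k)"]
        by (simp add: norm_minus_commute)
    qed
    then have "(\<Sum>k<Suc n. norm (m n 0)) \<le> (\<Sum>k<Suc n. g * (1 + (norm (V n k))\<^sup>2) + K * A)"
      by (intro sum_mono) auto
    also have "\<dots> = real (Suc n) * (g + K * A) + g * (\<Sum>k<Suc n. (norm (V n k))\<^sup>2)"
      unfolding sum_distrib_left by (simp only: sum.distrib distrib_left mult_1_right sum_constant card_lessThan)
    also have "\<dots> \<le> real (Suc n) * (g + K * A) + g * (real (Suc n) * A)"
      using g(1) by (intro add_left_mono mult_left_mono sum_V) auto
    also have "\<dots> = real (Suc n) * (g * (1 + A) + K * A)"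
      by (simp add: algebra_simps)
    finally have "real (Suc n) * norm (m n 0) \<le> real (Suc n) * (g * (1 + A) + K * A)"
      by (simp only: sum_constant card_lessThan)
    then show ?thesis
      by (simp only: mult_le_cancel_left_pos of_nat_0_less_iff zero_less_Suc)
  qed
  define B where "B = g * (1 + A) + K * A + K * A"
  have B: "norm (m n k) \<le> B" if "k \<le> Suc n" for n k
    using m0 [of n] osc [OF that] norm_triangle_sub [of "m n k" "m n 0"]
    unfolding B_def by linarith
  have VB: "norm (V n k) \<le> B / l" if "k < Suc n" for n k
  proof -
    have "l * norm (V n k) \<le> norm (m n (Suc k))"
      unfolding m_def nat.case by (rule G_lower_norm [OF u])
    also have "\<dots> \<le> B"
      using that by (intro B) auto
    finally show ?thesis
      using l_pos by (simp add: field_simps)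
  qed
  have QB: "norm ((1/2) *\<^sub>R gforce (u n k) (V n k)) \<le> K * (B / l)\<^sup>2" if "k < Suc n" for n k
  proof -
    have "norm ((1/2) *\<^sub>R gforce (u n k) (V n k)) \<le> norm (gforce (u n k) (V n k))"
      by simp
    also have "\<dots> \<le> K * (norm (V n k))\<^sup>2"
      by (intro K u)
    also have "\<dots> \<le> K * (B / l)\<^sup>2"
      using K(1) VB [OF that] by (intro mult_left_mono power_mono) auto
    finally show ?thesis .
  qed
  show ?thesis
  \<comment> \<open>One constant for velocities and forces, the step rates of the pair of position
    and momentum.\<close>
  proof (rule that [of u V m B "max (B / l) (K * (B / l)\<^sup>2)"])
    show "norm (V n k) \<le> max (B / l) (K * (B / l)\<^sup>2)" if "k < Suc n" for n k
      using VB [OF that] by simp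
    show "norm ((1/2) *\<^sub>R gforce (u n k) (V n k)) \<le> max (B / l) (K * (B / l)\<^sup>2)" if "k < Suc n" for n k
      using QB [OF that] by (rule max.coboundedI2)
  qed (use u0 uN u V_def step B min in \<open>simp_all add: m_def\<close>)
qed

text \<open>Difference equations become integral equations along a convergent subsequence.
  Minimality survives because a competitor sampled on the grids is an admissible chain, and its
  discrete energies converge to its energy.\<close>

lemma ex_minimizing_geodesic:
  assumes y: "L * (norm (y - c))\<^sup>2 < l * r\<^sup>2"
  obtains x v where "x 0 = c" "x 1 = y" "\<And>t. t \<in> {0..1} \<Longrightarrow> x t \<in> cball c r"
    and "\<And>t. t \<in> {0..1} \<Longrightarrow> (x has_vector_derivative v t) (at t within {0..1})"
    and "\<And>t. t \<in> {0..1} \<Longrightarrow>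
      (v has_vector_derivative geodesic_acc (x t) (v t)) (at t within {0..1})"
    and "\<And>t. t \<in> {0..1} \<Longrightarrow> gq (x t) (v t) = gq (x 0) (v 0)"
    and "\<And>\<eta> \<eta>'. (\<And>t. t \<in> {0..1} \<Longrightarrow> \<eta> t \<in> cball c r) \<Longrightarrow>
      (\<And>t. t \<in> {0..1} \<Longrightarrow> (\<eta> has_vector_derivative \<eta>' t) (at t within {0..1})) \<Longrightarrow>
      continuous_on {0..1} \<eta>' \<Longrightarrow> \<eta> 0 = c \<Longrightarrow> \<eta> 1 = y \<Longrightarrow>
      gq (x 0) (v 0) \<le> integral {0..1} (\<lambda>t. gq (\<eta> t) (\<eta>' t))"
proof -
  obtain u V m :: "nat \<Rightarrow> nat \<Rightarrow> real^'d" and B M :: real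
    where u0: "\<And>n. u n 0 = c" and uN: "\<And>n. u n (Suc n) = y" and u: "\<And>n k. u n k \<in> cball c r"
    and V: "\<And>n k. V n k = real (Suc n) *\<^sub>R (u n (Suc k) - u n k)"
    and m: "\<And>n k. m n (Suc k) = G (u n k) *v V n k"
    and mstep: "\<And>n k. k < Suc n \<Longrightarrow>
      m n (Suc k) - m n k = (1 / real (Suc n)) *\<^sub>R ((1/2) *\<^sub>R gforce (u n k) (V n k))"
    and mB: "\<And>n k. k \<le> Suc n \<Longrightarrow> norm (m n k) \<le> B"
    and VM: "\<And>n k. k < Suc n \<Longrightarrow> norm (V n k) \<le> M"
    and QM: "\<And>n k. k < Suc n \<Longrightarrow> norm ((1/2) *\<^sub>R gforce (u n k) (V n k)) \<le> M"
    and min: "\<And>n u'. u' 0 = c \<Longrightarrow> u' (Suc n) = y \<Longrightarrow> (\<And>k. u' k \<in> cball c r) \<Longrightarrow>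
      (\<Sum>k<Suc n. gq (u n k) (u n (Suc k) - u n k)) \<le> (\<Sum>k<Suc n. gq (u' k) (u' (Suc k) - u' k))"
    by (rule discrete_geodesics [OF y]) blast
  have ustep: "u n (Suc k) - u n k = (1 / real (Suc n)) *\<^sub>R V n k" for n k
    by (simp add: V del: of_nat_Suc)
  have mstep_norm: "norm (m n (Suc k) - m n k) \<le> M / real (Suc n)" if "k < Suc n" for n k
    unfolding mstep [OF that] using divide_right_mono [OF QM [OF that], of "real (Suc n)"]
    by (simp add: mult.commute del: of_nat_Suc)
  have ustep_norm: "norm (u n (Suc k) - u n k) \<le> M / real (Suc n)" if "k < Suc n" for n k
    unfolding ustep using divide_right_mono [OF VM [OF that], of "real (Suc n)"]
    by (simp del: of_nat_Suc)
  obtain g \<rho> where g: "continuous_on {0..1} g" and \<rho>: "strict_mono (\<rho> :: nat \<Rightarrow> nat)"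
    and conv: "\<And>e. 0 < e \<Longrightarrow> \<exists>n0. \<forall>n\<ge>n0. \<forall>k\<le>Suc (\<rho> n).
       norm ((u (\<rho> n) k, m (\<rho> n) k) - g (real k / real (Suc (\<rho> n)))) < e"
  \<comment> \<open>Working with pairs lets one subsequence serve position and momentum. Positions
    stay in the ball, whence the bound \<open>norm c + r\<close>.\<close>
  proof (rule discrete_Arzela_Ascoli [of "\<lambda>n k. (u n k, m n k)" "norm c + r + B" "M + M"])
    show "norm (u n k, m n k) \<le> norm c + r + B" if "k \<le> Suc n" for n k
      using norm_Pair_le [of "u n k" "m n k"] mB [OF that] u [of n k] norm_triangle_sub [of "u n k" c]
      by (simp add: dist_norm norm_minus_commute)
    show "norm ((u n (Suc k), m n (Suc k)) - (u n k, m n k)) \<le> (M + M) / real (Suc n)"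
      if "k < Suc n" for n k
      using norm_Pair_le [of "u n (Suc k) - u n k" "m n (Suc k) - m n k"]
        ustep_norm [OF that] mstep_norm [OF that]
      by (simp add: add_divide_distrib del: of_nat_Suc)
  qed blast
  define N where "N n = Suc (\<rho> n)" for n
  define x where "x t = fst (g t)" for t
  define P where "P t = snd (g t)" for t
  \<comment> \<open>The velocity is read off the limit momentum; that it is the derivative of
    \<open>x\<close> comes from the integral equation for \<open>x\<close>.\<close>
  define v where "v t = matrix_inv (G (x t)) *v P t" for t
  have "strict_mono N"
    using \<rho> by (simp add: N_def strict_mono_def)
  then have N: "filterlim N at_top sequentially"
    by (rule filterlim_subseq)
  have N_pos: "0 < N n" for n
    by (simp add: N_def)
  have xP: "continuous_on {0..1} x" "continuous_on {0..1} P"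
    unfolding x_def P_def using g by (intro continuous_intros; assumption)+
  have conv_u: "\<forall>\<^sub>F n in sequentially. \<forall>k\<le>N n. norm (u (\<rho> n) k - x (real k / real (N n))) < e"
    and conv_m: "\<forall>\<^sub>F n in sequentially. \<forall>k\<le>N n. norm (m (\<rho> n) k - P (real k / real (N n))) < e"
    if e: "0 < e" for e
  proof -
    obtain n0 where n0: "\<And>n k. n0 \<le> n \<Longrightarrow> k \<le> N n \<Longrightarrow>
        norm ((u (\<rho> n) k, m (\<rho> n) k) - g (real k / real (N n))) < e"
      using conv [OF e] unfolding N_def by blast
    have "norm (u (\<rho> n) k - x (real k / real (N n))) < e \<and> norm (m (\<rho> n) k - P (real k / real (N n))) < e"
      if "n0 \<le> n" "k \<le> N n" for n k
      using n0 [OF that] norm_fst_le [of "u (\<rho> n) k - x (real k / real (N n))" "m (\<rho> n) k - P (real k / real (N n))"]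
        norm_snd_le [of "m (\<rho> n) k - P (real k / real (N n))" "u (\<rho> n) k - x (real k / real (N n))"]
      by (simp add: x_def P_def minus_prod_def)
    then show "\<forall>\<^sub>F n in sequentially. \<forall>k\<le>N n. norm (u (\<rho> n) k - x (real k / real (N n))) < e"
      and "\<forall>\<^sub>F n in sequentially. \<forall>k\<le>N n. norm (m (\<rho> n) k - P (real k / real (N n))) < e"
      unfolding eventually_sequentially by blast+
  qed
  have x_lim: "x t \<in> cball c r" and P_lim: "P t \<in> cball 0 B" if t: "t \<in> {0..1}" for t
  proof -
    obtain k where k: "\<And>n. k n \<le> N n" "(\<lambda>n. real (k n) / real (N n)) \<longlonglongrightarrow> t"
      using grid_points [OF N t] by blast
    show "x t \<in> cball c r"
      by (rule closed_sequentially [OF closed_cball _ grid_tendsto [OF xP(1) t conv_u k]]) (rule u)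
    show "P t \<in> cball 0 B"
      by (rule closed_sequentially [OF closed_cball _ grid_tendsto [OF xP(2) t conv_m k]])
        (use k(1) mB in \<open>simp add: N_def\<close>)
  qed
  have x0: "x 0 = c"
  proof -
    have "(\<lambda>n. u (\<rho> n) 0) \<longlonglongrightarrow> x 0"
      by (rule grid_tendsto [OF xP(1) _ conv_u]) auto
    then show ?thesis
      by (simp add: u0 LIMSEQ_const_iff)
  qed
  have x1: "x 1 = y"
  proof -
    have "(\<lambda>n. u (\<rho> n) (N n)) \<longlonglongrightarrow> x 1"
      by (rule grid_tendsto [OF xP(1) _ conv_u]) (auto simp: N_def)
    then show ?thesis
      by (simp add: u0 uN N_def LIMSEQ_const_iff)
  qed
  have close: "unif_close N (\<lambda>n. u (\<rho> n)) x" "unif_close N (\<lambda>n. m (\<rho> n)) P"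
    unfolding unif_close_def using conv_u conv_m by (fastforce elim: eventually_mono)+
  have close_v: "unif_close N (\<lambda>n. V (\<rho> n)) v"
  \<comment> \<open>\<open>V\<close> at \<open>k\<close> is recovered from \<open>m\<close> at
    \<open>Suc k\<close>, whereas convergence of \<open>m\<close> is known at \<open>k\<close>. The
    shift costs one momentum step, at most \<open>M / N\<close>, divided by
    \<open>l\<close>.\<close>
  proof (rule unif_close_perturb [OF _ N])
    have "continuous_on (cball c r \<times> cball 0 B) (\<lambda>(x, p). matrix_inv (G x) *v p)"
      unfolding case_prod_unfold
      by (intro continuous_intros continuous_on_compose2 [OF Ginv_cont]) auto
    from unif_close_compose [OF unif_close_Pair [OF close] _ this]
    show "unif_close N (\<lambda>n k. matrix_inv (G (u (\<rho> n) k)) *v m (\<rho> n) k) v"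
      unfolding v_def using u mB x_lim P_lim by (simp add: compact_Times N_def)
    fix n k
    assume k: "k < N n"
    have "V (\<rho> n) k = matrix_inv (G (u (\<rho> n) k)) *v m (\<rho> n) (Suc k)"
      by (simp add: m matrix_inv_mult_vector [OF det_G [OF u]])
    then have "norm (V (\<rho> n) k - matrix_inv (G (u (\<rho> n) k)) *v m (\<rho> n) k)
        = norm (matrix_inv (G (u (\<rho> n) k)) *v (m (\<rho> n) (Suc k) - m (\<rho> n) k))"
      by (simp add: mvm_diff)
    also have "\<dots> \<le> norm (m (\<rho> n) (Suc k) - m (\<rho> n) k) / l"
      by (rule Ginv_norm [OF u])
    also have "\<dots> \<le> (M / real (N n)) / l"
      using mstep_norm [of k "\<rho> n"] k l_pos unfolding N_def by (intro divide_right_mono) auto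
    finally show "norm (V (\<rho> n) k - matrix_inv (G (u (\<rho> n) k)) *v m (\<rho> n) k) \<le> (M / l) / real (N n)"
      by (simp add: mult.commute)
  qed
  have v_cont: "continuous_on {0..1} v"
    unfolding v_def
    by (intro continuous_intros xP continuous_on_compose2 [OF Ginv_cont xP(1)]) (use x_lim in auto)
  have v_bound: "v t \<in> cball 0 (B / l)" if "t \<in> {0..1}" for t
  proof -
    have "norm (v t) \<le> norm (P t) / l"
      unfolding v_def by (rule Ginv_norm [OF x_lim [OF that]])
    also have "\<dots> \<le> B / l"
      using P_lim [OF that] l_pos by (intro divide_right_mono) auto
    finally show ?thesis
      by simp
  qed
  define C where "C = max M (B / l)"
  have close_comp: "unif_close N (\<lambda>n k. f (u (\<rho> n) k) (V (\<rho> n) k)) (\<lambda>t. f (x t) (v t))"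
    if f: "continuous_on (cball c r \<times> UNIV) (\<lambda>(x, v). f x v)"
    for f :: "real^'d \<Rightarrow> real^'d \<Rightarrow> 'b::real_normed_vector"
  proof -
    have "continuous_on (cball c r \<times> cball 0 C) (\<lambda>(x, v). f x v)"
      by (rule continuous_on_subset [OF f]) auto
    from unif_close_compose [OF unif_close_Pair [OF close(1) close_v] _ this]
    show ?thesis
      using u VM x_lim v_bound by (simp add: compact_Times N_def C_def le_max_iff_disj)
  qed
  have comp_cont: "continuous_on {0..1} (\<lambda>t. f (x t) (v t))"
    if f: "continuous_on (cball c r \<times> UNIV) (\<lambda>(x, v). f x v)"
    for f :: "real^'d \<Rightarrow> real^'d \<Rightarrow> 'b::real_normed_vector"
    using continuous_on_compose2 [OF f continuous_on_Pair [OF xP(1) v_cont]] x_lim by force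
  have x_eq: "x t = x 0 + integral {0..t} v" if "t \<in> {0..1}" for t
    by (rule unif_close_antiderivative [OF close_v N v_cont xP(1) conv_u _ that])
      (simp_all add: N_def ustep del: of_nat_Suc)
  have half: "continuous_on (cball c r \<times> UNIV) (\<lambda>(x, v). (1/2) *\<^sub>R gforce x v)"
    using continuous_on_scaleR [OF continuous_on_const gforce_cont] by (simp add: case_prod_unfold)
  have P_eq: "P t = P 0 + integral {0..t} (\<lambda>t. (1/2) *\<^sub>R gforce (x t) (v t))" if "t \<in> {0..1}" for t
    by (rule unif_close_antiderivative [OF close_comp [OF half] N comp_cont [OF half] xP(2) conv_m _ that])
      (simp_all only: N_def mstep)
  have x_deriv: "(x has_vector_derivative v t) (at t within {0..1})" if t: "t \<in> {0..1}" for t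
  proof -
    have "((\<lambda>t. x 0 + integral {0..t} v) has_vector_derivative 0 + v t) (at t within {0..1})"
      by (intro has_vector_derivative_add has_vector_derivative_const
          integral_has_vector_derivative v_cont t)
    then show ?thesis
      by (intro has_vector_derivative_transform [OF t x_eq]) auto
  qed
  have P_deriv: "(P has_vector_derivative (1/2) *\<^sub>R gforce (x t) (v t)) (at t within {0..1})"
    if t: "t \<in> {0..1}" for t
  proof -
    have "((\<lambda>t. P 0 + integral {0..t} (\<lambda>t. (1/2) *\<^sub>R gforce (x t) (v t)))
        has_vector_derivative 0 + (1/2) *\<^sub>R gforce (x t) (v t)) (at t within {0..1})"
      by (intro has_vector_derivative_add has_vector_derivative_const
          integral_has_vector_derivative comp_cont half t)
    then show ?thesis
      by (intro has_vector_derivative_transform [OF t P_eq]) auto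
  qed
  have GvP: "G (x t) *v v t = P t" if "t \<in> {0..1}" for t
    unfolding v_def by (rule matrix_inv_mult_vector(1) [OF det_G [OF x_lim [OF that]]])
  have Gv_deriv: "((\<lambda>s. G (x s) *v v s) has_vector_derivative (1/2) *\<^sub>R gforce (x t) (v t))
      (at t within {0..1})" if t: "t \<in> {0..1}" for t
    by (rule has_vector_derivative_transform [OF t GvP P_deriv [OF t]])
  have v_deriv: "(v has_vector_derivative geodesic_acc (x t) (v t)) (at t within {0..1})"
    if t: "t \<in> {0..1}" for t
    by (rule geodesic_acceleration [OF x_lim t x_deriv [OF t] Gv_deriv [OF t]])
  have const: "gq (x t) (v t) = gq (x 0) (v 0)" if t: "t \<in> {0..1}" for t
    by (rule geodesic_energy_constant [OF x_lim x_deriv v_deriv Gv_deriv t])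
  have energy: "integral {0..1} (\<lambda>t. gq (x t) (v t)) = gq (x 0) (v 0)"
  proof -
    have "integral {0..1} (\<lambda>t. gq (x t) (v t)) = integral {0..1::real} (\<lambda>t. gq (x 0) (v 0))"
      by (rule integral_cong) (rule const)
    then show ?thesis
      by simp
  qed
  have minimal: "gq (x 0) (v 0) \<le> integral {0..1} (\<lambda>t. gq (\<eta> t) (\<eta>' t))"
    if \<eta>: "\<And>t. t \<in> {0..1} \<Longrightarrow> \<eta> t \<in> cball c r"
      and d\<eta>: "\<And>t. t \<in> {0..1} \<Longrightarrow> (\<eta> has_vector_derivative \<eta>' t) (at t within {0..1})"
      and c\<eta>: "continuous_on {0..1} \<eta>'" and ends: "\<eta> 0 = c" "\<eta> 1 = y" for \<eta> \<eta>'
  proof -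
    define W where "W n k = real (N n) *\<^sub>R (\<eta> (real (Suc k) / real (N n)) - \<eta> (real k / real (N n)))" for n k
    have grid: "real k / real (N n) \<in> {0..1}" if "k \<le> N n" for k n
      using that by (auto simp: divide_le_eq)
    have \<eta>_cont: "continuous_on {0..1} \<eta>"
      using d\<eta> by (rule continuous_on_vector_derivative)
    have close_\<eta>: "unif_close N (\<lambda>n k. \<eta> (real k / real (N n))) \<eta>"
      by (simp add: unif_close_def)
    have close_W: "unif_close N W \<eta>'"
      unfolding W_def by (rule unif_close_difference_quotient [OF d\<eta> c\<eta> N])
    have "bounded (\<eta>' ` {0..1})"
      by (intro compact_imp_bounded compact_continuous_image c\<eta>) simp
    then obtain D where "\<forall>t\<in>{0..1}. norm (\<eta>' t) \<le> D"
      unfolding bounded_iff by blast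
    then have D: "norm (\<eta>' t) \<le> D" if "t \<in> {0..1}" for t
      using that by blast
    have W_bound: "norm (W n k) \<le> D" if "k < N n" for n k
    proof -
      define s where "s = real k / real (N n)"
      define t where "t = real (Suc k) / real (N n)"
      have st: "0 \<le> s" "s \<le> t" "t \<le> 1" "t - s = 1 / real (N n)"
        using that by (auto simp: s_def t_def divide_simps)
      have "norm ((t - s) *\<^sub>R 0 - (\<eta> t - \<eta> s)) \<le> D * (t - s)"
        by (rule C1_increment [OF d\<eta> c\<eta> st(1-3)]) (use st D in auto)
      then have "norm (\<eta> t - \<eta> s) \<le> D / real (N n)"
        by (simp add: st(4) norm_minus_commute)
      then have "real (N n) * norm (\<eta> t - \<eta> s) \<le> real (N n) * (D / real (N n))"
        by (rule mult_left_mono) simp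
      then show ?thesis
        using N_pos [of n] by (simp add: W_def s_def t_def)
    qed
    have cont: "continuous_on (cball c r \<times> cball 0 D) (\<lambda>(x, v). gq x v)"
      by (rule continuous_on_subset [OF gq_cont]) auto
    have "unif_close N (\<lambda>n k. gq (\<eta> (real k / real (N n))) (W n k)) (\<lambda>t. gq (\<eta> t) (\<eta>' t))"
      using unif_close_compose [OF unif_close_Pair [OF close_\<eta> close_W] _ cont] W_bound D \<eta> grid
      by (simp add: compact_Times less_imp_le)
    then have lim: "(\<lambda>n. (1 / real (N n)) *\<^sub>R (\<Sum>k<N n. gq (\<eta> (real k / real (N n))) (W n k)))
        \<longlonglongrightarrow> integral {0..1} (\<lambda>t. gq (\<eta> t) (\<eta>' t))"
      by (rule unif_close_riemann_limit [OF _ N])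
        (use continuous_on_compose2 [OF gq_cont continuous_on_Pair [OF \<eta>_cont c\<eta>]] \<eta> in force)
    have lim': "(\<lambda>n. (1 / real (N n)) *\<^sub>R (\<Sum>k<N n. gq (u (\<rho> n) k) (V (\<rho> n) k))) \<longlonglongrightarrow> gq (x 0) (v 0)"
      using unif_close_riemann_limit [OF close_comp [OF gq_cont] N comp_cont [OF gq_cont]] energy by simp
    show ?thesis
    proof (rule LIMSEQ_le [OF lim' lim], intro exI allI impI)
      fix n
      \<comment> \<open>Times are truncated at 1 because chains are indexed by all of
        \<open>nat\<close>, while \<open>\<eta>\<close> is controlled on
        \<open>{0..1}\<close>.\<close>
      define u' where "u' k = \<eta> (min 1 (real k / real (N n)))" for k
      have "(\<Sum>k<N n. gq (u (\<rho> n) k) (u (\<rho> n) (Suc k) - u (\<rho> n) k)) \<le> (\<Sum>k<N n. gq (u' k) (u' (Suc k) - u' k))"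
        unfolding N_def
      proof (rule min)
        show "u' 0 = c" "u' (Suc (\<rho> n)) = y"
          by (simp_all add: u'_def ends N_def del: of_nat_Suc)
        show "u' k \<in> cball c r" for k
          unfolding u'_def by (rule \<eta>) auto
      qed
      moreover have "gq (u (\<rho> n) k) (V (\<rho> n) k) = (real (N n))\<^sup>2 * gq (u (\<rho> n) k) (u (\<rho> n) (Suc k) - u (\<rho> n) k)" for k
        by (simp add: V N_def gq_scaleR del: of_nat_Suc)
      moreover have "gq (\<eta> (real k / real (N n))) (W n k) = (real (N n))\<^sup>2 * gq (u' k) (u' (Suc k) - u' k)"
        if "k < N n" for k
      proof -
        have "min 1 (real k / real (N n)) = real k / real (N n)"
          "min 1 (real (Suc k) / real (N n)) = real (Suc k) / real (N n)"
          using that by (auto simp: min_def divide_simps)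
        then show ?thesis
          by (simp add: W_def u'_def gq_scaleR del: of_nat_Suc)
      qed
      ultimately show "(1 / real (N n)) *\<^sub>R (\<Sum>k<N n. gq (u (\<rho> n) k) (V (\<rho> n) k))
          \<le> (1 / real (N n)) *\<^sub>R (\<Sum>k<N n. gq (\<eta> (real k / real (N n))) (W n k))"
        by (intro scaleR_left_mono) (simp_all add: sum_distrib_left [symmetric] mult_left_mono)
    qed
  qed
  show ?thesis
    by (rule that [OF x0 x1 x_lim x_deriv v_deriv const minimal])
qed

text \<open>Since \<open>\<tau> \<le> 1\<close>, the energy up to the first exit time \<open>\<tau>\<close> is at least the squared length.\<close>

lemma leaving_ball_energy:
  assumes deriv: "\<And>t. t \<in> {0..1} \<Longrightarrow> (\<eta> has_vector_derivative \<eta>' t) (at t within {0..1})"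
    and cont: "continuous_on {0..1} \<eta>'" and "\<eta> 0 = c"
    and leaves: "t \<in> {0..1}" "\<eta> t \<notin> cball c r"
    and e: "continuous_on {0..1} e" "\<And>s. s \<in> {0..1} \<Longrightarrow> 0 \<le> e s"
    and eq: "\<And>s. s \<in> {0..1} \<Longrightarrow> \<eta> s \<in> cball c r \<Longrightarrow> e s = gq (\<eta> s) (\<eta>' s)"
  shows "l * r\<^sup>2 \<le> integral {0..1} e"
proof -
  have \<eta>_cont: "continuous_on {0..1} \<eta>"
    using deriv by (rule continuous_on_vector_derivative)
  then have d_cont: "continuous_on {0..1} (\<lambda>s. dist c (\<eta> s))"
    by (intro continuous_intros)
  \<comment> \<open>The times up to \<open>t\<close> at which the curve is outside the open ball;
    the minimum of this compact set is the first exit time.\<close>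
  define T where "T = {s \<in> {0..t}. r \<le> dist c (\<eta> s)}"
  have "T = {0..t} \<inter> (\<lambda>s. dist c (\<eta> s)) -` {r..}"
    by (auto simp: T_def)
  moreover have "closed ({0..t} \<inter> (\<lambda>s. dist c (\<eta> s)) -` {r..})"
    by (intro continuous_closed_preimage continuous_on_subset [OF d_cont]) (use leaves in auto)
  ultimately have "compact T"
    by (metis compact_Icc compact_Int_closed inf.absorb_iff2 inf_le1)
  moreover have "t \<in> T"
    using leaves by (simp add: T_def)
  ultimately obtain \<tau> where \<tau>: "\<tau> \<in> T" "\<And>s. s \<in> T \<Longrightarrow> \<tau> \<le> s"
    using compact_attains_inf [of T] by blast
  have \<tau>01: "0 \<le> \<tau>" "\<tau> \<le> t" "\<tau> \<le> 1" "r \<le> dist c (\<eta> \<tau>)"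
    using \<tau>(1) leaves by (auto simp: T_def)
  have before: "dist c (\<eta> s) < r" if "0 \<le> s" "s < \<tau>" for s
    using \<tau>(2) [of s] that \<tau>01 by (force simp: T_def)
  obtain s where s: "0 \<le> s" "s \<le> \<tau>" "dist c (\<eta> s) = r"
    using IVT' [of "\<lambda>s. dist c (\<eta> s)" 0 r \<tau>] \<tau>01 r_pos \<open>\<eta> 0 = c\<close>
      continuous_on_subset [OF d_cont, of "{0..\<tau>}"] by auto
  then have "s = \<tau>"
    using before [of s] by force
  then have exit: "dist c (\<eta> \<tau>) = r"
    using s by simp
  then have inside: "\<eta> s \<in> cball c r" if "s \<in> {0..\<tau>}" for s
    using before [of s] that by (cases "s = \<tau>") auto
  have sub: "{0..\<tau>} \<subseteq> {0..1}"
    using \<tau>01 by auto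
  have int: "e integrable_on {0..\<tau>}" "e integrable_on {0..1}"
    "\<eta>' integrable_on {0..\<tau>}" "(\<lambda>s. (norm (\<eta>' s))\<^sup>2) integrable_on {0..\<tau>}"
    by (intro integrable_continuous_real continuous_intros e(1) continuous_on_subset [OF e(1) sub]
        continuous_on_subset [OF cont sub])+
  define I where "I = integral {0..\<tau>} (\<lambda>s. (norm (\<eta>' s))\<^sup>2)"
  have "(\<eta>' has_integral \<eta> \<tau> - \<eta> 0) {0..\<tau>}"
    using \<tau>01 sub by (intro fundamental_theorem_of_calculus)
      (auto intro!: has_vector_derivative_within_subset [OF deriv])
  then have "integral {0..\<tau>} \<eta>' = \<eta> \<tau> - c"
    using \<open>\<eta> 0 = c\<close> by (simp add: integral_unique)
  then have "r = norm (integral {0..\<tau>} \<eta>')"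
    using exit by (simp add: dist_norm norm_minus_commute)
  \<comment> \<open>Young's inequality with parameter \<open>r\<close> stands in for Cauchy-Schwarz
    on integrals: with \<open>\<tau> \<le> 1\<close> it leads to
    \<open>r \<le> r / 2 + I / (2 r)\<close>, that is, to \<open>r^2 \<le> I\<close>.\<close>
  also have "\<dots> \<le> integral {0..\<tau>} (\<lambda>s. r / 2 + (1 / (2 * r)) * (norm (\<eta>' s))\<^sup>2)"
  proof (rule integral_norm_bound_integral)
    show "(\<lambda>s. r / 2 + (1 / (2 * r)) * (norm (\<eta>' s))\<^sup>2) integrable_on {0..\<tau>}"
      by (intro integrable_continuous_real continuous_intros continuous_on_subset [OF cont sub])
    fix s
    have "0 \<le> (norm (\<eta>' s) - r)\<^sup>2"
      by simp
    then have "2 * r * norm (\<eta>' s) \<le> r\<^sup>2 + (norm (\<eta>' s))\<^sup>2"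
      by (simp add: power2_eq_square algebra_simps)
    then show "norm (\<eta>' s) \<le> r / 2 + (1 / (2 * r)) * (norm (\<eta>' s))\<^sup>2"
      using r_pos by (simp add: field_simps power2_eq_square)
  qed (rule int)
  also have "\<dots> = r / 2 * \<tau> + (1 / (2 * r)) * I"
  proof -
    have "integral {0..\<tau>} (\<lambda>s. r / 2 + (1 / (2 * r)) * (norm (\<eta>' s))\<^sup>2)
        = integral {0..\<tau>} (\<lambda>s. r / 2) + integral {0..\<tau>} (\<lambda>s. (1 / (2 * r)) * (norm (\<eta>' s))\<^sup>2)"
      by (intro integral_add integrable_on_mult_right int) auto
    then show ?thesis
      unfolding integral_mult_right I_def using \<tau>01 by (simp add: mult.commute)
  qed
  also have "\<dots> \<le> r / 2 + (1 / (2 * r)) * I"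
    using \<tau>01 r_pos by (simp add: mult_left_le)
  finally have "r\<^sup>2 \<le> I"
    using r_pos by (simp add: field_simps power2_eq_square)
  then have "l * r\<^sup>2 \<le> l * I"
    using l_pos by simp
  also have "\<dots> = integral {0..\<tau>} (\<lambda>s. l * (norm (\<eta>' s))\<^sup>2)"
    by (simp add: I_def)
  also have "\<dots> \<le> integral {0..\<tau>} e"
    using eq inside sub G_lower
    by (intro integral_le integrable_on_mult_right int) (force simp: gq_def)
  also have "\<dots> \<le> integral {0..1} e"
    using e(2) sub by (intro integral_subset_le int) auto
  finally show ?thesis .
qed

section \<open>Short geodesics with prescribed direction\<close>

lemma DG_expand:
  assumes "x \<in> cball c r"
  shows "DG x h = (\<Sum>i\<in>UNIV. (h $ i) *\<^sub>R DG x (axis i 1))"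
proof -
  have "DG x h = DG x (\<Sum>i\<in>UNIV. (h $ i) *\<^sub>R axis i 1)"
    using basis_expansion [of h] by (simp add: scalar_mult_eq_scaleR)
  then show ?thesis
    using DG_linear [OF assms] by (simp add: linear_sum linear_scale)
qed

lemma geodesic_acc_cont: "continuous_on (cball c r \<times> UNIV) (\<lambda>(x, v). geodesic_acc x v)"
proof -
  \<comment> \<open>Continuity of \<open>DG\<close> is given for fixed directions; expansion in the
    basis yields joint continuity.\<close>
  have "continuous_on (cball c r \<times> UNIV) (\<lambda>(x, v). \<Sum>i\<in>UNIV. (v $ i) *\<^sub>R DG x (axis i 1))"
    unfolding case_prod_unfold
    by (intro continuous_intros continuous_on_compose2 [OF DG_cont]) auto
  then have 1: "continuous_on (cball c r \<times> UNIV) (\<lambda>z. DG (fst z) (snd z))"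
    by (rule continuous_on_eq) (auto simp: DG_expand)
  show ?thesis
    using gforce_cont unfolding geodesic_acc_def case_prod_unfold
    by (intro continuous_intros continuous_on_compose2 [OF Ginv_cont] 1) auto
qed

lemma geodesic_acc_scaleR:
  assumes "x \<in> cball c r"
  shows "geodesic_acc x (a *\<^sub>R v) = a\<^sup>2 *\<^sub>R geodesic_acc x v"
  unfolding geodesic_acc_def gforce_scaleR linear_scale [OF DG_linear [OF assms]]
  by (simp add: mvm_scaleR mvm_diff scaleR_diff_right power2_eq_square
      flip: scaleR_matrix_vector_assoc)

text \<open>Homogeneity of degree two in \<open>v\<close> reduces the bound to a compact set of base
  points and vectors.\<close>

lemma geodesic_acc_bound:
  obtains K where "0 \<le> K" "\<And>x v. x \<in> cball c r \<Longrightarrow> norm (geodesic_acc x v) \<le> K * (norm v)\<^sup>2"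
proof -
  have "continuous_on (cball c r \<times> cball 0 1) (\<lambda>(x, v). geodesic_acc x v)"
    by (rule continuous_on_subset [OF geodesic_acc_cont]) auto
  then have "bounded ((\<lambda>(x, v). geodesic_acc x v) ` (cball c r \<times> cball 0 1))"
    by (intro compact_imp_bounded compact_continuous_image compact_Times compact_cball)
  then obtain K where "\<forall>z\<in>cball c r \<times> cball 0 1. norm ((\<lambda>(x, v). geodesic_acc x v) z) \<le> K"
    unfolding bounded_iff by blast
  then have K: "norm (geodesic_acc x v) \<le> K" if "x \<in> cball c r" "v \<in> cball 0 1" for x v
    using that by force
  show ?thesis
  proof (rule that [of K])
    show "0 \<le> K"
      using order_trans [OF norm_ge_zero K [of c 0]] r_pos by simp
    fix x v :: "real^'d"
    assume x: "x \<in> cball c r"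
    \<comment> \<open>For \<open>v = 0\<close> division by zero gives \<open>e = 0\<close>, which
      lies in the unit ball though not on the unit sphere; hence the bound over the ball.\<close>
    define e where "e = (1 / norm v) *\<^sub>R v"
    have "v = norm v *\<^sub>R e"
      by (simp add: e_def)
    then have "norm (geodesic_acc x v) = (norm v)\<^sup>2 * norm (geodesic_acc x e)"
      by (metis abs_power2 geodesic_acc_scaleR [OF x] norm_scaleR real_norm_def)
    also have "\<dots> \<le> (norm v)\<^sup>2 * K"
      using K [OF x, of e] by (intro mult_left_mono) (auto simp: e_def)
    finally show "norm (geodesic_acc x v) \<le> K * (norm v)\<^sup>2"
      by (simp add: mult.commute)
  qed
qed

text \<open>The metric is only \<open>C\<^sup>1\<close>, so a geodesic with a prescribed initial velocity need not be
  minimizing. The minimizing geodesic from \<open>c\<close> to \<open>c + s v\<close> has velocity \<open>s v + O(s\<^sup>2)\<close> throughout,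
  as its acceleration is \<open>O(s\<^sup>2)\<close>.\<close>

lemma ex_short_minimizing_geodesic:
  assumes "0 < \<rho>"
  obtains s x v where "0 < s" "x 0 = c" "\<And>t. t \<in> {0..1} \<Longrightarrow> x t \<in> cball c r"
    and "\<And>t. t \<in> {0..1} \<Longrightarrow> (x has_vector_derivative v t) (at t within {0..1})"
    and "\<And>t. t \<in> {0..1} \<Longrightarrow>
      (v has_vector_derivative geodesic_acc (x t) (v t)) (at t within {0..1})"
    and "\<And>t. t \<in> {0..1} \<Longrightarrow> gq (x t) (v t) = gq (x 0) (v 0)"
    and "\<And>t. t \<in> {0..1} \<Longrightarrow> norm ((1 / s) *\<^sub>R v t - v0) \<le> \<rho>"
    and "gq (x 0) (v 0) \<le> l * r\<^sup>2"
    and "\<And>\<eta> \<eta>'. (\<And>t. t \<in> {0..1} \<Longrightarrow> \<eta> t \<in> cball c r) \<Longrightarrow>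
      (\<And>t. t \<in> {0..1} \<Longrightarrow> (\<eta> has_vector_derivative \<eta>' t) (at t within {0..1})) \<Longrightarrow>
      continuous_on {0..1} \<eta>' \<Longrightarrow> \<eta> 0 = c \<Longrightarrow> \<eta> 1 = x 1 \<Longrightarrow>
      gq (x 0) (v 0) \<le> integral {0..1} (\<lambda>t. gq (\<eta> t) (\<eta>' t))"
proof -
  obtain K where K: "0 \<le> K" "\<And>x v. x \<in> cball c r \<Longrightarrow> norm (geodesic_acc x v) \<le> K * (norm v)\<^sup>2"
    using geodesic_acc_bound by metis
  have L: "0 < L"
    using l_le_L l_pos by linarith
  define A where "A = L * (norm v0)\<^sup>2"
  define C where "C = K * (A / l)"
  have AC: "0 \<le> A" "0 \<le> C"
    using L K(1) l_pos by (auto simp: A_def C_def)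
  \<comment> \<open>The three bounds serve, in turn, \<open>s^2 A \<le> s A\<close>, the final
    estimate \<open>C s \<le> \<rho>\<close>, and \<open>s A < l r^2\<close>. Each
    \<open>+ 1\<close> keeps a quotient meaningful when \<open>C\<close> or \<open>A\<close>
    vanishes.\<close>
  define s where "s = Min {1, \<rho> / (C + 1), l * r\<^sup>2 / (A + 1)}"
  have s: "0 < s" "s \<le> 1" "s \<le> \<rho> / (C + 1)" "s \<le> l * r\<^sup>2 / (A + 1)"
    using AC \<open>0 < \<rho>\<close> l_pos r_pos by (auto simp: s_def)
  have sC: "C * s \<le> \<rho>"
  proof -
    have "C * s \<le> (C + 1) * s"
      using s(1) by (simp add: distrib_right)
    also have "\<dots> \<le> \<rho>"
      using s(3) AC by (simp add: field_simps)
    finally show ?thesis .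
  qed
  define y where "y = c + s *\<^sub>R v0"
  have ny: "L * (norm (y - c))\<^sup>2 = s\<^sup>2 * A"
    by (simp add: y_def A_def power_mult_distrib)
  have "s\<^sup>2 * A \<le> s * A"
    using s AC by (intro mult_right_mono) (auto simp: power2_eq_square mult_left_le)
  also have "\<dots> < s * (A + 1)"
    using s by simp
  also have "\<dots> \<le> l * r\<^sup>2"
    using s(4) AC by (simp add: field_simps)
  finally have near: "L * (norm (y - c))\<^sup>2 < l * r\<^sup>2"
    using ny by simp
  obtain x v where x0: "x 0 = c" and x1: "x 1 = y" and x: "\<And>t. t \<in> {0..1} \<Longrightarrow> x t \<in> cball c r"
    and dx: "\<And>t. t \<in> {0..1} \<Longrightarrow> (x has_vector_derivative v t) (at t within {0..1})"
    and dv: "\<And>t. t \<in> {0..1} \<Longrightarrow>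
      (v has_vector_derivative geodesic_acc (x t) (v t)) (at t within {0..1})"
    and const: "\<And>t. t \<in> {0..1} \<Longrightarrow> gq (x t) (v t) = gq (x 0) (v 0)"
    and minimal: "\<And>\<eta> \<eta>'. (\<And>t. t \<in> {0..1} \<Longrightarrow> \<eta> t \<in> cball c r) \<Longrightarrow>
      (\<And>t. t \<in> {0..1} \<Longrightarrow> (\<eta> has_vector_derivative \<eta>' t) (at t within {0..1})) \<Longrightarrow>
      continuous_on {0..1} \<eta>' \<Longrightarrow> \<eta> 0 = c \<Longrightarrow> \<eta> 1 = y \<Longrightarrow>
      gq (x 0) (v 0) \<le> integral {0..1} (\<lambda>t. gq (\<eta> t) (\<eta>' t))"
    by (rule ex_minimizing_geodesic [OF near]) blast
  have energy: "gq (x 0) (v 0) \<le> s\<^sup>2 * A"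
  proof -
    define \<eta> where "\<eta> t = c + t *\<^sub>R (y - c)" for t
    have \<eta>: "\<eta> t \<in> cball c r" if "t \<in> {0..1}" for t
    proof -
      have "t * norm (y - c) \<le> norm (y - c)"
        using that by (intro mult_left_le_one_le) auto
      then show ?thesis
        using near_imp_in_ball [OF near] that by (simp add: \<eta>_def dist_norm norm_minus_commute)
    qed
    have "gq (x 0) (v 0) \<le> integral {0..1} (\<lambda>t. gq (\<eta> t) (y - c))"
      by (rule minimal) (use \<eta> in \<open>auto simp: \<eta>_def intro!: derivative_eq_intros\<close>)
    also have "\<dots> \<le> integral {0..1::real} (\<lambda>t. L * (norm (y - c))\<^sup>2)"
    proof (rule integral_le)
      have "continuous_on {0..1} (\<lambda>t. (\<eta> t, y - c))"
        unfolding \<eta>_def by (intro continuous_intros)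
      from continuous_on_compose2 [OF gq_cont this] show "(\<lambda>t. gq (\<eta> t) (y - c)) integrable_on {0..1}"
        using \<eta> by (intro integrable_continuous_real) force
      show "gq (\<eta> t) (y - c) \<le> L * (norm (y - c))\<^sup>2" if "t \<in> {0..1}" for t
        unfolding gq_def by (rule G_upper [OF \<eta> [OF that]])
    qed auto
    finally show ?thesis
      by (simp add: ny)
  qed
  have acc: "norm (geodesic_acc (x t) (v t)) \<le> C * s\<^sup>2" if t: "t \<in> {0..1}" for t
  proof -
    have "l * (norm (v t))\<^sup>2 \<le> s\<^sup>2 * A"
      using G_lower [OF x [OF t], of "v t"] const [OF t] energy by (simp add: gq_def)
    then have "(norm (v t))\<^sup>2 \<le> s\<^sup>2 * (A / l)"
      using l_pos by (simp add: field_simps)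
    then have "K * (norm (v t))\<^sup>2 \<le> K * (s\<^sup>2 * (A / l))"
      using K(1) by (rule mult_left_mono)
    then show ?thesis
      using K(2) [OF x [OF t], of "v t"] by (simp add: C_def mult_ac)
  qed
  have v_cont: "continuous_on {0..1} v"
    using dv by (rule continuous_on_vector_derivative)
  have x_cont: "continuous_on {0..1} x"
    using dx by (rule continuous_on_vector_derivative)
  have acc_cont: "continuous_on {0..1} (\<lambda>t. geodesic_acc (x t) (v t))"
    using continuous_on_compose2 [OF geodesic_acc_cont continuous_on_Pair [OF x_cont v_cont]] x by force
  have v_osc: "norm (v b - v a) \<le> C * s\<^sup>2" if ab: "0 \<le> a" "a \<le> b" "b \<le> 1" for a b
  proof -
    have "norm ((b - a) *\<^sub>R 0 - (v b - v a)) \<le> C * s\<^sup>2 * (b - a)"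
      by (rule C1_increment [OF dv acc_cont ab]) (use acc ab in auto)
    also have "\<dots> \<le> C * s\<^sup>2"
      using ab AC by (intro mult_left_le) auto
    finally show ?thesis
      by (simp add: norm_minus_commute)
  qed
  have direction: "norm ((1 / s) *\<^sub>R v t - v0) \<le> \<rho>" if t: "t \<in> {0..1}" for t
  proof -
    \<comment> \<open>\<open>x 1 - x 0 = s v0\<close> is the mean of \<open>v\<close> over
      \<open>{0..1}\<close>, so \<open>v t\<close> differs from it by at most the oscillation of
      \<open>v\<close>.\<close>
    have "norm ((1 - 0) *\<^sub>R v t - (x 1 - x 0)) \<le> C * s\<^sup>2 * (1 - 0)"
    proof (rule C1_increment [OF dx v_cont])
      fix a :: real
      assume "a \<in> {0..1}"
      then show "norm (v t - v a) \<le> C * s\<^sup>2"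
        using v_osc [of a t] v_osc [of t a] t by (cases "a \<le> t") (auto simp: norm_minus_commute)
    qed auto
    then have "norm (v t - s *\<^sub>R v0) \<le> C * s\<^sup>2"
      by (simp add: x0 x1 y_def)
    moreover have "(1 / s) *\<^sub>R v t - v0 = (1 / s) *\<^sub>R (v t - s *\<^sub>R v0)"
      using s(1) by (simp add: scaleR_diff_right)
    ultimately have "norm ((1 / s) *\<^sub>R v t - v0) \<le> (1 / s) * (C * s\<^sup>2)"
      using s(1) by (simp add: divide_right_mono)
    also have "\<dots> = C * s"
      using s(1) by (simp add: power2_eq_square)
    finally show ?thesis
      using sC by linarith
  qed
  show ?thesis
    by (rule that [OF s(1) x0 x dx dv const direction _ minimal]) (use energy near ny x1 in auto)
qed

end

section \<open>The pseudo-inverse of the graph Laplacian\<close>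

lemma matrix_diff_ldistrib:
  fixes A :: "real^'n::finite^'m::finite" and B C :: "real^'k::finite^'n"
  shows "A ** (B - C) = A ** B - A ** C"
  by (simp add: matrix_matrix_mult_def vec_eq_iff right_diff_distrib sum_subtractf)

lemma matrix_diff_rdistrib:
  fixes B C :: "real^'n::finite^'m::finite" and A :: "real^'k::finite^'n"
  shows "(B - C) ** A = B ** A - C ** A"
  by (simp add: matrix_matrix_mult_def vec_eq_iff left_diff_distrib sum_subtractf)

lemma matrix_add_rdistrib:
  fixes B C :: "real^'n::finite^'m::finite" and A :: "real^'k::finite^'n"
  shows "(B + C) ** A = B ** A + C ** A"
  by (simp add: matrix_matrix_mult_def vec_eq_iff distrib_right sum.distrib)

lemma transpose_diff: "transpose (A - B) = transpose A - transpose (B :: real^'n::finite^'m::finite)"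
  by (simp add: transpose_def vec_eq_iff)

lemma inner_symmetric_matrix:
  fixes A :: "real^'n::finite^'n"
  assumes "transpose A = A"
  shows "u \<bullet> (A *v v) = v \<bullet> (A *v u)"
  by (metis assms dot_lmul_matrix inner_commute transpose_matrix_vector)

lemma matrix_eq_vectorI:
  fixes A B :: "real^'n::finite^'m::finite"
  shows "(\<And>x. A *v x = B *v x) \<Longrightarrow> A = B"
  by (simp add: matrix_eq)

text \<open>Connectedness yields a neighbor of \<open>i\<close> as soon as there is a second vertex;
  hence the cardinality assumption.\<close>

lemma node_deg_pos:
  fixes E :: "('n::finite \<times> 'n) set"
  assumes graph: "weighted_graph E w" and card: "2 \<le> CARD('n)"
  shows "0 < node_deg E w i"
proof -
  have row: "0 < (\<Sum>j\<in>neighbors E i. w $ i $ j)" for i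
  proof -
    obtain j where "j \<noteq> i"
      using card by (metis (full_types) One_nat_def UNIV_eq_I card.empty card.insert
          equals0D finite.emptyI insertCI numeral_2_eq_2 not_less_eq_eq Suc_n_not_le_n singletonI)
    moreover have "(i, j) \<in> E\<^sup>*"
      using graph by (simp add: weighted_graph_def)
    ultimately obtain k where k: "(i, k) \<in> E"
      by (metis converse_rtranclE)
    show ?thesis
    proof (rule sum_pos2 [where i = k])
      show "k \<in> neighbors E i" "0 < w $ i $ k"
        using k graph by (auto simp: neighbors_def weighted_graph_def split: if_splits dest: spec)
      show "0 \<le> w $ i $ j" if "j \<in> neighbors E i" for j
        using that graph by (auto simp: neighbors_def weighted_graph_def less_imp_le dest: spec split: if_splits)
    qed simp
  qed
  have "0 < (\<Sum>k\<in>UNIV. \<Sum>j\<in>neighbors E k. w $ k $ j)"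
    by (intro sum_pos row) auto
  then show ?thesis
    unfolding node_deg_def by (intro divide_pos_pos row)
qed

text \<open>Orthogonal projection onto the constant vectors, the kernel of the Laplacian of a
  connected graph.\<close>

definition mean_matrix :: "real^'n::finite^'n" where
  "mean_matrix = (\<chi> i j. 1 / real CARD('n))"

lemma mean_matrix_mult_vector: "mean_matrix *v x = (\<chi> i. (\<Sum>j\<in>UNIV. x $ j) / real CARD('n))"
  for x :: "real^'n::finite"
  by (simp add: mean_matrix_def matrix_vector_mult_def vec_eq_iff sum_divide_distrib)

lemma transpose_mean_matrix: "transpose mean_matrix = mean_matrix"
  by (simp add: mean_matrix_def transpose_def)

lemma mean_matrix_idem: "mean_matrix ** mean_matrix = (mean_matrix :: real^'n::finite^'n)"
  by (simp add: mean_matrix_def matrix_matrix_mult_def vec_eq_iff)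

text \<open>Stated for positive weights rather than probability vectors, as it is also applied
  outside \<open>\<Theta>\<close>, where the extended parametrization need not be
  normalized.\<close>

locale positive_laplacian =
  fixes E :: "('n::finite \<times> 'n) set" and w :: "real^'n^'n" and p :: "real^'n"
  assumes graph: "weighted_graph E w" and card: "2 \<le> CARD('n)" and pos: "\<And>i. 0 < p $ i"
begin

lemma edge_factor_pos:
  "(i, j) \<in> E \<Longrightarrow> 0 < w $ i $ j * (1/2 * (p $ i / node_deg E w i + p $ j / node_deg E w j))"
proof -
  assume "(i, j) \<in> E"
  then have "0 < w $ i $ j"
    using graph by (auto simp: weighted_graph_def dest: spec split: if_splits)
  moreover have "0 < p $ i / node_deg E w i + p $ j / node_deg E w j"
    by (intro add_pos_pos divide_pos_pos pos node_deg_pos graph card)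
  ultimately show ?thesis
    by simp
qed

lemma dirichlet_form_term_nonneg:
  assumes "(i, j) \<in> E"
  shows "0 \<le> w $ i $ j * (\<Phi> $ i - \<Phi> $ j)\<^sup>2 * (1/2 * (p $ i / node_deg E w i + p $ j / node_deg E w j))"
proof -
  have "0 \<le> (\<Phi> $ i - \<Phi> $ j)\<^sup>2 * (w $ i $ j * (1/2 * (p $ i / node_deg E w i + p $ j / node_deg E w j)))"
    by (rule mult_nonneg_nonneg [OF zero_le_power2 less_imp_le [OF edge_factor_pos [OF assms]]])
  then show ?thesis
    by (simp only: mult_ac)
qed

lemma laplacian_nonneg: "0 \<le> \<Phi> \<bullet> (laplacian E w p *v \<Phi>)"
  unfolding laplacian_quadratic_form [OF graph]
  by (intro mult_nonneg_nonneg sum_nonneg) (use dirichlet_form_term_nonneg in auto)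

text \<open>A vanishing sum of nonnegative terms forces equality across every edge, and paths spread
  it over the connected graph.\<close>

lemma laplacian_zero_imp_constant:
  assumes "\<Phi> \<bullet> (laplacian E w p *v \<Phi>) = 0"
  shows "\<Phi> $ i = \<Phi> $ j"
proof -
  let ?f = "\<lambda>(i, j). w $ i $ j * (\<Phi> $ i - \<Phi> $ j)\<^sup>2 * (1/2 * (p $ i / node_deg E w i + p $ j / node_deg E w j))"
  have "sum ?f E = 0"
    using assms unfolding laplacian_quadratic_form [OF graph] by simp
  then have "\<forall>z\<in>E. ?f z = 0"
    by (subst (asm) sum_nonneg_eq_0_iff) (use dirichlet_form_term_nonneg in auto)
  then have edge: "\<Phi> $ i = \<Phi> $ j" if "(i, j) \<in> E" for i j
    using edge_factor_pos [OF that] that by fastforce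
  have "(i, j) \<in> E\<^sup>*"
    using graph by (simp add: weighted_graph_def)
  then show ?thesis
    by (induction rule: rtrancl_induct) (auto dest: edge)
qed

lemma laplacian_mean_matrix: "laplacian E w p ** mean_matrix = 0"
proof (rule matrix_eq_vectorI)
  fix x
  define e :: "real^'n" where "e = mean_matrix *v x"
  let ?L = "laplacian E w p"
  have sym: "transpose ?L = ?L"
    by (rule laplacian_symmetric [OF graph])
  have e: "e $ i = e $ j" for i j
    by (simp add: e_def mean_matrix_mult_vector)
  \<comment> \<open>The Dirichlet form sees differences only, so the constant vector
    \<open>e\<close> can be added freely; polarization then gives \<open>L e = 0\<close>.\<close>
  have shift: "(\<Psi> + e) \<bullet> (?L *v (\<Psi> + e)) = \<Psi> \<bullet> (?L *v \<Psi>)" for \<Psi>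
    unfolding laplacian_quadratic_form [OF graph]
    using e by (intro arg_cong2 [where f = "(*)"] sum.cong refl) (clarsimp, metis add_diff_cancel_right)
  have "\<Psi> \<bullet> (?L *v e) = 0" for \<Psi>
    using shift [of \<Psi>] shift [of 0] inner_symmetric_matrix [OF sym, of e \<Psi>]
    by (simp add: algebra_simps inner_add_left inner_add_right)
  then have "?L *v e = 0"
    by (metis inner_eq_zero_iff)
  then show "(?L ** mean_matrix) *v x = 0 *v x"
    by (simp add: e_def matrix_vector_mul_assoc)
qed

text \<open>Adding the projection onto the kernel makes the Laplacian invertible, and the inverse
  minus the same projection is the pseudo-inverse. This makes the pseudo-inverse accessible to
  Cramer's rule.\<close>

definition regularized :: "real^'n^'n" where
  "regularized = laplacian E w p + mean_matrix"

lemma det_regularized: "det regularized \<noteq> 0"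
proof (rule det_nonzero_if_kernel_trivial)
  fix x
  assume x: "regularized *v x = 0"
  have M: "x \<bullet> (mean_matrix *v x) = (\<Sum>j\<in>UNIV. x $ j)\<^sup>2 / real CARD('n)"
    by (simp add: mean_matrix_mult_vector inner_vec_def power2_eq_square
        flip: sum_divide_distrib sum_distrib_right)
  have "x \<bullet> (laplacian E w p *v x) + x \<bullet> (mean_matrix *v x) = 0"
    using arg_cong [OF x, of "(\<bullet>) x"]
    by (simp add: regularized_def matrix_vector_mult_add_rdistrib inner_add_right)
  moreover have "0 \<le> x \<bullet> (mean_matrix *v x)"
    by (simp add: M)
  ultimately have zero: "x \<bullet> (laplacian E w p *v x) = 0" "(\<Sum>j\<in>UNIV. x $ j)\<^sup>2 / real CARD('n) = 0"
    using laplacian_nonneg [of x] unfolding M by linarith+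
  have "real CARD('n) * x $ i = (\<Sum>j\<in>UNIV. x $ j)" for i
    using laplacian_zero_imp_constant [OF zero(1)] by (metis (mono_tags, lifting) sum.cong sum_constant)
  then show "x = 0"
    using zero(2) by (simp add: vec_eq_iff)
qed

text \<open>\<open>regularized\<close> and its inverse fix constant vectors, while the Laplacian
  annihilates them. So both products of the Laplacian with the candidate equal the symmetric
  projection \<open>mat 1 - mean_matrix\<close>.\<close>

lemma
  shows pinv_laplacian: "pinv (laplacian E w p) = matrix_inv regularized - mean_matrix"
  and laplacian_mult_pinv: "laplacian E w p ** pinv (laplacian E w p) = mat 1 - mean_matrix"
  and pinv_mult: "pinv (laplacian E w p) ** laplacian E w p ** pinv (laplacian E w p) = pinv (laplacian E w p)"
  and transpose_pinv_laplacian: "transpose (pinv (laplacian E w p)) = pinv (laplacian E w p)"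
proof -
  let ?L = "laplacian E w p"
  let ?M = "mean_matrix :: real^'n^'n"
  let ?B = "regularized"
  let ?C = "matrix_inv regularized"
  have BC: "?B ** ?C = mat 1" and CB: "?C ** ?B = mat 1"
    using matrix_inv_mult [OF det_regularized] by auto
  have symL: "transpose ?L = ?L"
    by (rule laplacian_symmetric [OF graph])
  have lap_mean: "?L ** ?M = 0"
    by (rule laplacian_mean_matrix)
  have mean_lap: "?M ** ?L = 0"
    using arg_cong [OF lap_mean, of transpose]
    by (simp add: matrix_transpose_mul symL transpose_mean_matrix)
      (simp add: transpose_def zero_vec_def)
  have "?B ** ?M = ?M" "?M ** ?B = ?M"
    by (simp_all add: regularized_def matrix_add_ldistrib matrix_add_rdistrib lap_mean mean_lap mean_matrix_idem)
  then have CM: "?C ** ?M = ?M" and MC: "?M ** ?C = ?M"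
    by (metis BC CB matrix_mul_assoc matrix_mul_lid matrix_mul_rid)+
  have L: "?L = ?B - ?M"
    by (simp add: regularized_def)
  have LC: "?L ** ?C = mat 1 - ?M" and CL: "?C ** ?L = mat 1 - ?M"
    unfolding L by (simp_all add: matrix_diff_ldistrib matrix_diff_rdistrib BC CB CM MC)
  have LX: "?L ** (?C - ?M) = mat 1 - ?M"
    by (simp add: matrix_diff_ldistrib LC lap_mean)
  have XL: "(?C - ?M) ** ?L = mat 1 - ?M"
    by (simp add: matrix_diff_rdistrib CL mean_lap)
  have X: "(mat 1 - ?M) ** (?C - ?M) = ?C - ?M"
    by (simp add: matrix_diff_ldistrib matrix_diff_rdistrib MC mean_matrix_idem)
  have "is_pinv ?L (?C - ?M)"
    unfolding is_pinv_def LX XL X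
    by (simp add: transpose_diff transpose_mean_matrix matrix_diff_rdistrib mean_lap)
  then show pinv: "pinv ?L = ?C - ?M"
    by (rule pinv_eqI)
  show "?L ** pinv ?L = mat 1 - ?M"
    by (simp add: pinv LX)
  show "pinv ?L ** ?L ** pinv ?L = pinv ?L"
    unfolding pinv XL by (rule X)
  have "transpose ?B = ?B"
    using symL by (simp add: regularized_def mean_matrix_def transpose_def vec_eq_iff)
  then have "transpose ?C ** ?B = mat 1"
    by (metis BC matrix_transpose_mul transpose_mat)
  then have "transpose ?C = ?C"
    by (metis BC matrix_mul_assoc matrix_mul_lid matrix_mul_rid)
  then show "transpose (pinv ?L) = pinv ?L"
    by (simp add: pinv transpose_diff transpose_mean_matrix)
qed

text \<open>The cost of a tangent vector is the Dirichlet energy of its potential, from which it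
  inherits nonnegativity and definiteness.\<close>

lemma pinv_laplacian_inner:
  "u \<bullet> (pinv (laplacian E w p) *v u)
    = (pinv (laplacian E w p) *v u) \<bullet> (laplacian E w p *v (pinv (laplacian E w p) *v u))"
proof -
  let ?X = "pinv (laplacian E w p)"
  have "u \<bullet> (?X *v u) = u \<bullet> (?X *v (laplacian E w p *v (?X *v u)))"
    by (simp add: matrix_vector_mul_assoc matrix_mul_assoc pinv_mult)
  also have "\<dots> = (laplacian E w p *v (?X *v u)) \<bullet> (?X *v u)"
    by (rule inner_symmetric_matrix [OF transpose_pinv_laplacian])
  finally show ?thesis
    by (simp add: inner_commute)
qed

lemma pinv_laplacian_nonneg: "0 \<le> u \<bullet> (pinv (laplacian E w p) *v u)"
  unfolding pinv_laplacian_inner by (rule laplacian_nonneg)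

text \<open>If the form vanished, the potential would be constant, hence in the kernel of the
  Laplacian; but the Laplacian maps the potential of a zero-sum \<open>u\<close> back to
  \<open>u\<close>.\<close>

lemma pinv_laplacian_pos:
  assumes "(\<Sum>i\<in>UNIV. u $ i) = 0" "u \<noteq> 0"
  shows "0 < u \<bullet> (pinv (laplacian E w p) *v u)"
proof (rule ccontr)
  let ?L = "laplacian E w p"
  let ?\<Phi> = "pinv ?L *v u"
  assume "\<not> 0 < u \<bullet> (pinv (laplacian E w p) *v u)"
  then have "?\<Phi> \<bullet> (?L *v ?\<Phi>) = 0"
    using pinv_laplacian_inner [of u] pinv_laplacian_nonneg [of u] by linarith
  then have const: "?\<Phi> $ i = ?\<Phi> $ j" for i j
    by (rule laplacian_zero_imp_constant)
  have "mean_matrix *v ?\<Phi> = ?\<Phi>"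
  proof (rule vec_eq_iff [THEN iffD2], rule allI)
    fix i
    have "(\<Sum>j\<in>UNIV. ?\<Phi> $ j) = (\<Sum>j\<in>(UNIV :: 'n set). ?\<Phi> $ i)"
      by (rule sum.cong [OF refl const])
    then show "(mean_matrix *v ?\<Phi>) $ i = ?\<Phi> $ i"
      by (simp add: mean_matrix_mult_vector)
  qed
  then have "?L *v ?\<Phi> = (?L ** mean_matrix) *v ?\<Phi>"
    by (simp flip: matrix_vector_mul_assoc)
  then have "?L *v ?\<Phi> = 0"
    by (simp add: laplacian_mean_matrix)
  moreover have "?L *v ?\<Phi> = u - mean_matrix *v u"
    by (simp add: matrix_vector_mul_assoc laplacian_mult_pinv matrix_vector_mult_diff_rdistrib)
  moreover have "mean_matrix *v u = 0"
    by (simp add: mean_matrix_mult_vector assms(1) vec_eq_iff)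
  ultimately show False
    using assms(2) by simp
qed

end

section \<open>Parametrized statistical models\<close>

lemma partial_cong_open:
  assumes "open S" "x \<in> S" "\<And>y. y \<in> S \<Longrightarrow> f y = g y"
  shows "partial k f x = partial k g x"
proof -
  have "((\<lambda>h. x + h *\<^sub>R axis k 1) \<longlongrightarrow> x + 0 *\<^sub>R axis k 1) (nhds 0)"
    by (intro tendsto_intros filterlim_ident)
  then have "\<forall>\<^sub>F h in nhds 0. x + h *\<^sub>R axis k 1 \<in> S"
    using assms(1,2) by (intro topological_tendstoD) auto
  then have "\<forall>\<^sub>F h in nhds 0. f (x + h *\<^sub>R axis k 1) = g (x + h *\<^sub>R axis k 1)"
    by eventually_elim (rule assms(3))
  then show ?thesis
    unfolding partial_def by (rule deriv_cong_ev) simp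
qed

lemma partial_mult:
  assumes "C1_on W f" "C1_on W g" "x \<in> W"
  shows "partial k (\<lambda>\<eta>. f \<eta> * g \<eta>) x = f x * partial k g x + partial k f x * g x"
  using has_derivative_imp_partial [OF has_derivative_mult
      [OF C1_on_has_derivative [OF assms(1,3)] C1_on_has_derivative [OF assms(2,3)]], of k]
  by (simp add: axis_def if_distrib if_distribR cong: if_cong)

lemma partial_add_const:
  assumes "C1_on W f" "x \<in> W"
  shows "partial k (\<lambda>\<eta>. f \<eta> + a) x = partial k f x"
  using has_derivative_imp_partial [OF has_derivative_add
      [OF C1_on_has_derivative [OF assms] has_derivative_const], of k]
  by (simp add: axis_def if_distrib if_distribR cong: if_cong)

lemma partial_sum:
  assumes "\<And>i. i \<in> I \<Longrightarrow> C1_on W (f i)" "x \<in> W"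
  shows "partial k (\<lambda>\<eta>. \<Sum>i\<in>I. f i \<eta>) x = (\<Sum>i\<in>I. partial k (f i) x)"
  using has_derivative_imp_partial [where k = k, OF has_derivative_sum
      [OF C1_on_has_derivative [OF assms(1) assms(2)]]]
  by (simp add: axis_def if_distrib if_distribR cong: if_cong)

lemma partial_ln:
  assumes "C1_on W f" "x \<in> W" "0 < f x"
  shows "partial k (\<lambda>\<eta>. ln (f \<eta>)) x = partial k f x / f x"
  using has_derivative_imp_partial [OF has_derivative_ln
      [OF assms(3) C1_on_has_derivative [OF assms(1,2)]], of k]
  by (simp add: axis_def if_distrib if_distribR divide_inverse mult.commute cong: if_cong)

lemma nonneg_on_closure:
  fixes f :: "'a::metric_space \<Rightarrow> real"
  assumes "continuous_on S f" "T \<subseteq> S" "x \<in> S" "x \<in> closure T" "\<And>y. y \<in> T \<Longrightarrow> 0 \<le> f y"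
  shows "0 \<le> f x"
proof -
  obtain y where y: "\<And>n. y n \<in> T" "y \<longlonglongrightarrow> x"
    using assms(4) by (auto simp: closure_sequential)
  have "(\<lambda>n. f (y n)) \<longlonglongrightarrow> f x"
    by (rule continuous_on_tendsto_compose [OF assms(1) y(2) assms(3)])
      (use y(1) assms(2) in \<open>auto intro!: always_eventually\<close>)
  then show ?thesis
    by (rule LIMSEQ_le_const) (use y(1) assms(5) in auto)
qed

lemma inner_matrix_vector_eq_sum:
  "v \<bullet> (A *v u) = (\<Sum>a\<in>UNIV. \<Sum>b\<in>UNIV. v $ a * u $ b * A $ a $ b)"
  for A :: "real^'n::finite^'m::finite"
  by (simp add: inner_vec_def matrix_vector_mult_def sum_distrib_left mult_ac)

locale stat_model =
  fixes E :: "('n::finite \<times> 'n) set" and w :: "real^'n^'n"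
    and \<Theta> :: "(real^'d::finite) set" and p :: "real^'d \<Rightarrow> real^'n" and U :: "(real^'d) set"
  assumes graph: "weighted_graph E w"
    and card: "2 \<le> CARD('n)"
    and U: "open U" "\<Theta> \<subseteq> U" and C2: "C2_on U p"
    and dense: "\<Theta> \<subseteq> closure (interior \<Theta>)"
    and simplex: "\<theta> \<in> \<Theta> \<Longrightarrow> p \<theta> \<in> pos_simplex"
    and full_rank: "\<theta> \<in> \<Theta> \<Longrightarrow> rank (jacobian p (at \<theta>)) = CARD('d)"
begin

abbreviation "dp i k \<equiv> partial k (\<lambda>\<eta>. p \<eta> $ i)"

text \<open>Translates the bounded linear derivatives of \<open>C2_on\<close> into coordinates, the
  form used from here on.\<close>

lemma C1_p: "C1_on U (\<lambda>\<eta>. p \<eta> $ i)"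
  and C1_dp: "C1_on U (dp i k)"
  and jacobian_entry: "x \<in> U \<Longrightarrow> jacobian p (at x) $ i $ k = dp i k x"
proof -
  obtain f' :: "real^'d \<Rightarrow> (real^'d) \<Rightarrow>\<^sub>L (real^'n)" and f'' :: "real^'d \<Rightarrow> (real^'d) \<Rightarrow>\<^sub>L (real^'d) \<Rightarrow>\<^sub>L (real^'n)"
    where f': "\<And>x. x \<in> U \<Longrightarrow> (p has_derivative blinfun_apply (f' x)) (at x)"
      and f'': "\<And>x. x \<in> U \<Longrightarrow> (f' has_derivative blinfun_apply (f'' x)) (at x)"
      and cont: "continuous_on U f''"
    using C2 unfolding C2_on_def by blast
  have f'_cont: "continuous_on U f'"
    by (intro continuous_at_imp_continuous_on ballI) (rule has_derivative_continuous [OF f''])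
  have d1: "((\<lambda>\<eta>. p \<eta> $ i) has_derivative (\<lambda>h. f' x h $ i)) (at x)" if "x \<in> U" for x i
    by (rule bounded_linear.has_derivative [OF bounded_linear_vec_nth f' [OF that]])
  show "C1_on U (\<lambda>\<eta>. p \<eta> $ i)" for i
    unfolding C1_on_def using d1 f'_cont
    by (intro exI [of _ "\<lambda>x h. f' x h $ i"]) (auto intro!: continuous_intros)
  have partial: "dp i k x = f' x (axis k 1) $ i" if "x \<in> U" for x i k
    by (rule has_derivative_imp_partial [OF d1 [OF that]])
  have d2: "((\<lambda>\<eta>. f' \<eta> (axis k 1) $ i) has_derivative (\<lambda>h. f'' x h (axis k 1) $ i)) (at x)"
    if "x \<in> U" for x i k
    by (intro bounded_linear.has_derivative [OF bounded_linear_vec_nth]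
        bounded_linear.has_derivative [OF blinfun.bounded_linear_left f'' [OF that]])
  have "C1_on U (\<lambda>\<eta>. f' \<eta> (axis k 1) $ i)" for i k
    unfolding C1_on_def using d2 cont
    by (intro exI [of _ "\<lambda>x h. f'' x h (axis k 1) $ i"]) (auto intro!: continuous_intros)
  then show "C1_on U (dp i k)" for i k
    by (rule C1_on_cong [OF _ U(1) partial])
  show "jacobian p (at x) $ i $ k = dp i k x" if "x \<in> U" for x i k
    using frechet_derivative_at [OF f' [OF that]]
    by (simp add: jacobian_def matrix_def partial [OF that])
qed

text \<open>An open neighborhood of \<open>\<Theta>\<close> on which logarithms and pseudo-inverse
  are regular, so that full derivatives exist at boundary points of \<open>\<Theta>\<close>. Outside
  \<open>\<Theta>\<close> the metric may degenerate.\<close>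

definition W :: "(real^'d) set" where
  "W = {\<theta> \<in> U. \<forall>i. 0 < p \<theta> $ i}"

lemma W_subset: "W \<subseteq> U"
  by (auto simp: W_def)

lemma \<Theta>_W: "\<Theta> \<subseteq> W"
  using U(2) simplex by (auto simp: W_def pos_simplex_def)

lemma open_W: "open W"
proof -
  have "open (U \<inter> (\<lambda>\<theta>. p \<theta> $ i) -` {0<..})" for i
    by (intro continuous_open_preimage C1_on_imp_continuous_on [OF C1_p] U(1)) auto
  then have "open (\<Inter>i. U \<inter> (\<lambda>\<theta>. p \<theta> $ i) -` {0<..})"
    by (intro open_INT) auto
  moreover have "W = (\<Inter>i. U \<inter> (\<lambda>\<theta>. p \<theta> $ i) -` {0<..})"
    by (auto simp: W_def)
  ultimately show ?thesis
    by simp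
qed

lemmas C1_p_W = C1_on_subset [OF C1_p W_subset]
lemmas C1_dp_W = C1_on_subset [OF C1_dp W_subset]

lemma p_pos: "x \<in> W \<Longrightarrow> 0 < p x $ i"
  by (auto simp: W_def)

lemma positive_laplacian: "x \<in> W \<Longrightarrow> positive_laplacian E w (p x)"
  by unfold_locales (use graph card p_pos in auto)

section \<open>Regularity and positive definiteness of the metric\<close>

abbreviation "G \<equiv> wass_metric E w p"

lemma C1_laplacian_entry: "C1_on W (\<lambda>x. laplacian E w (p x) $ i $ j)"
proof -
  have edge: "C1_on W (\<lambda>x. edge_weight E w (p x) i j)" for i j
    unfolding edge_weight_def divide_inverse
    by (intro C1_on_mult C1_on_add C1_on_const C1_p_W)
  have "C1_on W (\<lambda>x. \<Sum>k\<in>neighbors E i. edge_weight E w (p x) i k)" for i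
    by (intro C1_on_sum edge)
  then have "C1_on W (\<lambda>x. (if i = j then \<Sum>k\<in>neighbors E i. edge_weight E w (p x) i k else 0)
      - (if (i, j) \<in> E then edge_weight E w (p x) i j else 0))"
    by (intro C1_on_diff; cases "i = j"; cases "(i, j) \<in> E") (simp_all add: C1_on_const edge)
  then show ?thesis
    by (simp add: laplacian_def)
qed

text \<open>Pseudo-inversion is discontinuous where the rank jumps; on \<open>W\<close> it is an
  ordinary inverse up to a constant matrix.\<close>

lemma C1_pinv_entry: "C1_on W (\<lambda>x. pinv (laplacian E w (p x)) $ i $ j)"
proof (rule C1_on_cong [OF _ open_W])
  show "C1_on W (\<lambda>x. matrix_inv (laplacian E w (p x) + mean_matrix) $ i $ j - mean_matrix $ i $ j)"
  proof (intro C1_on_diff C1_on_const C1_on_matrix_inv open_W)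
    show "C1_on W (\<lambda>x. (laplacian E w (p x) + mean_matrix) $ i $ j)" for i j
      using C1_on_add [OF C1_laplacian_entry C1_on_const] by simp
    show "det (laplacian E w (p x) + mean_matrix) \<noteq> 0" if "x \<in> W" for x
      using positive_laplacian.det_regularized [OF positive_laplacian [OF that]]
      by (simp add: positive_laplacian.regularized_def [OF positive_laplacian [OF that]])
  qed
  show "pinv (laplacian E w (p x)) $ i $ j
      = matrix_inv (laplacian E w (p x) + mean_matrix) $ i $ j - mean_matrix $ i $ j" if "x \<in> W" for x
    by (simp add: positive_laplacian.pinv_laplacian [OF positive_laplacian [OF that]]
        positive_laplacian.regularized_def [OF positive_laplacian [OF that]])
qed

lemma C1_G: "C1_on W (\<lambda>x. G x $ a $ b)"
proof (rule C1_on_cong [OF _ open_W])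
  show "C1_on W (\<lambda>x. \<Sum>j\<in>UNIV. (\<Sum>i\<in>UNIV. dp i a x * pinv (laplacian E w (p x)) $ i $ j) * dp j b x)"
    by (intro C1_on_sum C1_on_mult C1_dp_W C1_pinv_entry)
  show "G x $ a $ b
      = (\<Sum>j\<in>UNIV. (\<Sum>i\<in>UNIV. dp i a x * pinv (laplacian E w (p x)) $ i $ j) * dp j b x)" if "x \<in> W" for x
    using that W_subset
    by (auto simp: wass_metric_def matrix_matrix_mult_def transpose_def jacobian_entry subset_iff)
qed

lemma G_continuous: "continuous_on W G"
  by (rule continuous_on_matrixI) (rule C1_on_imp_continuous_on [OF C1_G])

lemma transpose_G: "x \<in> W \<Longrightarrow> transpose (G x) = G x"
  by (simp add: wass_metric_def matrix_transpose_mul matrix_mul_assoc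
      positive_laplacian.transpose_pinv_laplacian [OF positive_laplacian])

lemma G_inner_eq: "v \<bullet> (G x *v v)
    = (jacobian p (at x) *v v) \<bullet> (pinv (laplacian E w (p x)) *v (jacobian p (at x) *v v))"
proof -
  have "v \<bullet> (transpose J *v z) = (J *v v) \<bullet> z" for J :: "real^'d^'n" and z
    by (metis dot_lmul_matrix inner_commute transpose_matrix_vector)
  then show ?thesis
    by (simp only: wass_metric_def matrix_vector_mul_assoc [symmetric])
qed

lemma G_nonneg: "x \<in> W \<Longrightarrow> 0 \<le> v \<bullet> (G x *v v)"
  unfolding G_inner_eq by (rule positive_laplacian.pinv_laplacian_nonneg [OF positive_laplacian])

lemma continuous_on_\<Theta>_zero:
  assumes "continuous_on \<Theta> f" "\<And>x. x \<in> interior \<Theta> \<Longrightarrow> f x = (0::real)" "x \<in> \<Theta>"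
  shows "f x = 0"
proof -
  have "0 \<le> f x"
    by (rule nonneg_on_closure [OF assms(1) interior_subset assms(3)]) (use assms dense in auto)
  moreover have "0 \<le> - f x"
    by (rule nonneg_on_closure [OF continuous_on_minus [OF assms(1)] interior_subset assms(3)])
      (use assms dense in auto)
  ultimately show ?thesis
    by simp
qed

text \<open>Normalization is available on \<open>\<Theta>\<close>, hence can be differentiated in
  its interior; boundary points follow by continuity of the partial derivatives.\<close>

lemma sum_dp_zero:
  assumes "x \<in> \<Theta>"
  shows "(\<Sum>i\<in>UNIV. dp i k x) = 0"
proof (rule continuous_on_\<Theta>_zero [OF _ _ assms])
  show "continuous_on \<Theta> (\<lambda>x. \<Sum>i\<in>UNIV. dp i k x)"
    by (intro continuous_on_sum continuous_on_subset [OF C1_on_imp_continuous_on [OF C1_dp] U(2)])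
  fix x
  assume x: "x \<in> interior \<Theta>"
  then have "x \<in> U"
    using U(2) interior_subset by blast
  then have "(\<Sum>i\<in>UNIV. dp i k x) = partial k (\<lambda>\<eta>. \<Sum>i\<in>UNIV. p \<eta> $ i) x"
    by (simp add: partial_sum [OF C1_p])
  also have "\<dots> = partial k (\<lambda>\<eta>. 1) x"
    by (rule partial_cong_open [OF open_interior x])
      (use simplex interior_subset in \<open>force simp: pos_simplex_def\<close>)
  also have "\<dots> = 0"
    by (simp add: partial_def)
  finally show "(\<Sum>i\<in>UNIV. dp i k x) = 0" .
qed

lemma sum_ddp_zero:
  assumes "x \<in> \<Theta>"
  shows "(\<Sum>i\<in>UNIV. partial a (dp i b) x) = 0"
proof (rule continuous_on_\<Theta>_zero [OF _ _ assms])
  show "continuous_on \<Theta> (\<lambda>x. \<Sum>i\<in>UNIV. partial a (dp i b) x)"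
    by (intro continuous_on_sum continuous_on_subset [OF C1_on_partial_continuous [OF C1_dp] U(2)])
  fix x
  assume x: "x \<in> interior \<Theta>"
  then have "x \<in> U"
    using U(2) interior_subset by blast
  then have "(\<Sum>i\<in>UNIV. partial a (dp i b) x) = partial a (\<lambda>\<eta>. \<Sum>i\<in>UNIV. dp i b \<eta>) x"
    by (simp add: partial_sum [OF C1_dp])
  also have "\<dots> = partial a (\<lambda>\<eta>. 0) x"
    by (rule partial_cong_open [OF open_interior x]) (use sum_dp_zero interior_subset in blast)
  also have "\<dots> = 0"
    by (simp add: partial_def)
  finally show "(\<Sum>i\<in>UNIV. partial a (dp i b) x) = 0" .
qed

text \<open>The full-rank Jacobian maps \<open>v\<close> to a nonzero vector of zero sum, a tangent
  vector of the simplex, on which the pseudo-inverse is positive.\<close>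

lemma G_pos:
  assumes x: "x \<in> \<Theta>" and "v \<noteq> 0"
  shows "0 < v \<bullet> (G x *v v)"
  unfolding G_inner_eq
proof (rule positive_laplacian.pinv_laplacian_pos)
  have xW: "x \<in> W"
    using x \<Theta>_W by blast
  then show "positive_laplacian E w (p x)"
    by (rule positive_laplacian)
  have "(\<Sum>i\<in>UNIV. (jacobian p (at x) *v v) $ i) = (\<Sum>i\<in>UNIV. \<Sum>k\<in>UNIV. dp i k x * v $ k)"
    using xW W_subset by (auto simp: matrix_vector_mult_def jacobian_entry subset_iff)
  also have "\<dots> = (\<Sum>k\<in>UNIV. (\<Sum>i\<in>UNIV. dp i k x) * v $ k)"
    by (subst sum.swap) (simp add: sum_distrib_right)
  finally show "(\<Sum>i\<in>UNIV. (jacobian p (at x) *v v) $ i) = 0"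
    by (simp add: sum_dp_zero [OF x])
  have "inj ((*v) (jacobian p (at x)))"
    using full_rank [OF x] by (simp add: full_rank_injective)
  then show "jacobian p (at x) *v v \<noteq> 0"
    using \<open>v \<noteq> 0\<close> by (metis injD matrix_vector_mult_0_right)
qed

lemma det_G_\<Theta>: "x \<in> \<Theta> \<Longrightarrow> det (G x) \<noteq> 0"
  by (rule det_nonzero_if_posdef) (rule G_pos)

end

section \<open>Second derivatives of the divergence along geodesics\<close>

lemma partial_const: "partial k (\<lambda>\<eta>. a) x = 0"
  by (simp add: partial_def)

lemma sum_matrix_vector_mult:
  "(\<Sum>k\<in>I. A k) *v u = (\<Sum>k\<in>I. A k *v u)" for A :: "_ \<Rightarrow> real^'n::finite^'m::finite"
  by (rule linear_sum [OF bounded_linear.linear [OF bounded_bilinear.bounded_linear_left [OF mvm_bilinear]]])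

context stat_model
begin

abbreviation "F q \<equiv> (\<lambda>\<eta>. KL (p \<eta>) q)"

lemma C1_ln_ratio:
  assumes "\<And>i. 0 < q $ i"
  shows "C1_on W (\<lambda>\<eta>. ln (p \<eta> $ i / q $ i))"
  using assms by (intro C1_on_ln C1_on_divide C1_p_W C1_on_const divide_pos_pos p_pos)
    (auto simp: less_imp_neq [THEN not_sym])

lemma partial_ln_ratio:
  assumes "\<And>i. 0 < q $ i" "x \<in> W"
  shows "partial k (\<lambda>\<eta>. ln (p \<eta> $ i / q $ i)) x = dp i k x / p x $ i"
proof -
  have C1: "C1_on W (\<lambda>\<eta>. (1 / q $ i) * p \<eta> $ i)"
    by (intro C1_on_mult C1_on_const C1_p_W)
  have "partial k (\<lambda>\<eta>. ln ((1 / q $ i) * p \<eta> $ i)) x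
      = partial k (\<lambda>\<eta>. (1 / q $ i) * p \<eta> $ i) x / ((1 / q $ i) * p x $ i)"
    by (rule partial_ln [OF C1 assms(2)]) (simp add: assms p_pos)
  also have "partial k (\<lambda>\<eta>. (1 / q $ i) * p \<eta> $ i) x = (1 / q $ i) * dp i k x"
    using partial_mult [where k = k and f = "\<lambda>\<eta>. 1 / q $ i", OF C1_on_const C1_p_W [of i] assms(2)]
    by (simp add: partial_const)
  finally show ?thesis
    using assms(1) [of i] by simp
qed

lemma C1_KL:
  assumes "\<And>i. 0 < q $ i"
  shows "C1_on W (F q)"
  unfolding KL_def by (intro C1_on_sum C1_on_mult C1_p_W C1_ln_ratio assms)

lemma partial_KL:
  assumes q: "\<And>i. 0 < q $ i" and x: "x \<in> W"
  shows "partial k (F q) x = (\<Sum>i\<in>UNIV. dp i k x * (ln (p x $ i / q $ i) + 1))"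
proof -
  have "partial k (\<lambda>\<eta>. p \<eta> $ i * ln (p \<eta> $ i / q $ i)) x = dp i k x * (ln (p x $ i / q $ i) + 1)" for i
    using partial_mult [where k = k, OF C1_p_W [of i] C1_ln_ratio [OF q, of i] x] p_pos [OF x, of i]
    by (simp add: partial_ln_ratio [OF q x] distrib_left)
  then show ?thesis
    unfolding KL_def
    by (subst partial_sum [where W = W]) (auto intro!: C1_on_mult C1_p_W C1_ln_ratio q x)
qed

lemma C1_partial_KL:
  assumes "\<And>i. 0 < q $ i"
  shows "C1_on W (partial k (F q))"
  by (rule C1_on_cong [OF _ open_W partial_KL [OF assms]])
    (intro C1_on_sum C1_on_mult C1_on_add C1_dp_W C1_ln_ratio C1_on_const assms)

lemma fisher_metric_entry:
  assumes "x \<in> W"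
  shows "fisher_metric p x $ a $ b = (\<Sum>i\<in>UNIV. dp i a x * dp i b x / p x $ i)"
proof -
  have "partial k (\<lambda>\<eta>. ln (p \<eta> $ i)) x = dp i k x / p x $ i" for i k
    by (rule partial_ln [OF C1_p_W assms p_pos [OF assms]])
  then show ?thesis
    using p_pos [OF assms] by (simp add: fisher_metric_def less_imp_neq [THEN not_sym])
qed

text \<open>The Hessian of the divergence in coordinates also contains \<open>\<Sum>i. \<partial>\<^sub>a \<partial>\<^sub>b p\<^sub>i\<close>, which vanishes as
  the \<open>p\<^sub>i\<close> sum to one.\<close>

lemma partial_partial_KL:
  assumes q: "\<And>i. 0 < q $ i" and x: "x \<in> \<Theta>"
  shows "partial a (partial b (F q)) x
    = (fisher_metric p x + (\<Sum>i\<in>UNIV. ln (p x $ i / q $ i) *\<^sub>R hess_p p i x)) $ a $ b"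
proof -
  have xW: "x \<in> W"
    using x \<Theta>_W by blast
  have C1: "C1_on W (\<lambda>\<eta>. ln (p \<eta> $ i / q $ i) + 1)" for i
    by (intro C1_on_add C1_ln_ratio q C1_on_const)
  have "partial a (partial b (F q)) x
      = partial a (\<lambda>\<eta>. \<Sum>i\<in>UNIV. dp i b \<eta> * (ln (p \<eta> $ i / q $ i) + 1)) x"
    by (rule partial_cong_open [OF open_W xW partial_KL [OF q]])
  also have "\<dots> = (\<Sum>i\<in>UNIV. partial a (\<lambda>\<eta>. dp i b \<eta> * (ln (p \<eta> $ i / q $ i) + 1)) x)"
    by (rule partial_sum [OF _ xW]) (intro C1_on_mult C1_dp_W C1)
  also have "\<dots> = (\<Sum>i\<in>UNIV. dp i a x * dp i b x / p x $ i
      + ln (p x $ i / q $ i) * partial a (dp i b) x + partial a (dp i b) x)"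
  proof (rule sum.cong [OF refl])
    fix i
    show "partial a (\<lambda>\<eta>. dp i b \<eta> * (ln (p \<eta> $ i / q $ i) + 1)) x
      = dp i a x * dp i b x / p x $ i + ln (p x $ i / q $ i) * partial a (dp i b) x + partial a (dp i b) x"
    proof -
      have "partial a (\<lambda>\<eta>. ln (p \<eta> $ i / q $ i) + 1) x = dp i a x / p x $ i"
        by (simp add: partial_add_const [OF C1_ln_ratio [OF q] xW] partial_ln_ratio [OF q xW])
      then show ?thesis
        unfolding partial_mult [OF C1_dp_W C1 xW] by (simp add: algebra_simps)
    qed
  qed
  also have "\<dots> = (\<Sum>i\<in>UNIV. dp i a x * dp i b x / p x $ i)
      + (\<Sum>i\<in>UNIV. ln (p x $ i / q $ i) * partial a (dp i b) x)"
    by (simp add: sum.distrib sum_ddp_zero [OF x])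
  finally show ?thesis
    by (simp add: fisher_metric_entry [OF xW] hess_p_def)
qed

text \<open>The covariant Hessian of the divergence with respect to the metric
  \<open>G\<close>.\<close>

definition riemannian_hessian :: "real^'n \<Rightarrow> real^'d \<Rightarrow> real^'d^'d" where
  "riemannian_hessian q x = fisher_metric p x + (\<Sum>i\<in>UNIV. ln (p x $ i / q $ i) *\<^sub>R hess_p p i x)
     - (\<Sum>k\<in>UNIV. partial k (F q) x *\<^sub>R christoffel E w p k x)"

lemma KL_along_curve:
  assumes q: "\<And>i. 0 < q $ i" and "\<gamma> t \<in> \<Theta>"
    and "(\<gamma> has_vector_derivative v t) (at t within S)"
  shows "((\<lambda>s. KL (p (\<gamma> s)) q) has_vector_derivative
    (\<Sum>k\<in>UNIV. v t $ k * partial k (F q) (\<gamma> t))) (at t within S)"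
  using C1_on_chain [OF C1_KL [OF q] _ assms(3)] assms(2) \<Theta>_W by auto

text \<open>Differentiating the partials produces the coordinate Hessian; differentiating
  \<open>v\<close> produces, through the geodesic equation, the Christoffel correction.\<close>

lemma KL_along_geodesic:
  assumes q: "\<And>i. 0 < q $ i" and x: "\<gamma> t \<in> \<Theta>"
    and d: "(\<gamma> has_vector_derivative v t) (at t within S)"
    and dd: "(v has_vector_derivative (\<chi> k. - (v t \<bullet> (christoffel E w p k (\<gamma> t) *v v t)))) (at t within S)"
  shows "((\<lambda>s. \<Sum>k\<in>UNIV. v s $ k * partial k (F q) (\<gamma> s)) has_vector_derivative
    v t \<bullet> (riemannian_hessian q (\<gamma> t) *v v t)) (at t within S)"
proof -
  let ?H = "fisher_metric p (\<gamma> t) + (\<Sum>i\<in>UNIV. ln (p (\<gamma> t) $ i / q $ i) *\<^sub>R hess_p p i (\<gamma> t))"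
  have xW: "\<gamma> t \<in> W"
    using x \<Theta>_W by blast
  have comp: "((\<lambda>s. v s $ k) has_vector_derivative - (v t \<bullet> (christoffel E w p k (\<gamma> t) *v v t))) (at t within S)" for k
    using bounded_linear.has_vector_derivative [OF bounded_linear_vec_nth dd, of k] by simp
  have "((\<lambda>s. \<Sum>k\<in>UNIV. v s $ k * partial k (F q) (\<gamma> s)) has_vector_derivative
      (\<Sum>k\<in>UNIV. v t $ k * (\<Sum>a\<in>UNIV. v t $ a * partial a (partial k (F q)) (\<gamma> t))
        + - (v t \<bullet> (christoffel E w p k (\<gamma> t) *v v t)) * partial k (F q) (\<gamma> t))) (at t within S)"
    by (intro has_vector_derivative_sum has_vector_derivative_mult comp
        C1_on_chain [OF C1_partial_KL [OF q] xW d])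
  moreover have "(\<Sum>k\<in>UNIV. v t $ k * (\<Sum>a\<in>UNIV. v t $ a * partial a (partial k (F q)) (\<gamma> t)))
      = v t \<bullet> (?H *v v t)"
    unfolding partial_partial_KL [OF q x] inner_matrix_vector_eq_sum sum_distrib_left
    by (subst sum.swap) (simp add: mult_ac)
  moreover have "v t \<bullet> ((\<Sum>k\<in>UNIV. partial k (F q) (\<gamma> t) *\<^sub>R christoffel E w p k (\<gamma> t)) *v v t)
      = (\<Sum>k\<in>UNIV. (v t \<bullet> (christoffel E w p k (\<gamma> t) *v v t)) * partial k (F q) (\<gamma> t))"
    by (simp add: sum_matrix_vector_mult
        inner_sum_right mult.commute flip: scaleR_matrix_vector_assoc)
  ultimately show ?thesis
    by (simp add: riemannian_hessian_def mvm_diff_left inner_diff_right sum.distrib sum_negf sum_subtractf)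
qed

lemma christoffel_continuous: "continuous_on \<Theta> (christoffel E w p k)"
proof (rule continuous_on_matrixI)
  fix i j
  have T: "continuous_on \<Theta> (partial a (\<lambda>\<eta>. G \<eta> $ b $ c))" for a b c
    by (rule continuous_on_subset [OF C1_on_partial_continuous [OF C1_G] \<Theta>_W])
  have "continuous_on \<Theta> (\<lambda>x. matrix_inv (G x))"
    by (intro continuous_on_matrix_inv continuous_on_subset [OF G_continuous \<Theta>_W] det_G_\<Theta>)
  then show "continuous_on \<Theta> (\<lambda>x. christoffel E w p k x $ i $ j)"
    unfolding christoffel_def vec_lambda_beta by (intro continuous_intros T)
qed

lemma riemannian_hessian_continuous:
  assumes q: "\<And>i. 0 < q $ i"
  shows "continuous_on \<Theta> (riemannian_hessian q)"
proof -
  note sub = continuous_on_subset [OF _ \<Theta>_W]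
  have "continuous_on \<Theta> (fisher_metric p)"
    unfolding fisher_metric_def
    by (intro continuous_intros sub C1_on_partial_continuous C1_on_ln C1_p_W p_pos
        C1_on_imp_continuous_on [OF C1_p_W])
  moreover have "continuous_on \<Theta> (hess_p p i)" for i
    unfolding hess_p_def by (intro continuous_intros sub C1_on_partial_continuous C1_dp_W)
  moreover have "continuous_on \<Theta> (\<lambda>x. ln (p x $ i / q $ i))" for i
    by (rule sub) (rule C1_on_imp_continuous_on [OF C1_ln_ratio [OF q]])
  moreover have "continuous_on \<Theta> (partial k (F q))" for k
    by (rule sub) (rule C1_on_partial_continuous [OF C1_KL [OF q]])
  ultimately show ?thesis
    unfolding riemannian_hessian_def
    by (intro continuous_on_diff continuous_on_add continuous_on_sum continuous_on_scaleR
        christoffel_continuous)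
qed

section \<open>From the matrix inequality to convexity along geodesics\<close>

lemma hessian_ge_imp_Ric_ge:
  assumes q: "\<And>i. 0 < q $ i"
    and hess: "\<And>x v. x \<in> \<Theta> \<Longrightarrow> 0 \<le> v \<bullet> ((riemannian_hessian q x - \<kappa> *\<^sub>R G x) *v v)"
  shows "Ric_ge E w \<Theta> p q \<kappa>"
  unfolding Ric_ge_def
proof (intro allI impI ballI)
  fix \<gamma> and t :: real
  assume "const_speed_geodesic E w \<Theta> p \<gamma>" and t: "t \<in> {0..1}"
  then obtain v where C1: "C1_curve \<Theta> \<gamma> v"
    and acc: "\<And>t. t \<in> {0..1} \<Longrightarrow> (v has_vector_derivative
      (\<chi> k. - (v t \<bullet> (christoffel E w p k (\<gamma> t) *v v t)))) (at t within {0..1})"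
    and speed: "\<And>t. t \<in> {0..1} \<Longrightarrow>
      sqrt (wass_inner E w p (\<gamma> t) (v t) (v t)) = wass_dist E w \<Theta> p (\<gamma> 0) (\<gamma> 1)"
    unfolding const_speed_geodesic_def by blast
  have \<gamma>: "\<gamma> t \<in> \<Theta>" "(\<gamma> has_vector_derivative v t) (at t within {0..1})" if "t \<in> {0..1}" for t
    using C1 that by (auto simp: C1_curve_def)
  let ?D = "wass_dist E w \<Theta> p (\<gamma> 0) (\<gamma> 1)"
  have "KL (p (\<gamma> t)) q \<le> (1 - t) * KL (p (\<gamma> 0)) q + t * KL (p (\<gamma> 1)) q
      - (\<kappa> * ?D\<^sup>2) / 2 * t * (1 - t)"
  proof (rule second_derivative_ge_imp_convex [OF KL_along_curve [OF q] KL_along_geodesic [OF q] _ t])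
    fix t :: real
    assume t: "t \<in> {0..1}"
    have "0 \<le> v t \<bullet> (G (\<gamma> t) *v v t)"
      using G_nonneg \<gamma>(1) [OF t] \<Theta>_W by blast
    then have "?D\<^sup>2 = v t \<bullet> (G (\<gamma> t) *v v t)"
      using speed [OF t] by (simp add: wass_inner_def flip: speed [OF t])
    then show "\<kappa> * ?D\<^sup>2 \<le> v t \<bullet> (riemannian_hessian q (\<gamma> t) *v v t)"
      using hess [OF \<gamma>(1) [OF t], of "v t"]
      by (simp add: mvm_diff_left inner_diff_right flip: scaleR_matrix_vector_assoc)
  qed (use \<gamma> acc in auto)
  then show "KL (p (\<gamma> t)) q \<le> (1 - t) * KL (p (\<gamma> 0)) q + t * KL (p (\<gamma> 1)) q
      - \<kappa> / 2 * t * (1 - t) * (wass_dist E w \<Theta> p (\<gamma> 0) (\<gamma> 1))\<^sup>2"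
    by (simp add: mult_ac)
qed

section \<open>From convexity along geodesics to the matrix inequality\<close>

definition DG :: "real^'d \<Rightarrow> real^'d \<Rightarrow> real^'d^'d" where
  "DG x h = (\<chi> a b. \<Sum>k\<in>UNIV. h $ k * partial k (\<lambda>\<eta>. G \<eta> $ a $ b) x)"

lemma G_has_derivative:
  assumes "x \<in> W"
  shows "(G has_derivative DG x) (at x)"
  using C1_on_has_derivative [OF C1_G assms]
  by (simp add: has_derivative_componentwise_within [of G] Basis_vec_def inner_axis DG_def)

lemma DG_continuous: "continuous_on W (\<lambda>x. DG x h)"
  unfolding DG_def by (intro continuous_intros C1_on_partial_continuous [OF C1_G])

text \<open>\<open>l\<close> and \<open>L\<close> are the extrema of the quadratic form on the
  compact product of ball and unit sphere; \<open>l\<close> is attained over a point of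
  \<open>\<Theta>\<close> and therefore positive.\<close>

lemma ex_riemannian_ball:
  assumes "0 < r" and sub: "cball c r \<subseteq> \<Theta>"
  obtains l L where "riemannian_ball G DG c r l L"
proof -
  let ?S = "cball c r \<times> sphere (0 :: real^'d) 1"
  have subW: "cball c r \<subseteq> W"
    using sub \<Theta>_W by blast
  have "continuous_on ?S (\<lambda>z. snd z \<bullet> (G (fst z) *v snd z))"
    by (intro continuous_intros continuous_on_compose2 [OF continuous_on_subset [OF G_continuous subW]]) auto
  moreover have "compact ?S"
    by (intro compact_Times compact_cball compact_sphere)
  moreover have "(c, axis undefined 1) \<in> ?S"
    using \<open>0 < r\<close> by (simp add: norm_axis_1)
  then have "?S \<noteq> {}"
    by blast
  ultimately obtain z1 z2
    where z1: "z1 \<in> ?S" "\<forall>z\<in>?S. snd z1 \<bullet> (G (fst z1) *v snd z1) \<le> snd z \<bullet> (G (fst z) *v snd z)"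
      and z2: "z2 \<in> ?S" "\<forall>z\<in>?S. snd z \<bullet> (G (fst z) *v snd z) \<le> snd z2 \<bullet> (G (fst z2) *v snd z2)"
    using continuous_attains_inf [of ?S "\<lambda>z. snd z \<bullet> (G (fst z) *v snd z)"]
      continuous_attains_sup [of ?S "\<lambda>z. snd z \<bullet> (G (fst z) *v snd z)"] by blast
  define l where "l = snd z1 \<bullet> (G (fst z1) *v snd z1)"
  define L where "L = snd z2 \<bullet> (G (fst z2) *v snd z2)"
  have "snd z1 \<noteq> 0"
    using z1(1) by (cases z1) auto
  then have "0 < l"
    unfolding l_def using z1(1) sub by (intro G_pos) auto
  have scale: "(a *\<^sub>R u) \<bullet> (G x *v (a *\<^sub>R u)) = a\<^sup>2 * (u \<bullet> (G x *v u))" for a u x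
    by (simp add: mvm_scaleR power2_eq_square)
  have bounds: "l * (norm v)\<^sup>2 \<le> v \<bullet> (G x *v v) \<and> v \<bullet> (G x *v v) \<le> L * (norm v)\<^sup>2"
    if x: "x \<in> cball c r" for x v
  proof (cases "v = 0")
    case False
    define e where "e = (1 / norm v) *\<^sub>R v"
    have e: "(x, e) \<in> ?S"
      using x False by (simp add: e_def)
    have "norm v *\<^sub>R e = v"
      using False by (simp add: e_def)
    then have "v \<bullet> (G x *v v) = (norm v)\<^sup>2 * (e \<bullet> (G x *v e))"
      using scale [of "norm v" e x] by simp
    moreover have "l \<le> e \<bullet> (G x *v e)" "e \<bullet> (G x *v e) \<le> L"
      using bspec [OF z1(2) e] bspec [OF z2(2) e] by (simp_all add: l_def L_def)
    ultimately show ?thesis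
      by (simp add: mult.commute [of _ "(norm v)\<^sup>2"] mult_left_mono)
  qed simp
  have "riemannian_ball G DG c r l L"
    by unfold_locales
      (use \<open>0 < r\<close> \<open>0 < l\<close> bounds subW G_has_derivative transpose_G continuous_on_subset [OF DG_continuous subW]
        in auto)
  then show ?thesis
    by (rule that)
qed

text \<open>Contracted twice with \<open>v\<close>, the first two Christoffel terms agree after
  exchanging summation indices and give \<open>DG x v v\<close>; the third gives
  \<open>gforce\<close>.\<close>

lemma geodesic_acc_eq_christoffel:
  assumes "riemannian_ball G DG c r l L" and x: "x \<in> W"
  shows "riemannian_ball.geodesic_acc G DG x v = (\<chi> k. - (v \<bullet> (christoffel E w p k x *v v)))"
proof (rule vec_eq_iff [THEN iffD2], rule allI)
  interpret riemannian_ball G DG c r l L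
    by fact
  fix k
  define T where "T a b c = partial a (\<lambda>\<eta>. G \<eta> $ b $ c) x" for a b c
  define g where "g = matrix_inv (G x) $ k"
  have T_sym: "T a b c = T a c b" for a b c
    unfolding T_def
  proof (rule partial_cong_open [OF open_W x])
    show "G y $ b $ c = G y $ c $ b" if "y \<in> W" for y
      using arg_cong [OF transpose_G [OF that], of "\<lambda>A. A $ c $ b"] by (simp add: transpose_def)
  qed
  define S1 where "S1 l = (\<Sum>i\<in>UNIV. \<Sum>j\<in>UNIV. v $ i * v $ j * T i j l)" for l
  define S3 where "S3 l = (\<Sum>i\<in>UNIV. \<Sum>j\<in>UNIV. v $ i * v $ j * T l i j)" for l
  have S1_swap: "(\<Sum>i\<in>UNIV. \<Sum>j\<in>UNIV. v $ i * v $ j * T j i l) = S1 l" for l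
    unfolding S1_def by (subst sum.swap) (simp add: mult_ac)
  have "v \<bullet> (christoffel E w p k x *v v)
      = (\<Sum>i\<in>UNIV. \<Sum>j\<in>UNIV. \<Sum>l\<in>UNIV. v $ i * v $ j * (1/2 * (g $ l * (T i j l + T j i l - T l i j))))"
    by (simp add: inner_matrix_vector_eq_sum christoffel_def T_def g_def sum_distrib_left)
  also have "\<dots> = (\<Sum>i\<in>UNIV. \<Sum>l\<in>UNIV. \<Sum>j\<in>UNIV. v $ i * v $ j * (1/2 * (g $ l * (T i j l + T j i l - T l i j))))"
    by (rule sum.cong [OF refl]) (rule sum.swap)
  also have "\<dots> = (\<Sum>l\<in>UNIV. \<Sum>i\<in>UNIV. \<Sum>j\<in>UNIV. v $ i * v $ j * (1/2 * (g $ l * (T i j l + T j i l - T l i j))))"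
    by (rule sum.swap)
  also have "\<dots> = (\<Sum>l\<in>UNIV. g $ l * (1/2 * (S1 l
      + (\<Sum>i\<in>UNIV. \<Sum>j\<in>UNIV. v $ i * v $ j * T j i l) - S3 l)))"
    unfolding S1_def S3_def sum_distrib_left sum.distrib [symmetric] sum_subtractf [symmetric]
    by (intro sum.cong refl) (simp add: algebra_simps)
  also have "\<dots> = (\<Sum>l\<in>UNIV. g $ l * (S1 l - 1/2 * S3 l))"
    unfolding S1_swap by (simp add: field_simps)
  finally have chr: "v \<bullet> (christoffel E w p k x *v v) = (\<Sum>l\<in>UNIV. g $ l * (S1 l - 1/2 * S3 l))" .
  have "gforce x v $ l = S3 l" for l
    by (simp add: gforce_def inner_matrix_vector_eq_sum DG_def S3_def T_def axis_def
        if_distrib if_distribR cong: if_cong)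
  moreover have "(DG x v *v v) $ l = S1 l" for l
  proof -
    have "(DG x v *v v) $ l = (\<Sum>j\<in>UNIV. \<Sum>i\<in>UNIV. v $ i * v $ j * T i l j)"
      by (simp add: matrix_vector_mult_def DG_def T_def sum_distrib_left sum_distrib_right mult_ac)
    also have "\<dots> = S1 l"
      unfolding S1_def by (subst sum.swap) (simp add: T_sym [of _ l])
    finally show ?thesis .
  qed
  ultimately have "geodesic_acc x v $ k = (\<Sum>l\<in>UNIV. g $ l * (1/2 * S3 l - S1 l))"
    by (simp add: geodesic_acc_def matrix_vector_mult_def g_def)
  also have "\<dots> = - (v \<bullet> (christoffel E w p k x *v v))"
    unfolding chr sum_negf [symmetric] by (intro sum.cong refl) (simp add: algebra_simps)
  finally show "geodesic_acc x v $ k = (\<chi> k. - (v \<bullet> (christoffel E w p k x *v v))) $ k"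
    by simp
qed

text \<open>Minimality is known among curves in the ball, whereas \<open>wass_dist\<close> ranges
  over all curves in \<open>\<Theta>\<close>. A curve leaving the ball has energy at least
  \<open>l r^2\<close>, hence at least \<open>e\<close>, so the local minimum is global.\<close>

lemma short_curve_is_const_speed_geodesic:
  assumes ball: "riemannian_ball G DG c r l L" and sub: "cball c r \<subseteq> \<Theta>"
    and x0: "x 0 = c" and x: "\<And>t. t \<in> {0..1} \<Longrightarrow> x t \<in> cball c r"
    and dx: "\<And>t. t \<in> {0..1} \<Longrightarrow> (x has_vector_derivative v t) (at t within {0..1})"
    and dv: "\<And>t. t \<in> {0..1} \<Longrightarrow>
      (v has_vector_derivative riemannian_ball.geodesic_acc G DG (x t) (v t)) (at t within {0..1})"
    and const: "\<And>t. t \<in> {0..1} \<Longrightarrow> v t \<bullet> (G (x t) *v v t) = e" and "e \<le> l * r\<^sup>2"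
    and minimal: "\<And>\<eta> \<eta>'. (\<And>t. t \<in> {0..1} \<Longrightarrow> \<eta> t \<in> cball c r) \<Longrightarrow>
      (\<And>t. t \<in> {0..1} \<Longrightarrow> (\<eta> has_vector_derivative \<eta>' t) (at t within {0..1})) \<Longrightarrow>
      continuous_on {0..1} \<eta>' \<Longrightarrow> \<eta> 0 = c \<Longrightarrow> \<eta> 1 = x 1 \<Longrightarrow>
      e \<le> integral {0..1} (\<lambda>t. \<eta>' t \<bullet> (G (\<eta> t) *v \<eta>' t))"
  shows "wass_dist E w \<Theta> p (x 0) (x 1) = sqrt e" and "const_speed_geodesic E w \<Theta> p x"
proof -
  interpret riemannian_ball G DG c r l L
    by fact
  have v_cont: "continuous_on {0..1} v"
    using dv by (rule continuous_on_vector_derivative)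
  have C1: "C1_curve \<Theta> x v"
    unfolding C1_curve_def using x sub dx v_cont by blast
  have "integral {0..1} (\<lambda>t. wass_inner E w p (x t) (v t) (v t)) = integral {0..1::real} (\<lambda>t. e)"
    by (rule integral_cong) (simp add: wass_inner_def const)
  then have energy: "integral {0..1} (\<lambda>t. wass_inner E w p (x t) (v t) (v t)) = e"
    by simp
  have "e \<le> integral {0..1} (\<lambda>t. wass_inner E w p (\<eta> t) (\<eta>' t) (\<eta>' t))"
    if \<eta>: "C1_curve \<Theta> \<eta> \<eta>'" and ends: "\<eta> 0 = x 0" "\<eta> 1 = x 1" for \<eta> \<eta>'
  proof (cases "\<forall>t\<in>{0..1}. \<eta> t \<in> cball c r")
    case True
    then show ?thesis
      unfolding wass_inner_def
      using \<eta> ends x0 by (intro minimal) (auto simp: C1_curve_def)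
  next
    case False
    then obtain t where t: "t \<in> {0..1}" "\<eta> t \<notin> cball c r"
      by blast
    have d\<eta>: "\<And>t. t \<in> {0..1} \<Longrightarrow> (\<eta> has_vector_derivative \<eta>' t) (at t within {0..1})"
      and \<eta>_in: "\<And>t. t \<in> {0..1} \<Longrightarrow> \<eta> t \<in> W" and c\<eta>: "continuous_on {0..1} \<eta>'"
      using \<eta> \<Theta>_W by (auto simp: C1_curve_def)
    have "continuous_on {0..1} \<eta>"
      using d\<eta> by (rule continuous_on_vector_derivative)
    then have "continuous_on {0..1} (\<lambda>t. \<eta>' t \<bullet> (G (\<eta> t) *v \<eta>' t))"
      using \<eta>_in by (intro continuous_intros c\<eta> continuous_on_compose2 [OF G_continuous]) auto
    then have "l * r\<^sup>2 \<le> integral {0..1} (\<lambda>t. wass_inner E w p (\<eta> t) (\<eta>' t) (\<eta>' t))"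
      unfolding wass_inner_def using G_nonneg \<eta>_in x0 ends t
      by (intro leaving_ball_energy [OF d\<eta> c\<eta> _ t]) (auto simp: gq_def)
    then show ?thesis
      using \<open>e \<le> l * r\<^sup>2\<close> by linarith
  qed
  then have "Inf {integral {0..1} (\<lambda>t. wass_inner E w p (\<eta> t) (\<eta>' t) (\<eta>' t)) | \<eta> \<eta>'.
      C1_curve \<Theta> \<eta> \<eta>' \<and> \<eta> 0 = x 0 \<and> \<eta> 1 = x 1} = e"
    using C1 energy by (intro cInf_eq_minimum) blast+
  then show dist: "wass_dist E w \<Theta> p (x 0) (x 1) = sqrt e"
    by (simp add: wass_dist_def)
  show "const_speed_geodesic E w \<Theta> p x"
    unfolding const_speed_geodesic_def dist
  proof (intro exI [of _ v] conjI ballI)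
    fix t :: real
    assume t: "t \<in> {0..1}"
    have "x t \<in> W"
      using x [OF t] sub \<Theta>_W by blast
    then show "(v has_vector_derivative (\<chi> k. - (v t \<bullet> (christoffel E w p k (x t) *v v t)))) (at t within {0..1})"
      using dv [OF t] by (simp add: geodesic_acc_eq_christoffel [OF ball])
    show "sqrt (wass_inner E w p (x t) (v t) (v t)) = sqrt e"
      by (simp add: wass_inner_def const [OF t])
  qed (rule C1)
qed

text \<open>The form \<open>D\<close> is homogeneous of degree two in the velocity, so velocities of
  the short geodesic may be rescaled by \<open>1 / s\<close>. They then stay near \<open>v0\<close>,
  and \<open>D\<close> is at most \<open>- \<delta> s^2\<close> along the whole curve.\<close>

lemma Ric_ge_imp_hessian_ge_interior:
  assumes q: "\<And>i. 0 < q $ i" and Ric: "Ric_ge E w \<Theta> p q \<kappa>" and c: "c \<in> interior \<Theta>"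
  shows "0 \<le> v0 \<bullet> ((riemannian_hessian q c - \<kappa> *\<^sub>R G c) *v v0)"
proof (rule ccontr)
  define D where "D z = snd z \<bullet> ((riemannian_hessian q (fst z) - \<kappa> *\<^sub>R G (fst z)) *v snd z)" for z
  assume "\<not> 0 \<le> v0 \<bullet> ((riemannian_hessian q c - \<kappa> *\<^sub>R G c) *v v0)"
  then have neg: "D (c, v0) < 0"
    by (simp add: D_def)
  define \<delta> where "\<delta> = - D (c, v0) / 2"
  have \<delta>: "0 < \<delta>"
    using neg by (simp add: \<delta>_def)
  have D_scale: "D (x, a *\<^sub>R v) = a\<^sup>2 * D (x, v)" for x a v
    by (simp add: D_def mvm_scaleR power2_eq_square)
  have "continuous_on (\<Theta> \<times> UNIV) D"
    unfolding D_def
    by (intro continuous_intros continuous_on_compose2 [OF riemannian_hessian_continuous [OF q]]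
        continuous_on_compose2 [OF continuous_on_subset [OF G_continuous \<Theta>_W]]) auto
  then have "\<exists>d>0. \<forall>z\<in>\<Theta> \<times> UNIV. dist z (c, v0) < d \<longrightarrow> dist (D z) (D (c, v0)) < \<delta>"
    using c interior_subset \<delta> unfolding continuous_on_iff by blast
  then obtain d where "0 < d"
    and d: "\<And>z. z \<in> \<Theta> \<times> UNIV \<Longrightarrow> dist z (c, v0) < d \<Longrightarrow> dist (D z) (D (c, v0)) < \<delta>"
    by blast
  obtain r0 where "0 < r0" "cball c r0 \<subseteq> \<Theta>"
    using c by (meson interior_subset open_contains_cball open_interior order_trans)
  \<comment> \<open>Position and rescaled velocity may each deviate by \<open>d / 3\<close>, which
    keeps the pair within \<open>d\<close> of \<open>(c, v0)\<close>.\<close>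
  define r where "r = min r0 (d / 3)"
  have r: "0 < r" "r \<le> d / 3" "cball c r \<subseteq> \<Theta>"
    using \<open>0 < r0\<close> \<open>0 < d\<close> \<open>cball c r0 \<subseteq> \<Theta>\<close> by (auto simp: r_def)
  have D_neg: "D (x, v) \<le> - \<delta>" if "x \<in> cball c r" "norm (v - v0) \<le> d / 3" for x v
  proof -
    have "dist (x, v) (c, v0) \<le> dist x c + dist v v0"
      unfolding dist_Pair_Pair by (rule sqrt_sum_squares_le_sum) auto
    also have "\<dots> < d"
      using that r(2) \<open>0 < d\<close> by (simp add: dist_norm norm_minus_commute)
    finally have "dist (D (x, v)) (D (c, v0)) < \<delta>"
      using that(1) r(3) by (intro d) auto
    then show ?thesis
      by (simp add: \<delta>_def dist_real_def abs_less_iff)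
  qed
  obtain l L where ball: "riemannian_ball G DG c r l L"
    by (rule ex_riemannian_ball [OF r(1,3)])
  interpret riemannian_ball G DG c r l L
    by (rule ball)
  have "0 < d / 3"
    using \<open>0 < d\<close> by simp
  then obtain s x v where s: "0 < s" and x0: "x 0 = c"
    and x: "\<And>t. t \<in> {0..1} \<Longrightarrow> x t \<in> cball c r"
    and dx: "\<And>t. t \<in> {0..1} \<Longrightarrow> (x has_vector_derivative v t) (at t within {0..1})"
    and dv: "\<And>t. t \<in> {0..1} \<Longrightarrow>
      (v has_vector_derivative geodesic_acc (x t) (v t)) (at t within {0..1})"
    and const: "\<And>t. t \<in> {0..1} \<Longrightarrow> gq (x t) (v t) = gq (x 0) (v 0)"
    and direction: "\<And>t. t \<in> {0..1} \<Longrightarrow> norm ((1 / s) *\<^sub>R v t - v0) \<le> d / 3"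
    and short: "gq (x 0) (v 0) \<le> l * r\<^sup>2"
    and minimal: "\<And>\<eta> \<eta>'. (\<And>t. t \<in> {0..1} \<Longrightarrow> \<eta> t \<in> cball c r) \<Longrightarrow>
      (\<And>t. t \<in> {0..1} \<Longrightarrow> (\<eta> has_vector_derivative \<eta>' t) (at t within {0..1})) \<Longrightarrow>
      continuous_on {0..1} \<eta>' \<Longrightarrow> \<eta> 0 = c \<Longrightarrow> \<eta> 1 = x 1 \<Longrightarrow>
      gq (x 0) (v 0) \<le> integral {0..1} (\<lambda>t. gq (\<eta> t) (\<eta>' t))"
    by (rule ex_short_minimizing_geodesic [where ?v0.0 = v0]) blast
  define e where "e = gq (x 0) (v 0)"
  have speed: "v t \<bullet> (G (x t) *v v t) = e" if "t \<in> {0..1}" for t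
    using const [OF that] by (simp add: e_def gq_def)
  have geo: "wass_dist E w \<Theta> p (x 0) (x 1) = sqrt e" "const_speed_geodesic E w \<Theta> p x"
    using short_curve_is_const_speed_geodesic [OF ball r(3) x0 x dx dv speed short [folded e_def]
        minimal [folded e_def, unfolded gq_def]] by blast+
  have "x 0 \<in> cball c r"
    by (rule x) simp
  then have "x 0 \<in> W"
    using r(3) \<Theta>_W by blast
  then have "0 \<le> e"
    using G_nonneg [of "x 0" "v 0"] speed [of 0] by simp
  then have dist: "(wass_dist E w \<Theta> p (x 0) (x 1))\<^sup>2 = e"
    by (simp add: geo(1))
  let ?f = "\<lambda>t. KL (p (x t)) q"
  have x\<Theta>: "x t \<in> \<Theta>" if "t \<in> {0..1}" for t
    using x [OF that] r(3) by blast
  have acc: "(v has_vector_derivative (\<chi> k. - (v t \<bullet> (christoffel E w p k (x t) *v v t)))) (at t within {0..1})"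
    if t: "t \<in> {0..1}" for t
    using dv [OF t] geodesic_acc_eq_christoffel [OF ball] x\<Theta> [OF t] \<Theta>_W by (simp add: subset_iff)
  have f'': "v t \<bullet> (riemannian_hessian q (x t) *v v t) \<le> \<kappa> * e - \<delta> * s\<^sup>2" if t: "t \<in> {0..1}" for t
  proof -
    have "s\<^sup>2 * D (x t, (1 / s) *\<^sub>R v t) \<le> s\<^sup>2 * - \<delta>"
      by (intro mult_left_mono D_neg x t direction) simp
    then have "D (x t, v t) \<le> - (\<delta> * s\<^sup>2)"
      using s by (simp add: D_scale power_divide mult.commute)
    then show ?thesis
      by (simp add: D_def mvm_diff_left inner_diff_right speed [OF t] flip: scaleR_matrix_vector_assoc)
  qed
  \<comment> \<open>The upper bound on the second derivative of \<open>?f\<close> is a lower bound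
    for \<open>- ?f\<close>. The resulting lower bound for \<open>?f\<close> at the midpoint exceeds
    the upper bound from \<open>Ric\<close> by \<open>\<delta> s^2 / 8\<close>.\<close>
  have "- ?f (1/2) \<le> (1 - 1/2) * - ?f 0 + 1/2 * - ?f 1 - (- (\<kappa> * e - \<delta> * s\<^sup>2)) / 2 * (1/2) * (1 - 1/2)"
  proof (rule second_derivative_ge_imp_convex
      [where f = "\<lambda>t. - ?f t" and f' = "\<lambda>t. - (\<Sum>k\<in>UNIV. v t $ k * partial k (F q) (x t))"
        and f'' = "\<lambda>t. - (v t \<bullet> (riemannian_hessian q (x t) *v v t))"])
    fix t :: real
    assume t: "t \<in> {0..1}"
    show "((\<lambda>t. - ?f t) has_vector_derivative - (\<Sum>k\<in>UNIV. v t $ k * partial k (F q) (x t)))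
        (at t within {0..1})"
      by (intro has_vector_derivative_minus KL_along_curve q x\<Theta> dx t)
    show "((\<lambda>t. - (\<Sum>k\<in>UNIV. v t $ k * partial k (F q) (x t))) has_vector_derivative
        - (v t \<bullet> (riemannian_hessian q (x t) *v v t))) (at t within {0..1})"
      by (intro has_vector_derivative_minus KL_along_geodesic q x\<Theta> dx acc t)
    show "- (\<kappa> * e - \<delta> * s\<^sup>2) \<le> - (v t \<bullet> (riemannian_hessian q (x t) *v v t))"
      using f'' [OF t] by linarith
  qed simp
  moreover have "?f (1/2) \<le> (1 - 1/2) * ?f 0 + 1/2 * ?f 1 - \<kappa> / 2 * (1/2) * (1 - 1/2) * e"
    using Ric [unfolded Ric_ge_def, rule_format, OF geo(2), of "1/2"] by (simp add: dist)
  ultimately have "\<delta> * s\<^sup>2 \<le> 0"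
    by (simp add: field_simps)
  then show False
    using \<delta> s by (simp add: mult_le_0_iff)
qed

lemma Ric_ge_imp_hessian_ge:
  assumes q: "\<And>i. 0 < q $ i" and Ric: "Ric_ge E w \<Theta> p q \<kappa>" and x: "x \<in> \<Theta>"
  shows "0 \<le> v \<bullet> ((riemannian_hessian q x - \<kappa> *\<^sub>R G x) *v v)"
proof (rule nonneg_on_closure [OF _ interior_subset x])
  show "continuous_on \<Theta> (\<lambda>x. v \<bullet> ((riemannian_hessian q x - \<kappa> *\<^sub>R G x) *v v))"
    by (intro continuous_intros riemannian_hessian_continuous q continuous_on_subset [OF G_continuous \<Theta>_W])
qed (use x dense Ric_ge_imp_hessian_ge_interior [OF q Ric] in auto)

end

theorem theorem8:
  fixes E :: "('n::finite \<times> 'n) set" and w :: "real^'n^'n"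
    and \<Theta> :: "(real^'d::finite) set" and p :: "real^'d \<Rightarrow> real^'n"
    and q :: "real^'n" and \<kappa> :: real
  assumes "weighted_graph E w"
    and "parametrized_model \<Theta> p"
    and "q \<in> pos_simplex"
    and "compact \<Theta>"
  shows "Ric_ge E w \<Theta> p q \<kappa> \<longleftrightarrow>
    (\<forall>\<theta>\<in>\<Theta>.
       fisher_metric p \<theta>
       + (\<Sum>i\<in>UNIV. ln (p \<theta> $ i / q $ i) *\<^sub>R hess_p p i \<theta>)
       - (\<Sum>k\<in>UNIV. partial k (\<lambda>\<eta>. KL (p \<eta>) q) \<theta> *\<^sub>R christoffel E w p k \<theta>)
       \<succeq> \<kappa> *\<^sub>R wass_metric E w p \<theta>)"
proof -
  obtain U where U: "open U" "\<Theta> \<subseteq> U" "C2_on U p"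
    using assms(2) unfolding parametrized_model_def by blast
  have "CARD('d) \<le> CARD('n) - 1"
    using assms(2) by (simp add: parametrized_model_def)
  \<comment> \<open>The index type of the parameters is nonempty, so the dimension bound forces at
    least two vertices.\<close>
  moreover have "0 < CARD('d)"
    by simp
  ultimately have "2 \<le> CARD('n)"
    by linarith
  then interpret stat_model E w \<Theta> p U
    using assms(1,2) U by unfold_locales (auto simp: parametrized_model_def)
  have q: "0 < q $ i" for i
    using assms(3) by (simp add: pos_simplex_def)
  show ?thesis
    unfolding loewner_ge_def riemannian_hessian_def [symmetric]
    using Ric_ge_imp_hessian_ge [OF q] hessian_ge_imp_Ric_ge [OF q] by blast
qed

end
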